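(* Let $(X,d,\mu)$ be a metric measure space such that (i) $\mu$ is a locally finite Borel-regular measure with dense support, (ii) $X$ is locally compact, (iii) $X$ is $\alpha$-regular for some $\alpha>1$, and (iv) $X$ admits a weak $(1,p)$-Poincaré inequality for some $p\in[1,\alpha)$. Let $f$ be an $\eta$-quasisymmetric mapping of $(X,d,\mu)$ onto itself. Let $\widehat J_f$ be the generalised Jacobian of $f$ with respect to the metric $d$. Then $\widehat J_f(x)$ exists and is finite for $\mu$-almost every $x\in X$, and $\log\widehat J_f\in\mathrm{BMO}(X,d,\mu)$.
   Context: A metric measure space $(X,d,\mu)$ is a set $X$ with a metric $d$ and a doubling measure $\mu$: balls $\widehat B(x,r)=\{y:d(x,y)<r\}$ are $\mu$-measurable and there is $A_1\ge1$ with $0<\mu(\widehat B(x,2r))\le A_1\mu(\widehat B(x,r))<\infty$ for all $x\in X$, $r>0$. The measure $\mu$ is defined on a $\sigma$-algebra containing all Borel sets and all balls. $\mu$ is Borel regular if for all Borel sets $E\subset X$, $\mu(E)=\sup\{\mu(V):V\text{ closed},V\subset E\}=\inf\{\mu(U):U\text{ open},E\subset U\}$. $X$ is locally compact if for each $x\in X$ there are an open set $O$ and a compact set $K$ with $x\in O\subset K$. $X$ is $\alpha$-regular (Ahlfors regular of dimension $\alpha$) if there is $\kappa\ge1$ such that $\kappa^{-1}r^\alpha\le\mu(\widehat B_r)\le\kappa r^\alpha$ for every ball $\widehat B_r$ of radius $r<\operatorname{diam}X$. For an open set $U\subset X$ and a real-valued function $u$ on $U$, a Borel function $\varrho:U\to[0,\infty]$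 is a very weak gradient (upper gradient) of $u$ in $U$ if $|u(x)-u(y)|\le\int_{\gamma_{xy}}\varrho\,ds$ for each rectifiable curve $\gamma_{xy}$ joining two points $x,y$ in $U$. For $p\ge1$, $(X,d,\mu)$ admits a weak $(1,p)$-Poincaré inequality if there are constants $C_p,C_0\ge1$ such that for every ball $B$, $$\frac1{\mu(B)}\int_B|u-u_B|\,d\mu\le C_p(\operatorname{diam}B)\Big(\frac1{\mu(C_0B)}\int_{C_0B}\varrho^p\,d\mu\Big)^{1/p}$$ whenever $u$ is a bounded continuous function on the ball $C_0B$ (concentric, radius multiplied by $C_0$) and $\varrho$ is a very weak gradient of $u$ there; here $u_B=\frac1{\mu(B)}\int_Bu\,d\mu$, and the constants are independent of $B$ and $u$. A homeomorphism $f:(X,d)\to(X,d)$ is $\eta$-quasisymmetric if $\eta:[0,\infty)\to[0,\infty)$ is an increasing homeomorphism and for all $\theta\ge0$ and all distinct $x,a,b\in X$, $\frac{d(x,a)}{d(x,b)}\le\theta$ implies $\frac{d(f(x),f(a))}{d(f(x),f(b))}\le\eta(\theta)$. The pullback measure is $\mu_f(E):=\mu(f(E))$, and the generalised Jacobian of $f$ with respect to $d$ is $$\widehat J_f(x):=\lim_{r\to0^+}\frac{\mu_f(\overline B_d(x,r))}{\mu(\overline B_d(x,r))},\qquad \overline B_d(x,r)=\{y\in X:d(x,y)\le r\}.$$ A locally integrable real-valued function $g$ on $X$ is in $\mathrm{BMO}(X,d,\mu)$ if $\sup_{\widehat B}\frac1{\mu(\widehat B)}\int_{\widehat B}|g-g_{\widehat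 B}|\,d\mu<\infty$, the supremum over all balls, where $g_{\widehat B}$ is the $\mu$-average of $g$ over $\widehat B$. *)

theory Defs
  imports "HOL-Analysis.Analysis"
begin

text \<open>The metric space is a type of class \<open>metric_space\<close>; open balls are \<open>ball x r\<close> with \<open>r > 0\<close>,
  closed balls \<open>cball x r\<close>. A measure lives on a sigma-algebra that may be larger than the Borel one.\<close>

definition doubling :: "'a::metric_space measure \<Rightarrow> bool" where
  "doubling M \<longleftrightarrow> (\<exists>A\<ge>1::real. \<forall>x. \<forall>r>0.
      0 < emeasure M (ball x (2 * r)) \<and>
      emeasure M (ball x (2 * r)) \<le> ennreal A * emeasure M (ball x r) \<and>
      ennreal A * emeasure M (ball x r) < \<infinity>)"

definition metric_measure_space :: "'a::metric_space measure \<Rightarrow> bool" where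
  "metric_measure_space M \<longleftrightarrow> space M = UNIV \<and> sets borel \<subseteq> sets M \<and> doubling M"

definition locally_finite_measure :: "'a::topological_space measure \<Rightarrow> bool" where
  "locally_finite_measure M \<longleftrightarrow> (\<forall>x. \<exists>U. open U \<and> x \<in> U \<and> emeasure M U < \<infinity>)"

definition borel_regular :: "'a::topological_space measure \<Rightarrow> bool" where
  "borel_regular M \<longleftrightarrow> (\<forall>E\<in>sets borel.
      emeasure M E = (SUP V\<in>{V. closed V \<and> V \<subseteq> E}. emeasure M V) \<and>
      emeasure M E = (INF U\<in>{U. open U \<and> E \<subseteq> U}. emeasure M U))"

definition measure_support :: "'a::topological_space measure \<Rightarrow> 'a set" where
  "measure_support M = {x. \<forall>U. open U \<and> x \<in> U \<longrightarrow> 0 < emeasure M U}"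

text \<open>The library's \<open>diameter\<close> is unspecified on unbounded sets, so the diameter of the
  whole space is taken in the extended reals.\<close>

definition ext_diameter :: "'a::metric_space set \<Rightarrow> ereal" where
  "ext_diameter S = (SUP (x, y)\<in>S \<times> S. ereal (dist x y))"

definition ahlfors_regular :: "'a::metric_space measure \<Rightarrow> real \<Rightarrow> bool" where
  "ahlfors_regular M \<alpha> \<longleftrightarrow> (\<exists>\<kappa>\<ge>1::real. \<forall>x. \<forall>r>0.
      ereal r < ext_diameter (UNIV :: 'a set) \<longrightarrow>
      ennreal (inverse \<kappa> * r powr \<alpha>) \<le> emeasure M (ball x r) \<and>
      emeasure M (ball x r) \<le> ennreal (\<kappa> * r powr \<alpha>))"

text \<open>Length of the curve \<open>g\<close> restricted to \<open>{a..b}\<close>: supremum over all partitions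
  \<open>\<tau> 0 \<le> \<dots> \<le> \<tau> n\<close> with points in \<open>{a..b}\<close>.\<close>

definition curve_length :: "(real \<Rightarrow> 'a::metric_space) \<Rightarrow> real \<Rightarrow> real \<Rightarrow> ennreal" where
  "curve_length g a b =
     (SUP (n, \<tau>)\<in>{(n::nat, \<tau>). mono_on {..n} \<tau> \<and> \<tau> ` {..n} \<subseteq> {a..b}}.
        \<Sum>i<n. ennreal (dist (g (\<tau> i)) (g (\<tau> (Suc i)))))"

definition rectifiable_curve :: "(real \<Rightarrow> 'a::metric_space) \<Rightarrow> bool" where
  "rectifiable_curve g \<longleftrightarrow> path g \<and> curve_length g 0 1 < \<infinity>"

text \<open>For rectifiable \<open>g\<close> and \<open>s\<close> between 0 and its length a time \<open>t\<close> as below exists, and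
  \<open>g\<close> takes the same value at all such times: this is the parametrisation of \<open>g\<close> by arc length.\<close>

definition arclength_param :: "(real \<Rightarrow> 'a::metric_space) \<Rightarrow> real \<Rightarrow> 'a" where
  "arclength_param g s = g (SOME t. t \<in> {0..1} \<and> curve_length g 0 t = ennreal s)"

definition curve_integral :: "('a::metric_space \<Rightarrow> ennreal) \<Rightarrow> (real \<Rightarrow> 'a) \<Rightarrow> ennreal" where
  "curve_integral \<rho> g =
     (\<integral>\<^sup>+ s\<in>{0..enn2real (curve_length g 0 1)}. \<rho> (arclength_param g s) \<partial>lborel)"

text \<open>Only the values of \<open>\<rho>\<close> and \<open>u\<close> on \<open>U\<close> matter: the curves are required to stay in \<open>U\<close>.\<close>

definition very_weak_gradient ::
  "'a::metric_space set \<Rightarrow> ('a \<Rightarrow> real) \<Rightarrow> ('a \<Rightarrow> ennreal) \<Rightarrow> bool" where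
  "very_weak_gradient U u \<rho> \<longleftrightarrow>
     open U \<and> \<rho> \<in> borel_measurable (restrict_space borel U) \<and>
     (\<forall>g. rectifiable_curve g \<and> path_image g \<subseteq> U \<longrightarrow>
        ennreal \<bar>u (pathstart g) - u (pathfinish g)\<bar> \<le> curve_integral \<rho> g)"

text \<open>Power of an extended nonnegative real with exponent \<open>p > 0\<close>.\<close>

definition ennreal_powr :: "ennreal \<Rightarrow> real \<Rightarrow> ennreal" where
  "ennreal_powr x p = (if x = \<infinity> then \<infinity> else ennreal (enn2real x powr p))"

definition average :: "'a measure \<Rightarrow> 'a set \<Rightarrow> ('a \<Rightarrow> real) \<Rightarrow> real" where
  "average M B u = (LINT y:B|M. u y) / measure M B"

definition weak_poincare :: "'a::metric_space measure \<Rightarrow> real \<Rightarrow> bool" where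
  "weak_poincare M p \<longleftrightarrow> (\<exists>C\<^sub>p\<ge>1::real. \<exists>C\<^sub>0\<ge>1::real. \<forall>x. \<forall>r>0. \<forall>u \<rho>.
      continuous_on (ball x (C\<^sub>0 * r)) u \<and> bounded (u ` ball x (C\<^sub>0 * r)) \<and>
      very_weak_gradient (ball x (C\<^sub>0 * r)) u \<rho> \<longrightarrow>
      ennreal (average M (ball x r) (\<lambda>y. \<bar>u y - average M (ball x r) u\<bar>))
        \<le> ennreal (C\<^sub>p * diameter (ball x r)) *
           ennreal_powr ((\<integral>\<^sup>+ y\<in>ball x (C\<^sub>0 * r). ennreal_powr (\<rho> y) p \<partial>M)
                           / emeasure M (ball x (C\<^sub>0 * r))) (1 / p))"

definition quasisymmetric :: "(real \<Rightarrow> real) \<Rightarrow> ('a::metric_space \<Rightarrow> 'a) \<Rightarrow> bool" where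
  "quasisymmetric \<eta> f \<longleftrightarrow>
     (\<exists>g. homeomorphism UNIV UNIV f g) \<and>
     (\<exists>\<zeta>. homeomorphism {0..} {0..} \<eta> \<zeta>) \<and> strict_mono_on {0..} \<eta> \<and>
     (\<forall>\<theta>\<ge>0. \<forall>x a b. x \<noteq> a \<and> x \<noteq> b \<and> a \<noteq> b \<longrightarrow>
        dist x a / dist x b \<le> \<theta> \<longrightarrow> dist (f x) (f a) / dist (f x) (f b) \<le> \<eta> \<theta>)"

definition pullback_measure :: "'a measure \<Rightarrow> ('a \<Rightarrow> 'a) \<Rightarrow> 'a set \<Rightarrow> ennreal" where
  "pullback_measure M f E = emeasure M (f ` E)"

definition jacobian_quotient :: "'a::metric_space measure \<Rightarrow> ('a \<Rightarrow> 'a) \<Rightarrow> 'a \<Rightarrow> real \<Rightarrow> ennreal" where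
  "jacobian_quotient M f x r = pullback_measure M f (cball x r) / emeasure M (cball x r)"

text \<open>Meaningful only at points where the limit exists in \<open>[0, \<infinity>]\<close>.\<close>

definition generalised_jacobian :: "'a::metric_space measure \<Rightarrow> ('a \<Rightarrow> 'a) \<Rightarrow> 'a \<Rightarrow> ennreal" where
  "generalised_jacobian M f x = Lim (at_right 0) (jacobian_quotient M f x)"

definition locally_integrable :: "'a::metric_space measure \<Rightarrow> ('a \<Rightarrow> real) \<Rightarrow> bool" where
  "locally_integrable M g \<longleftrightarrow> (\<forall>x. \<exists>U. open U \<and> x \<in> U \<and> set_integrable M U g)"

text \<open>Integrability over every ball is stated explicitly, since balls need not be relatively compact
  and the Bochner integral of a non-integrable function is 0 by convention.\<close>

definition BMO :: "'a::metric_space measure \<Rightarrow> ('a \<Rightarrow> real) set" where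
  "BMO M = {g. locally_integrable M g \<and>
     (\<forall>x. \<forall>r>0. set_integrable M (ball x r) g) \<and>
     (\<exists>C::real. \<forall>x. \<forall>r>0.
        average M (ball x r) (\<lambda>y. \<bar>g y - average M (ball x r) g\<bar>) \<le> C)}"

end

theory Submission
  imports Defs
begin

text \<open>Let \<open>\<nu>(E) = \<mu>(f(E))\<close> and let \<open>ratio e x\<close> be the quotient \<open>\<nu>(B(x,e)) / \<mu>(B(x,e))\<close> over the
  closed ball of radius \<open>e\<close>. By quasisymmetry and Ahlfors regularity, the oscillation of \<open>f\<close>
  over \<open>B(x,e)\<close> is at most a constant times \<open>e * (ratio e x) powr (1/\<alpha>)\<close>. Average
  \<open>y \<mapsto> d(f y, f x)\<close> at scale \<open>e\<close>. The averaged function is Lipschitz at scales below \<open>e\<close> with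
  local constant about \<open>(ratio e y) powr (1/\<alpha>)\<close>, so that this function is an upper gradient of
  it, and its mean oscillation over \<open>B(x,r)\<close> is at least a multiple of the diameter of
  \<open>f(B(x,r))\<close> when \<open>e\<close> is small against \<open>r\<close>. The Poincare inequality then becomes a reverse
  Hoelder inequality with the exponent \<open>s = p/\<alpha> < 1\<close>: \<open>ratio r x\<close> is bounded by the \<open>s\<close>-mean of
  \<open>ratio e\<close> over a larger ball, with a constant that depends neither on \<open>e\<close> nor on \<open>r \<ge> e\<close>
  (\<open>reverse_Holder_inequality\<close>). Since \<open>e\<close> stays positive, this holds before anything is known
  about a singular part of \<open>\<nu>\<close>.

  A stopping time argument as in Gehring's lemma turns the reverse Hoelder inequality into a
  bound for the integrals of \<open>ratio e\<close> over its superlevel sets (\<open>superlevel_estimate\<close>). Summing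
  it over the levels \<open>2^k\<close> gives a local \<open>L log L\<close> bound that is uniform in \<open>e\<close>
  (\<open>LlogL_estimate\<close>). Uniform integrability makes \<open>\<nu>\<close> absolutely continuous
  (\<open>absolutely_continuous_\<mu>_\<nu>\<close>); the ratios converge almost everywhere to its density \<open>h\<close>
  (\<open>Lebesgue_differentiation\<close>), and by Fatou's lemma \<open>h\<close> inherits the bound (\<open>density_LlogL\<close>).

  On a ball \<open>B\<close> put \<open>c = \<nu>(B)/\<mu>(B)\<close>. The mean of the positive part of \<open>ln h - ln c\<close> is at most
  the mean of \<open>h/c\<close>, which is 1. For the negative part pass to the inverse \<open>g\<close> of \<open>f\<close>, which is
  quasisymmetric as well. If \<open>k\<close> is the density of \<open>\<mu>(g(E))\<close> then \<open>h(x) * k(f x) = 1\<close> almost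
  everywhere, in particular \<open>h > 0\<close>, and the change of variables \<open>y = f x\<close> turns the integral of
  the negative part over \<open>B\<close> into an integral of \<open>k * ln (max 1 (c * k))\<close> over \<open>f(B)\<close>. This is
  controlled by the \<open>L log L\<close> bound for \<open>k\<close> (\<open>log_Jacobian_estimate\<close>). Hence the logarithm of
  the Jacobian has bounded mean oscillation.\<close>

section \<open>Arc length and local Lipschitz functions\<close>

definition partition_sum :: "(real \<Rightarrow> 'a::metric_space) \<Rightarrow> nat \<Rightarrow> (nat \<Rightarrow> real) \<Rightarrow> real" where
  "partition_sum g n \<tau> = (\<Sum>i<n. dist (g (\<tau> i)) (g (\<tau> (Suc i))))"

lemma curve_length_eq_partition_sum:
  "curve_length g a b =
     (SUP (n, \<tau>)\<in>{(n::nat, \<tau>). mono_on {..n} \<tau> \<and> \<tau> ` {..n} \<subseteq> {a..b}}. ennreal (partition_sum g n \<tau>))"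
  unfolding curve_length_def partition_sum_def
  by (intro SUP_cong refl) (auto simp: sum_ennreal)

lemma partition_sum_le_curve_length:
  assumes "mono_on {..n} \<tau>" "\<tau> ` {..n} \<subseteq> {a..b}"
  shows "ennreal (partition_sum g n \<tau>) \<le> curve_length g a b"
  unfolding curve_length_eq_partition_sum using assms by (intro SUP_upper2[of "(n, \<tau>)"]) auto

lemma curve_length_le_iff:
  "curve_length g a b \<le> c \<longleftrightarrow>
     (\<forall>n \<tau>. mono_on {..n} \<tau> \<longrightarrow> \<tau> ` {..n} \<subseteq> {a..b} \<longrightarrow> ennreal (partition_sum g n \<tau>) \<le> c)"
  unfolding curve_length_eq_partition_sum by (subst SUP_le_iff) auto

lemma less_curve_length_iff:
  "c < curve_length g a b \<longleftrightarrow>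
     (\<exists>n \<tau>. mono_on {..n} \<tau> \<and> \<tau> ` {..n} \<subseteq> {a..b} \<and> c < ennreal (partition_sum g n \<tau>))"
  unfolding curve_length_eq_partition_sum less_SUP_iff by auto

lemma partition_sum_nonneg: "0 \<le> partition_sum g n \<tau>"
  unfolding partition_sum_def by (simp add: sum_nonneg)

lemma curve_length_mono:
  assumes "{a..b} \<subseteq> {c..d}" shows "curve_length g a b \<le> curve_length g c d"
  unfolding curve_length_eq_partition_sum using assms by (intro SUP_subset_mono) auto

lemma dist_le_curve_length:
  assumes "a \<le> b" shows "ennreal (dist (g a) (g b)) \<le> curve_length g a b"
proof -
  have "ennreal (partition_sum g 1 (\<lambda>i. if i = 0 then a else b)) \<le> curve_length g a b"
    by (rule partition_sum_le_curve_length) (use assms in \<open>auto simp: mono_on_def\<close>)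
  then show ?thesis by (simp add: partition_sum_def)
qed

lemma sum_lessThan_add:
  "(\<Sum>i<n + m. f i) = (\<Sum>i<n. f i) + (\<Sum>i<m. f (n + i :: nat))"
  for f :: "nat \<Rightarrow> 'b::comm_monoid_add"
  by (induction m) (auto simp: add.assoc)

lemma partition_sum_append:
  assumes "mono_on {..n} \<tau>" "\<tau> ` {..n} \<subseteq> {a..t}" "mono_on {..m} \<sigma>" "\<sigma> ` {..m} \<subseteq> {t..b}"
  defines "\<upsilon> \<equiv> (\<lambda>i. if i \<le> n then \<tau> i else \<sigma> (i - Suc n))"
  shows "mono_on {..n + Suc m} \<upsilon>" "\<upsilon> ` {..n + Suc m} \<subseteq> {a..b}"
    and "partition_sum g n \<tau> + partition_sum g m \<sigma> \<le> partition_sum g (n + Suc m) \<upsilon>"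
proof -
  have at: "a \<le> t" using assms(2) by force
  have tb: "t \<le> b" using assms(4) by force
  show "mono_on {..n + Suc m} \<upsilon>"
  proof (rule mono_onI)
    fix i j assume ij: "i \<in> {..n + Suc m}" "j \<in> {..n + Suc m}" "i \<le> j"
    consider "j \<le> n" | "i \<le> n" "n < j" | "n < i" by linarith
    then show "\<upsilon> i \<le> \<upsilon> j"
    proof cases
      case 1 then show ?thesis using ij assms(1) by (auto simp: \<upsilon>_def mono_on_def)
    next
      case 2
      then have "\<tau> i \<le> t" "t \<le> \<sigma> (j - Suc n)" using ij assms(2,4) by (auto simp: image_subset_iff)
      then show ?thesis using 2 by (simp add: \<upsilon>_def)
    next
      case 3 then have "\<sigma> (i - Suc n) \<le> \<sigma> (j - Suc n)" using ij by (intro mono_onD[OF assms(3)]) auto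
      then show ?thesis using 3 ij by (simp add: \<upsilon>_def)
    qed
  qed
  show "\<upsilon> ` {..n + Suc m} \<subseteq> {a..b}"
  proof (rule image_subsetI)
    fix i assume i: "i \<in> {..n + Suc m}"
    have "\<tau> i \<in> {a..t}" if "i \<le> n" using that assms(2) by blast
    moreover have "\<sigma> (i - Suc n) \<in> {t..b}" if "\<not> i \<le> n"
    proof -
      have "i - Suc n \<in> {..m}" using that i by auto
      then show ?thesis using assms(4) by blast
    qed
    ultimately show "\<upsilon> i \<in> {a..b}" using at tb by (auto simp: \<upsilon>_def)
  qed
  \<comment> \<open>The index \<open>n\<close> is the jump from the last point of \<open>\<tau>\<close> to the first point of \<open>\<sigma>\<close>; its
      summand is dropped.\<close>
  have 1: "partition_sum g (n + Suc m) \<upsilon> = (\<Sum>i<n. dist (g (\<upsilon> i)) (g (\<upsilon> (Suc i))))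
      + (\<Sum>i<Suc m. dist (g (\<upsilon> (n + i))) (g (\<upsilon> (Suc (n + i)))))"
    unfolding partition_sum_def by (rule sum_lessThan_add)
  show "partition_sum g n \<tau> + partition_sum g m \<sigma> \<le> partition_sum g (n + Suc m) \<upsilon>"
    unfolding 1 sum.lessThan_Suc_shift
    by (intro add_mono add_increasing) (simp_all add: partition_sum_def \<upsilon>_def)
qed

text \<open>A partition of \<open>{a..t}\<close> followed by one of \<open>{t..b}\<close> is a partition of \<open>{a..b}\<close>.\<close>

lemma curve_length_superadditive:
  assumes "a \<le> t" "t \<le> b"
  shows "curve_length g a t + curve_length g t b \<le> curve_length g a b"
proof -
  have "ennreal (partition_sum g n \<tau>) + ennreal (partition_sum g m \<sigma>) \<le> curve_length g a b"
    if "mono_on {..n} \<tau>" "\<tau> ` {..n} \<subseteq> {a..t}" "mono_on {..m} \<sigma>" "\<sigma> ` {..m} \<subseteq> {t..b}" for n \<tau> m \<sigma>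
  proof -
    note app = partition_sum_append[OF that]
    have "ennreal (partition_sum g n \<tau>) + ennreal (partition_sum g m \<sigma>)
        = ennreal (partition_sum g n \<tau> + partition_sum g m \<sigma>)"
      by (simp add: partition_sum_nonneg)
    also have "\<dots> \<le> curve_length g a b"
      using ennreal_leI[OF app(3)] partition_sum_le_curve_length[OF app(1,2), where g = g] by (rule order_trans)
    finally show ?thesis .
  qed
  note sums = this
  let ?I = "\<lambda>a b. {(n::nat, \<tau>::nat \<Rightarrow> real). mono_on {..n} \<tau> \<and> \<tau> ` {..n} \<subseteq> {a..b}}"
  have ne: "?I a b \<noteq> {}" if "a \<le> b" for a b
    using that by (auto intro!: exI[of _ 0] exI[of _ "\<lambda>_. a"] simp: mono_on_def)
  have "curve_length g a t + ennreal (partition_sum g m \<sigma>) \<le> curve_length g a b"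
    if "mono_on {..m} \<sigma>" "\<sigma> ` {..m} \<subseteq> {t..b}" for m \<sigma>
    unfolding curve_length_eq_partition_sum[of g a t]
    by (subst ennreal_SUP_add_left[OF ne[OF assms(1)], symmetric], rule SUP_least) (use sums that in force)
  note that = this
  show ?thesis
    unfolding curve_length_eq_partition_sum[of g t b]
    by (subst add.commute, subst ennreal_SUP_add_left[OF ne[OF assms(2)], symmetric], rule SUP_least)
      (use that in \<open>auto simp: add.commute\<close>)
qed

text \<open>Clip a partition at \<open>t\<close> from above and from below. Only the interval that contains \<open>t\<close> is cut,
  and there the triangle inequality applies.\<close>

lemma curve_length_subadditive:
  assumes "a \<le> t" "t \<le> b"
  shows "curve_length g a b \<le> curve_length g a t + curve_length g t b"
  unfolding curve_length_le_iff[of g a b]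
proof (intro allI impI)
  fix n and \<tau> :: "nat \<Rightarrow> real"
  assume \<tau>: "mono_on {..n} \<tau>" "\<tau> ` {..n} \<subseteq> {a..b}"
  let ?l = "\<lambda>i. min (\<tau> i) t" and ?r = "\<lambda>i. max (\<tau> i) t"
  have "partition_sum g n \<tau> \<le> partition_sum g n ?l + partition_sum g n ?r"
    unfolding partition_sum_def sum.distrib[symmetric]
  proof (rule sum_mono)
    fix i assume "i \<in> {..<n}"
    then have "\<tau> i \<le> \<tau> (Suc i)" using mono_onD[OF \<tau>(1), of i "Suc i"] by simp
    then consider "\<tau> (Suc i) \<le> t" | "\<tau> i \<le> t" "t \<le> \<tau> (Suc i)" | "t \<le> \<tau> i" by linarith
    then show "dist (g (\<tau> i)) (g (\<tau> (Suc i)))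
      \<le> dist (g (?l i)) (g (?l (Suc i))) + dist (g (?r i)) (g (?r (Suc i)))"
      using \<open>\<tau> i \<le> \<tau> (Suc i)\<close>
      by cases (auto simp: min_def max_def intro: dist_triangle)
  qed
  then have "ennreal (partition_sum g n \<tau>) \<le> ennreal (partition_sum g n ?l) + ennreal (partition_sum g n ?r)"
    by (simp add: partition_sum_nonneg flip: ennreal_plus)
  also have "\<dots> \<le> curve_length g a t + curve_length g t b"
    using \<tau> assms
    by (intro add_mono partition_sum_le_curve_length mono_onI min.mono max.mono mono_onD[OF \<tau>(1)])
      (auto simp: image_subset_iff min.coboundedI1)
  finally show "ennreal (partition_sum g n \<tau>) \<le> curve_length g a t + curve_length g t b" .
qed

lemma curve_length_add:
  assumes "a \<le> t" "t \<le> b"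
  shows "curve_length g a t + curve_length g t b = curve_length g a b"
  using curve_length_superadditive[OF assms] curve_length_subadditive[OF assms] by (rule antisym)

lemma partition_sum_clip_tendsto:
  assumes g: "continuous_on {0..1} g" and t: "t \<in> {0..1}"
    and \<tau>: "\<And>i. i \<le> n \<Longrightarrow> c t (\<tau> i) = \<tau> i" "\<And>i. i \<le> n \<Longrightarrow> \<tau> i \<in> {0..1}"
    and c: "\<And>x. x \<in> {0..1} \<Longrightarrow> continuous_on {0..1} (\<lambda>s. c s x)"
      "\<And>s x. s \<in> {0..1} \<Longrightarrow> x \<in> {0..1} \<Longrightarrow> c s x \<in> {0..1}"
  shows "((\<lambda>s. partition_sum g n (\<lambda>i. c s (\<tau> i))) \<longlongrightarrow> partition_sum g n \<tau>) (at t within {0..1})"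
proof -
  have "continuous_on {0..1} (\<lambda>s. g (c s x))" if "x \<in> {0..1}" for x
    using that c by (intro continuous_on_compose2[OF g]) auto
  then have *: "((\<lambda>s. g (c s (\<tau> i))) \<longlongrightarrow> g (\<tau> i)) (at t within {0..1})" if "i \<le> n" for i
    using \<tau>[OF that] t by (force simp: continuous_on_def)
  show ?thesis
    unfolding partition_sum_def by (intro tendsto_sum tendsto_dist *) auto
qed

text \<open>The sum over a fixed partition clipped at \<open>s\<close> depends continuously on \<open>s\<close>, and the length of
  either part of the curve is a supremum of such sums. Hence both are lower semicontinuous in
  the cutting point.\<close>

lemma
  assumes g: "continuous_on {0..1} g" and t: "t \<in> {0..1}"
  shows curve_length_left_lsc: "l < curve_length g 0 t \<Longrightarrow> \<forall>\<^sub>F s in at t within {0..1}. l < curve_length g 0 s"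
    and curve_length_right_lsc: "l < curve_length g t 1 \<Longrightarrow> \<forall>\<^sub>F s in at t within {0..1}. l < curve_length g s 1"
proof -
  assume "l < curve_length g 0 t"
  then obtain n \<tau> where \<tau>: "mono_on {..n} \<tau>" "\<tau> ` {..n} \<subseteq> {0..t}" "l < ennreal (partition_sum g n \<tau>)"
    unfolding less_curve_length_iff by blast
  have "((\<lambda>s. partition_sum g n (\<lambda>i. min s (\<tau> i))) \<longlongrightarrow> partition_sum g n \<tau>) (at t within {0..1})"
    using \<tau>(2) t by (intro partition_sum_clip_tendsto[OF g t] continuous_on_min continuous_on_id continuous_on_const)
      (fastforce simp: image_subset_iff min_def)+
  then have "\<forall>\<^sub>F s in at t within {0..1}. l < ennreal (partition_sum g n (\<lambda>i. min s (\<tau> i)))"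
    by (intro order_tendstoD(1)[OF tendsto_ennrealI \<tau>(3)])
  moreover have "\<forall>\<^sub>F s in at t within {0..1}. s \<in> {0..1}"
    by (simp add: eventually_at_filter)
  ultimately show "\<forall>\<^sub>F s in at t within {0..1}. l < curve_length g 0 s"
  proof eventually_elim
    case (elim s)
    have "ennreal (partition_sum g n (\<lambda>i. min s (\<tau> i))) \<le> curve_length g 0 s"
      using \<tau>(2) elim t
      by (intro partition_sum_le_curve_length mono_onI min.mono mono_onD[OF \<tau>(1)]) (auto simp: image_subset_iff min.coboundedI2)
    then show ?case using elim by (auto intro: less_le_trans)
  qed
next
  assume "l < curve_length g t 1"
  then obtain n \<tau> where \<tau>: "mono_on {..n} \<tau>" "\<tau> ` {..n} \<subseteq> {t..1}" "l < ennreal (partition_sum g n \<tau>)"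
    unfolding less_curve_length_iff by blast
  have "((\<lambda>s. partition_sum g n (\<lambda>i. max s (\<tau> i))) \<longlongrightarrow> partition_sum g n \<tau>) (at t within {0..1})"
    using \<tau>(2) t by (intro partition_sum_clip_tendsto[OF g t] continuous_on_max continuous_on_id continuous_on_const)
      (fastforce simp: image_subset_iff max_def)+
  then have "\<forall>\<^sub>F s in at t within {0..1}. l < ennreal (partition_sum g n (\<lambda>i. max s (\<tau> i)))"
    by (intro order_tendstoD(1)[OF tendsto_ennrealI \<tau>(3)])
  moreover have "\<forall>\<^sub>F s in at t within {0..1}. s \<in> {0..1}"
    by (simp add: eventually_at_filter)
  ultimately show "\<forall>\<^sub>F s in at t within {0..1}. l < curve_length g s 1"
  proof eventually_elim
    case (elim s)
    have "ennreal (partition_sum g n (\<lambda>i. max s (\<tau> i))) \<le> curve_length g s 1"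
      using \<tau>(2) elim t
      by (intro partition_sum_le_curve_length mono_onI max.mono mono_onD[OF \<tau>(1)]) (auto simp: image_subset_iff max.coboundedI2)
    then show ?case using elim by (auto intro: less_le_trans)
  qed
qed

text \<open>The lengths of the two parts of the curve are lower semicontinuous and have a constant finite
  sum, so each of them is upper semicontinuous too.\<close>

lemma continuous_on_curve_length:
  assumes "rectifiable_curve g"
  shows "continuous_on {0..1} (\<lambda>t. enn2real (curve_length g 0 t))"
proof -
  have g: "continuous_on {0..1} g" and fin: "curve_length g 0 1 < \<infinity>"
    using assms by (auto simp: rectifiable_curve_def path_def)
  define V where "V t = enn2real (curve_length g 0 t)" for t
  define W where "W t = enn2real (curve_length g t 1)" for t
  have V: "curve_length g 0 t = ennreal (V t)" and W: "curve_length g t 1 = ennreal (W t)"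
    and VW: "V t + W t = V 1" if "t \<in> {0..1}" for t
  proof -
    have f: "curve_length g 0 t < \<infinity>" "curve_length g t 1 < \<infinity>"
      using that curve_length_mono[of 0 t 0 1 g] curve_length_mono[of t 1 0 1 g] fin
      by (simp_all add: le_less_trans)
    then show *: "curve_length g 0 t = ennreal (V t)" "curve_length g t 1 = ennreal (W t)"
      by (auto simp: V_def W_def)
    have "ennreal (V t + W t) = ennreal (V 1)"
      using curve_length_add[of 0 t 1 g] that fin unfolding * by (simp add: V_def W_def ennreal_plus)
    then show "V t + W t = V 1" by (subst (asm) ennreal_inj) (auto simp: V_def W_def)
  qed
  have nn: "0 \<le> V t" "0 \<le> W t" for t by (auto simp: V_def W_def)
  have "(V \<longlongrightarrow> V t) (at t within {0..1})" if t: "t \<in> {0..1}" for t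
  proof (rule order_tendstoI)
    have ev: "\<forall>\<^sub>F s in at t within {0..1}. s \<in> {0..1}" by (simp add: eventually_at_filter)
    fix a assume a: "a < V t"
    show "\<forall>\<^sub>F s in at t within {0..1}. a < V s"
    proof (cases "a < 0")
      case True then show ?thesis by (intro always_eventually allI) (meson nn(1) less_le_trans)
    next
      case False
      then have "ennreal a < curve_length g 0 t" using a t by (simp add: V ennreal_less_iff)
      from curve_length_left_lsc[OF g t this] ev show ?thesis
        by eventually_elim (use False in \<open>simp add: V ennreal_less_iff\<close>)
    qed
  next
    have ev: "\<forall>\<^sub>F s in at t within {0..1}. s \<in> {0..1}" by (simp add: eventually_at_filter)
    fix a assume a: "V t < a"
    show "\<forall>\<^sub>F s in at t within {0..1}. V s < a"
    proof (cases "V 1 < a")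
      case True
      from ev show ?thesis
      proof eventually_elim
        case (elim s) then show ?case using VW[OF elim] nn(2)[of s] True by linarith
      qed
    next
      case False
      then have "ennreal (V 1 - a) < curve_length g t 1" using a t VW[OF t] by (simp add: W ennreal_less_iff)
      from curve_length_right_lsc[OF g t this] ev show ?thesis
      proof eventually_elim
        case (elim s) then show ?case using False VW[of s] by (simp add: W ennreal_less_iff)
      qed
    qed
  qed
  then show ?thesis unfolding continuous_on_def V_def by blast
qed

text \<open>The intermediate value theorem for the length provides a witness for the choice operator in
  the definition of the arc length parametrisation.\<close>

lemma arclength_param_time:
  assumes "rectifiable_curve g" "s \<in> {0..enn2real (curve_length g 0 1)}"
  obtains t where "t \<in> {0..1}" "curve_length g 0 t = ennreal s" "arclength_param g s = g t"
proof -
  have fin: "curve_length g 0 1 < \<infinity>" using assms(1) by (simp add: rectifiable_curve_def)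
  have "curve_length g 0 0 = 0"
  proof (intro antisym zero_le, unfold curve_length_le_iff, intro allI impI)
    fix n and \<tau> :: "nat \<Rightarrow> real" assume "\<tau> ` {..n} \<subseteq> {0..0}"
    then have "\<tau> i = 0" if "i \<le> n" for i using that by (auto simp: image_subset_iff)
    then have "partition_sum g n \<tau> = 0" unfolding partition_sum_def by (intro sum.neutral) simp
    then show "ennreal (partition_sum g n \<tau>) \<le> 0" by simp
  qed
  then have "\<exists>t\<ge>0. t \<le> 1 \<and> enn2real (curve_length g 0 t) = s"
    using assms(2) continuous_on_curve_length[OF assms(1)] by (intro IVT') auto
  then obtain t where t: "t \<in> {0..1}" "enn2real (curve_length g 0 t) = s" by auto
  have "curve_length g 0 t < \<infinity>"
    using t(1) curve_length_mono[of 0 t 0 1 g] fin by (simp add: le_less_trans)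
  then have "curve_length g 0 t = ennreal s" unfolding t(2)[symmetric] by simp
  then have "\<exists>t. t \<in> {0..1} \<and> curve_length g 0 t = ennreal s" using t by blast
  from someI_ex[OF this] show ?thesis by (intro that) (auto simp: arclength_param_def)
qed

lemma arclength_param_Lipschitz:
  assumes g: "rectifiable_curve g"
    and s: "0 \<le> s" "s \<le> s'" "s' \<le> enn2real (curve_length g 0 1)"
  shows "dist (arclength_param g s) (arclength_param g s') \<le> s' - s"
proof -
  obtain t where t: "t \<in> {0..1}" "curve_length g 0 t = ennreal s" "arclength_param g s = g t"
    using s by (elim arclength_param_time[OF g, of s, rotated]) auto
  obtain t' where t': "t' \<in> {0..1}" "curve_length g 0 t' = ennreal s'" "arclength_param g s' = g t'"
    using s by (elim arclength_param_time[OF g, of s', rotated]) auto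
  have main: "dist (g a) (g b) \<le> l' - l"
    if "a \<in> {0..1}" "b \<in> {0..1}" "a \<le> b" "curve_length g 0 a = ennreal l" "curve_length g 0 b = ennreal l'" "0 \<le> l" "0 \<le> l'"
    for a b l l'
  proof -
    have "ennreal l + ennreal (dist (g a) (g b)) \<le> ennreal l'"
      using curve_length_superadditive[of 0 a b g] dist_le_curve_length[of a b g] that
      by (metis add_left_mono atLeastAtMost_iff order_trans)
    then show ?thesis using that by (simp flip: ennreal_plus)
  qed
  show ?thesis
  proof (cases "t \<le> t'")
    case True then show ?thesis using main[of t t' s s'] t t' s by simp
  next
    case False then show ?thesis using main[of t' t s' s] t t' s by (simp add: dist_commute)
  qed
qed

lemma arclength_param_endpoints:
  assumes g: "rectifiable_curve g"
  shows "arclength_param g 0 = g 0" "arclength_param g (enn2real (curve_length g 0 1)) = g 1"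
proof -
  have fin: "curve_length g 0 1 < \<infinity>" using g by (simp add: rectifiable_curve_def)
  obtain t where t: "t \<in> {0..1}" "curve_length g 0 t = ennreal 0" "arclength_param g 0 = g t"
    by (rule arclength_param_time[OF g, of 0]) auto
  show "arclength_param g 0 = g 0"
    using dist_le_curve_length[of 0 t g] t by simp
  obtain t where t: "t \<in> {0..1}" "curve_length g 0 t = curve_length g 0 1"
    "arclength_param g (enn2real (curve_length g 0 1)) = g t"
    by (rule arclength_param_time[OF g, of "enn2real (curve_length g 0 1)"]) (use fin in auto)
  have "curve_length g 0 t + curve_length g t 1 = curve_length g 0 t"
    using curve_length_add[of 0 t 1 g] t by simp
  then have "curve_length g t 1 = 0" using t(2) fin using ennreal_add_left_cancel[of "curve_length g 0 t" "curve_length g t 1" 0] by auto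
  then show "arclength_param g (enn2real (curve_length g 0 1)) = g 1"
    using dist_le_curve_length[of t 1 g] t by simp
qed

lemma continuous_on_of_pointwise_Lipschitz:
  fixes u :: "'a::metric_space \<Rightarrow> real"
  assumes L: "\<And>y. \<exists>\<delta>>0. \<exists>L. \<forall>y'. dist y y' < \<delta> \<longrightarrow> \<bar>u y - u y'\<bar> \<le> L * dist y y'"
  shows "continuous_on UNIV u"
  unfolding continuous_on_def
proof
  fix y
  obtain \<delta> L where \<delta>: "0 < \<delta>" and Lip: "\<And>y'. dist y y' < \<delta> \<Longrightarrow> \<bar>u y - u y'\<bar> \<le> L * dist y y'"
    using L by blast
  have "norm (u y' - u y) \<le> L * dist y y'" if "dist y' y < \<delta>" for y'
    using Lip[of y'] that by (simp add: dist_commute abs_minus_commute)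
  then have "\<forall>\<^sub>F y' in at y. norm (u y' - u y) \<le> L * dist y y'"
    using \<delta> unfolding eventually_at by blast
  moreover have "((\<lambda>y'. L * dist y y') \<longlongrightarrow> L * dist y y) (at y)" by (intro tendsto_intros)
  ultimately have "((\<lambda>y'. u y' - u y) \<longlongrightarrow> 0) (at y)"
    using Lim_null_comparison[of "\<lambda>y'. u y' - u y" "\<lambda>y'. L * dist y y'" "at y"] by simp
  then show "(u \<longlongrightarrow> u y) (at y within UNIV)" by (simp add: LIM_zero_iff)
qed

text \<open>Cut the arc length parameter into pieces of length \<open>h < \<delta>\<close>. For every \<open>s\<close> in a piece, going
  through the point \<open>c s\<close> of the curve shows that \<open>u\<close> changes over the piece by at most
  \<open>h * \<Lambda> (c s)\<close>. So the change is at most the integral of \<open>\<Lambda> \<circ> c\<close> over the piece, and the pieces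
  add up.\<close>

lemma very_weak_gradient_local_Lipschitz:
  fixes u :: "'a::metric_space \<Rightarrow> real"
  assumes U: "open U" and \<Lambda>: "\<Lambda> \<in> borel_measurable borel" "\<And>y. 0 \<le> \<Lambda> y"
    and "0 < \<delta>" and Lip: "\<And>y y'. dist y y' < \<delta> \<Longrightarrow> \<bar>u y - u y'\<bar> \<le> \<Lambda> y * dist y y'"
  shows "very_weak_gradient U u (\<lambda>y. ennreal (\<Lambda> y))"
  unfolding very_weak_gradient_def
proof (intro conjI allI impI U)
  show "(\<lambda>y. ennreal (\<Lambda> y)) \<in> borel_measurable (restrict_space borel U)"
    using \<Lambda>(1) by (intro measurable_restrict_space1) measurable
  fix g :: "real \<Rightarrow> 'a" assume "rectifiable_curve g \<and> path_image g \<subseteq> U"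
  then have g: "rectifiable_curve g" by simp
  define l where "l = enn2real (curve_length g 0 1)"
  define c where "c = arclength_param g"
  have l: "0 \<le> l" by (simp add: l_def)
  have c: "dist (c s) (c s') \<le> s' - s" if "0 \<le> s" "s \<le> s'" "s' \<le> l" for s s'
    using arclength_param_Lipschitz[OF g] that by (simp add: c_def l_def)
  have "1-lipschitz_on {0..l} c"
  proof (rule lipschitz_onI)
    fix x y assume "x \<in> {0..l}" "y \<in> {0..l}"
    then show "dist (c x) (c y) \<le> 1 * dist x y"
      using c[of x y] c[of y x] by (cases "x \<le> y") (auto simp: dist_real_def dist_commute)
  qed simp
  then have "continuous_on {0..l} c" by (rule lipschitz_on_continuous_on)
  then have [measurable]: "c \<in> borel_measurable (restrict_space borel {0..l})"
    by (rule borel_measurable_continuous_on_restrict)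
  have meas: "(\<lambda>s. ennreal (\<Lambda> (c s)) * indicator A s) \<in> borel_measurable lborel"
    if A: "A \<subseteq> {0..l}" "A \<in> sets borel" for A
  proof -
    have "(\<lambda>s. ennreal (\<Lambda> (c s))) \<in> borel_measurable (restrict_space borel {0..l})"
      using \<Lambda>(1) by measurable
    then have [measurable]: "(\<lambda>s. ennreal (\<Lambda> (c s)) * indicator {0..l} s) \<in> borel_measurable borel"
      by (subst (asm) borel_measurable_restrict_space_iff_ennreal) auto
    have "(\<lambda>s. ennreal (\<Lambda> (c s)) * indicator A s) = (\<lambda>s. ennreal (\<Lambda> (c s)) * indicator {0..l} s * indicator A s)"
      using A by (auto simp: fun_eq_iff indicator_def)
    then show ?thesis using A(2) by simp
  qed
  \<comment> \<open>Enough pieces that each is shorter than \<open>\<delta>\<close>.\<close>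
  obtain n :: nat where n: "l < real n * \<delta>" using \<open>0 < \<delta>\<close> reals_Archimedean3 by blast
  then have n0: "0 < n" using l by (cases n) auto
  define h where "h = l / n"
  have h: "0 \<le> h" "h < \<delta>" "n * h = l" using n n0 l by (auto simp: h_def divide_simps mult.commute)
  let ?s = "\<lambda>i::nat. i * h"
  have sl: "?s i \<le> l" if "i \<le> n" for i using that h mult_right_mono[of i n h] by simp
  have piece: "ennreal \<bar>u (c (?s i)) - u (c (?s (Suc i)))\<bar>
      \<le> (\<integral>\<^sup>+ s. ennreal (\<Lambda> (c s)) * indicator {?s i<..?s (Suc i)} s \<partial>lborel)" if i: "i < n" for i
  proof (cases "h = 0")
    case False
    then have hp: "0 < h" using h by simp
    let ?d = "\<bar>u (c (?s i)) - u (c (?s (Suc i)))\<bar>"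
    have "?d / h \<le> \<Lambda> (c s)" if s: "?s i < s" "s \<le> ?s (Suc i)" for s
    proof -
      have s0: "0 \<le> ?s i" "s \<le> l" using hp s sl[of "Suc i"] i by auto
      have d1: "dist (c (?s i)) (c s) \<le> s - ?s i" and d2: "dist (c s) (c (?s (Suc i))) \<le> ?s (Suc i) - s"
        using s s0 sl[of "Suc i"] i by (auto intro!: c)
      have Such: "?s (Suc i) = ?s i + h" by (simp add: algebra_simps)
      have "\<bar>u (c s) - u (c (?s i))\<bar> \<le> \<Lambda> (c s) * dist (c s) (c (?s i))"
        using d1 s h Such by (intro Lip) (simp add: dist_commute)
      moreover have "\<bar>u (c s) - u (c (?s (Suc i)))\<bar> \<le> \<Lambda> (c s) * dist (c s) (c (?s (Suc i)))"
        using d2 s h Such by (intro Lip) simp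
      ultimately have "?d \<le> \<Lambda> (c s) * (dist (c s) (c (?s i)) + dist (c s) (c (?s (Suc i))))"
        by (simp add: distrib_left)
      also have "\<dots> \<le> \<Lambda> (c s) * h"
        using d1 d2 Such by (intro mult_left_mono \<Lambda>) (simp add: dist_commute)
      finally show ?thesis using hp by (simp add: divide_simps)
    qed
    then have "(\<integral>\<^sup>+ s. ennreal (?d / h) * indicator {?s i<..?s (Suc i)} s \<partial>lborel)
        \<le> (\<integral>\<^sup>+ s. ennreal (\<Lambda> (c s)) * indicator {?s i<..?s (Suc i)} s \<partial>lborel)"
      by (intro nn_integral_mono) (auto simp: indicator_def intro!: ennreal_leI)
    moreover have "(\<integral>\<^sup>+ s. ennreal (?d / h) * indicator {?s i<..?s (Suc i)} s \<partial>lborel)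
        = ennreal (?d / h) * ennreal (?s (Suc i) - ?s i)"
      using hp by (subst nn_integral_cmult_indicator) (auto simp: algebra_simps)
    moreover have "\<dots> = ennreal ?d"
      using hp by (subst ennreal_mult'[symmetric]) (auto simp: algebra_simps)
    ultimately show ?thesis by simp
  qed simp
  have "\<bar>u (c 0) - u (c l)\<bar> = \<bar>\<Sum>i<n. u (c (?s i)) - u (c (?s (Suc i)))\<bar>"
    using h by (subst sum_lessThan_telescope') simp
  also have "\<dots> \<le> (\<Sum>i<n. \<bar>u (c (?s i)) - u (c (?s (Suc i)))\<bar>)" by (rule sum_abs)
  finally have "ennreal \<bar>u (c 0) - u (c l)\<bar> \<le> (\<Sum>i<n. ennreal \<bar>u (c (?s i)) - u (c (?s (Suc i)))\<bar>)"
    by (subst sum_ennreal) (auto intro: ennreal_leI)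
  also have "\<dots> \<le> (\<Sum>i<n. \<integral>\<^sup>+ s. ennreal (\<Lambda> (c s)) * indicator {?s i<..?s (Suc i)} s \<partial>lborel)"
    by (intro sum_mono piece) simp
  also have "\<dots> = (\<integral>\<^sup>+ s. (\<Sum>i<n. ennreal (\<Lambda> (c s)) * indicator {?s i<..?s (Suc i)} s) \<partial>lborel)"
  proof (rule nn_integral_sum[symmetric])
    fix i assume "i \<in> {..<n}"
    then have "{?s i<..?s (Suc i)} \<subseteq> {0..l}"
      using sl[of "Suc i"] mult_nonneg_nonneg[of "real i" h] h
      by (force simp: subset_iff simp del: mult_nonneg_nonneg)
    then show "(\<lambda>s. ennreal (\<Lambda> (c s)) * indicator {?s i<..?s (Suc i)} s) \<in> borel_measurable lborel"
      by (rule meas) simp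
  qed
  also have "\<dots> \<le> (\<integral>\<^sup>+ s. ennreal (\<Lambda> (c s)) * indicator {0..l} s \<partial>lborel)"
  proof (intro nn_integral_mono)
    fix s :: real
    have ex: "(\<Sum>i<m. indicator {?s i<..?s (Suc i)} s :: ennreal) = indicator {0<..?s m} s" for m
    proof (induction m)
      case (Suc m)
      have join: "indicator {0<..a} s + indicator {a<..b} s = (indicator {0<..b} s :: ennreal)"
        if "0 \<le> a" "a \<le> b" for a b :: real
        using that by (auto simp: indicator_def)
      show ?case
        unfolding sum.lessThan_Suc Suc using h by (intro join) (auto intro: mult_right_mono)
    qed simp
    show "(\<Sum>i<n. ennreal (\<Lambda> (c s)) * indicator {?s i<..?s (Suc i)} s) \<le> ennreal (\<Lambda> (c s)) * indicator {0..l} s"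
      unfolding sum_distrib_left[symmetric] ex using h by (intro mult_left_mono) (auto simp: indicator_def)
  qed
  finally show "ennreal \<bar>u (pathstart g) - u (pathfinish g)\<bar> \<le> curve_integral (\<lambda>y. ennreal (\<Lambda> y)) g"
    using arclength_param_endpoints[OF g]
    by (simp add: curve_integral_def pathstart_def pathfinish_def c_def l_def)
qed

section \<open>Consequences of the Poincare inequality\<close>

lemma metric_measure_spaceE:
  assumes "metric_measure_space M"
  obtains A where "1 \<le> A"
    "\<And>x r. 0 < r \<Longrightarrow> 0 < emeasure M (ball x r)"
    "\<And>x r. 0 < r \<Longrightarrow> emeasure M (ball x r) < \<infinity>"
    "\<And>x r. 0 < r \<Longrightarrow> measure M (ball x (2 * r)) \<le> A * measure M (ball x r)"
proof -
  from assms obtain A where A: "1 \<le> A" and d: "\<And>x r. 0 < r \<Longrightarrow>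
      0 < emeasure M (ball x (2 * r)) \<and>
      emeasure M (ball x (2 * r)) \<le> ennreal A * emeasure M (ball x r) \<and>
      ennreal A * emeasure M (ball x r) < \<infinity>"
    unfolding metric_measure_space_def doubling_def by blast
  have pos: "0 < emeasure M (ball x r)" if "0 < r" for x r using d[of "r/2" x] that by simp
  have fin: "emeasure M (ball x r) < \<infinity>" if "0 < r" for x r
    using d[of r x] that A by (auto simp: ennreal_mult_less_top)
  have "measure M (ball x (2 * r)) \<le> A * measure M (ball x r)" if "0 < r" for x r
  proof -
    have e: "emeasure M (ball x s) = ennreal (measure M (ball x s))" if "0 < s" for s
      using fin[OF that, of x] by (intro emeasure_eq_ennreal_measure) auto
    have "ennreal (measure M (ball x (2 * r))) \<le> ennreal A * ennreal (measure M (ball x r))"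
      using d[OF that, of x] that by (simp add: e)
    also have "\<dots> = ennreal (A * measure M (ball x r))" using A by (simp add: ennreal_mult')
    finally have "ennreal (measure M (ball x (2 * r))) \<le> ennreal (A * measure M (ball x r))" .
    then show ?thesis using A by (subst (asm) ennreal_le_iff) auto
  qed
  with A pos fin show ?thesis using that by blast
qed

text \<open>The indicator of a clopen set is continuous and is constant along every curve, so it has the
  gradient 0. The Poincare inequality makes it constant almost everywhere on each ball, although
  nonempty open sets have positive measure.\<close>

lemma weak_poincare_connected:
  fixes M :: "'a::metric_space measure"
  assumes M: "metric_measure_space M" and P: "weak_poincare M p"
  shows "connected (UNIV :: 'a set)"
proof (rule ccontr)
  assume "\<not> connected (UNIV :: 'a set)"
  then obtain U :: "'a set" where U: "open U" "closed U" "U \<noteq> {}" "U \<noteq> UNIV"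
    by (auto simp: connected_clopen)
  then obtain a b where ab: "a \<in> U" "b \<notin> U" by blast
  define u :: "'a \<Rightarrow> real" where "u = indicator U"
  from P obtain C\<^sub>p C\<^sub>0 where C: "1 \<le> C\<^sub>p" "1 \<le> C\<^sub>0" and ineq:
    "\<And>x r u \<rho>. 0 < r \<Longrightarrow> continuous_on (ball x (C\<^sub>0 * r)) u \<and> bounded (u ` ball x (C\<^sub>0 * r)) \<and>
      very_weak_gradient (ball x (C\<^sub>0 * r)) u \<rho> \<Longrightarrow>
      ennreal (average M (ball x r) (\<lambda>y. \<bar>u y - average M (ball x r) u\<bar>))
        \<le> ennreal (C\<^sub>p * diameter (ball x r)) *
           ennreal_powr ((\<integral>\<^sup>+ y\<in>ball x (C\<^sub>0 * r). ennreal_powr (\<rho> y) p \<partial>M)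
                           / emeasure M (ball x (C\<^sub>0 * r))) (1 / p)"
    unfolding weak_poincare_def by blast
  obtain A where pos: "\<And>x r. 0 < r \<Longrightarrow> 0 < emeasure M (ball x r)"
    and fin: "\<And>x r. 0 < r \<Longrightarrow> emeasure M (ball x r) < \<infinity>"
    using metric_measure_spaceE[OF M] by metis
  have borel: "sets borel \<subseteq> sets M" and space: "space M = UNIV" using M by (auto simp: metric_measure_space_def)
  have null: False if "open S" "S \<noteq> {}" "emeasure M S = 0" for S
  proof -
    from that obtain x e where "0 < e" "ball x e \<subseteq> S" by (meson ex_in_conv openE)
    then have "emeasure M (ball x e) \<le> emeasure M S" using that(1) borel borel_open[OF that(1)] by (intro emeasure_mono) auto
    then show False using pos[OF \<open>0 < e\<close>, of x] that by simp
  qed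
  have contU: "continuous_on UNIV u"
  proof -
    have "continuous_on (U \<union> - U) (\<lambda>x. if x \<in> U then 1 else 0 :: real)"
      using U by (intro continuous_on_cases) auto
    moreover have "u = (\<lambda>x. if x \<in> U then 1 else 0)" by (auto simp: u_def indicator_def)
    ultimately show ?thesis by simp
  qed
  define r where "r = dist a b + 1"
  have r: "0 < r" "b \<in> ball a r" by (auto simp: r_def add_nonneg_pos)
  define B where "B = ball a r"
  define m where "m = average M B u"
  have "very_weak_gradient (ball a (C\<^sub>0 * r)) u (\<lambda>_. 0)"
    unfolding very_weak_gradient_def
  proof (intro conjI allI impI)
    fix g :: "real \<Rightarrow> 'a" assume "rectifiable_curve g \<and> path_image g \<subseteq> ball a (C\<^sub>0 * r)"
    then have "connected (path_image g)" by (auto simp: rectifiable_curve_def connected_path_image)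
    then have "path_image g \<subseteq> U \<or> path_image g \<inter> U = {}"
      using connectedD[of "path_image g" U "- U"] U by blast
    then have "u (pathstart g) = u (pathfinish g)"
      using pathstart_in_path_image[of g] pathfinish_in_path_image[of g]
      unfolding u_def indicator_def by auto
    then show "ennreal \<bar>u (pathstart g) - u (pathfinish g)\<bar> \<le> curve_integral (\<lambda>_. 0) g" by simp
  qed simp_all
  moreover have "bounded (u ` S)" for S by (rule bounded_subset[of "{0, 1}"]) (auto simp: u_def indicator_def)
  ultimately have "ennreal (average M B (\<lambda>y. \<bar>u y - m\<bar>)) \<le> ennreal (C\<^sub>p * diameter B) *
      ennreal_powr ((\<integral>\<^sup>+ y\<in>ball a (C\<^sub>0 * r). ennreal_powr 0 p \<partial>M) / emeasure M (ball a (C\<^sub>0 * r))) (1 / p)"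
    unfolding B_def m_def using r contU by (intro ineq conjI) (auto intro: continuous_on_subset)
  then have "average M B (\<lambda>y. \<bar>u y - m\<bar>) \<le> 0"
    by (simp add: ennreal_powr_def ennreal_eq_0_iff)
  then have le: "(LINT y:B|M. \<bar>u y - m\<bar>) \<le> 0"
    using pos[OF r(1), of a] fin[OF r(1), of a]
    by (auto simp: average_def B_def divide_le_0_iff emeasure_eq_ennreal_measure)
  have [measurable]: "u \<in> borel_measurable M"
    using borel_measurable_continuous_onI[OF contU] borel space
    by (auto intro: borel_measurable_subalgebra)
  have [measurable]: "B \<in> sets M" using borel by (auto simp: B_def)
  have int: "integrable M (\<lambda>y. indicator B y * \<bar>u y - m\<bar>)"
  proof (rule Bochner_Integration.integrable_bound)
    show "integrable M (\<lambda>y. indicator B y * (1 + \<bar>m\<bar>))"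
      using fin[OF r(1), of a] by (auto simp: B_def[symmetric])
    show "AE y in M. norm (indicator B y * \<bar>u y - m\<bar>) \<le> norm (indicator B y * (1 + \<bar>m\<bar>))"
      by (auto simp: u_def indicator_def abs_mult)
  qed measurable
  have "(\<integral>y. indicator B y * \<bar>u y - m\<bar> \<partial>M) = 0"
    using le by (intro antisym integral_nonneg_AE) (auto simp: set_lebesgue_integral_def)
  then have "AE y in M. indicator B y * \<bar>u y - m\<bar> = 0"
    by (subst (asm) integral_nonneg_eq_0_iff_AE[OF int]) simp_all
  then have AE: "AE y in M. y \<in> B \<longrightarrow> u y = m" by eventually_elim (auto simp: indicator_def)
  have zero: "emeasure M (B \<inter> S) = 0" if "S \<in> sets borel" "\<And>y. y \<in> S \<Longrightarrow> u y \<noteq> m" for S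
  proof -
    have "AE y in M. y \<notin> B \<inter> S" using AE by eventually_elim (use that in auto)
    then have "B \<inter> S \<in> null_sets M"
      using that borel by (subst AE_iff_null_sets) auto
    then show ?thesis by auto
  qed
  show False
  proof (cases "m = 1")
    case True
    have "emeasure M (B \<inter> - U) = 0" by (rule zero) (use U True in \<open>auto simp: u_def\<close>)
    moreover have "b \<in> B \<inter> - U" using ab r by (simp add: B_def)
    moreover have "open (B \<inter> - U)" using U by (auto simp: B_def)
    ultimately show False using null[of "B \<inter> - U"] by blast
  next
    case False
    have "emeasure M (B \<inter> U) = 0" by (rule zero) (use U False in \<open>auto simp: u_def\<close>)
    moreover have "a \<in> B \<inter> U" using ab r by (simp add: B_def)
    moreover have "open (B \<inter> U)" using U by (auto simp: B_def)
    ultimately show False using null[of "B \<inter> U"] by blast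
  qed
qed

text \<open>For functions that are Lipschitz at small scales the local Lipschitz constant serves as the
  gradient. The inequality is raised to the power \<open>p\<close> and cleared of denominators, so that the
  right-hand side remains meaningful when the integral is infinite.\<close>

lemma weak_poincare_local_Lipschitz:
  fixes M :: "'a::metric_space measure"
  assumes M: "metric_measure_space M" and P: "weak_poincare M p" and p: "1 \<le> p"
  obtains C\<^sub>0 C\<^sub>p where "1 \<le> C\<^sub>0" "1 \<le> C\<^sub>p"
    "\<And>x r u \<Lambda> \<delta>. 0 < r \<Longrightarrow> 0 < \<delta> \<Longrightarrow> bounded (u ` ball x (C\<^sub>0 * r)) \<Longrightarrow>
       \<Lambda> \<in> borel_measurable borel \<Longrightarrow> (\<And>y. 0 \<le> \<Lambda> y) \<Longrightarrow>
       (\<And>y y'. dist y y' < \<delta> \<Longrightarrow> \<bar>u y - u y'\<bar> \<le> \<Lambda> y * dist y y') \<Longrightarrow>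
       ennreal (average M (ball x r) (\<lambda>y. \<bar>u y - average M (ball x r) u\<bar>) powr p * measure M (ball x (C\<^sub>0 * r)))
        \<le> ennreal ((2 * C\<^sub>p * r) powr p) * (\<integral>\<^sup>+ y\<in>ball x (C\<^sub>0 * r). ennreal (\<Lambda> y powr p) \<partial>M)"
proof -
  from P obtain C\<^sub>p C\<^sub>0 where C: "1 \<le> C\<^sub>p" "1 \<le> C\<^sub>0" and ineq:
    "\<And>x r u \<rho>. 0 < r \<Longrightarrow> continuous_on (ball x (C\<^sub>0 * r)) u \<and> bounded (u ` ball x (C\<^sub>0 * r)) \<and>
      very_weak_gradient (ball x (C\<^sub>0 * r)) u \<rho> \<Longrightarrow>
      ennreal (average M (ball x r) (\<lambda>y. \<bar>u y - average M (ball x r) u\<bar>))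
        \<le> ennreal (C\<^sub>p * diameter (ball x r)) *
           ennreal_powr ((\<integral>\<^sup>+ y\<in>ball x (C\<^sub>0 * r). ennreal_powr (\<rho> y) p \<partial>M)
                           / emeasure M (ball x (C\<^sub>0 * r))) (1 / p)"
    unfolding weak_poincare_def by blast
  obtain A where pos: "\<And>x r. 0 < r \<Longrightarrow> 0 < emeasure M (ball x r)"
    and fin: "\<And>x r. 0 < r \<Longrightarrow> emeasure M (ball x r) < \<infinity>"
    using metric_measure_spaceE[OF M] by metis
  show ?thesis
  proof (rule that[OF C(2,1)])
    fix x r \<delta> and u \<Lambda> :: "'a \<Rightarrow> real"
    assume r: "0 < r" and \<delta>: "0 < \<delta>" and bdd: "bounded (u ` ball x (C\<^sub>0 * r))"
      and \<Lambda>: "\<Lambda> \<in> borel_measurable borel" "\<And>y. 0 \<le> \<Lambda> y"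
      and Lip: "\<And>y y'. dist y y' < \<delta> \<Longrightarrow> \<bar>u y - u y'\<bar> \<le> \<Lambda> y * dist y y'"
    define a where "a = average M (ball x r) (\<lambda>y. \<bar>u y - average M (ball x r) u\<bar>)"
    define m where "m = measure M (ball x (C\<^sub>0 * r))"
    define I where "I = (\<integral>\<^sup>+ y\<in>ball x (C\<^sub>0 * r). ennreal (\<Lambda> y powr p) \<partial>M)"
    have r0: "0 < C\<^sub>0 * r" using C r by simp
    have m: "emeasure M (ball x (C\<^sub>0 * r)) = ennreal m" "0 < m"
      using pos[OF r0, of x] fin[OF r0, of x] by (auto simp: m_def emeasure_eq_ennreal_measure)
    have a: "0 \<le> a" unfolding a_def average_def set_lebesgue_integral_def
      by (intro divide_nonneg_nonneg integral_nonneg_AE) auto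
    have "continuous_on UNIV u"
      using \<delta> Lip by (intro continuous_on_of_pointwise_Lipschitz) blast
    then have cont: "continuous_on (ball x (C\<^sub>0 * r)) u" by (rule continuous_on_subset) simp
    have grad: "very_weak_gradient (ball x (C\<^sub>0 * r)) u (\<lambda>y. ennreal (\<Lambda> y))"
      by (rule very_weak_gradient_local_Lipschitz[OF open_ball \<Lambda> \<delta> Lip])
    have ineq1: "ennreal a \<le> ennreal (C\<^sub>p * diameter (ball x r)) *
        ennreal_powr ((\<integral>\<^sup>+ y\<in>ball x (C\<^sub>0 * r). ennreal_powr (ennreal (\<Lambda> y)) p \<partial>M) / emeasure M (ball x (C\<^sub>0 * r))) (1 / p)"
      unfolding a_def by (rule ineq[OF r conjI[OF cont conjI[OF bdd grad]]])
    have "diameter (ball x r) \<le> 2 * r"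
    proof -
      have "(SUP (y, z)\<in>ball x r \<times> ball x r. dist y z) \<le> 2 * r"
      proof (rule cSUP_least)
        show "ball x r \<times> ball x r \<noteq> {}" using r by auto
        fix q assume "q \<in> ball x r \<times> ball x r"
        then show "(case q of (y, z) \<Rightarrow> dist y z) \<le> 2 * r"
          using dist_triangle[of "fst q" "snd q" x] by (auto simp: dist_commute split: prod.splits)
      qed
      then show ?thesis using r by (simp add: diameter_def)
    qed
    then have diam: "ennreal (C\<^sub>p * diameter (ball x r)) \<le> ennreal (2 * C\<^sub>p * r)"
      using C by (intro ennreal_leI) simp
    have pw: "ennreal_powr (ennreal (\<Lambda> y)) p = ennreal (\<Lambda> y powr p)" for y
      using \<Lambda>(2)[of y] by (simp add: ennreal_powr_def)
    have le: "ennreal a \<le> ennreal (2 * C\<^sub>p * r) * ennreal_powr (I / ennreal m) (1 / p)"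
      unfolding I_def m(1)[symmetric]
      by (rule order_trans[OF ineq1[unfolded pw] mult_right_mono[OF diam zero_le]])
    have "ennreal (a powr p * m) \<le> ennreal ((2 * C\<^sub>p * r) powr p) * I"
    proof (cases I)
      case top then show ?thesis using C r by (simp add: ennreal_mult_top)
    next
      case (real i)
      have "ennreal a \<le> ennreal (2 * C\<^sub>p * r * (i / m) powr (1 / p))"
        using le real m C r by (simp add: divide_ennreal ennreal_powr_def ennreal_mult)
      then have "a \<le> 2 * C\<^sub>p * r * (i / m) powr (1 / p)"
        using C r by (subst (asm) ennreal_le_iff) auto
      then have "a powr p \<le> (2 * C\<^sub>p * r * (i / m) powr (1 / p)) powr p"
        using a p by (intro powr_mono2) auto
      also have "\<dots> = (2 * C\<^sub>p * r) powr p * (i / m)"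
        using C r real m p by (simp add: powr_mult powr_powr)
      finally have "a powr p * m \<le> (2 * C\<^sub>p * r) powr p * i"
        using m by (simp add: field_simps)
      then show ?thesis using real by (simp add: ennreal_leI flip: ennreal_mult)
    qed
    then show "ennreal (average M (ball x r) (\<lambda>y. \<bar>u y - average M (ball x r) u\<bar>) powr p * measure M (ball x (C\<^sub>0 * r)))
        \<le> ennreal ((2 * C\<^sub>p * r) powr p) * (\<integral>\<^sup>+ y\<in>ball x (C\<^sub>0 * r). ennreal (\<Lambda> y powr p) \<partial>M)"
      by (simp add: a_def m_def I_def)
  qed
qed

section \<open>Doubling measures and covering\<close>

text \<open>Apply Zorn's lemma to the disjoint subfamilies \<open>F\<close> with the property that every ball of the
  family that meets a member of \<open>F\<close> meets one of at least half its radius. A ball that meets no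
  member of a maximal \<open>F\<close> would allow adding a ball of nearly the largest radius among such
  balls.\<close>

lemma Vitali_covering:
  fixes A :: "'a::metric_space set"
  assumes \<rho>: "\<And>x. x \<in> A \<Longrightarrow> 0 < \<rho> x" "\<And>x. x \<in> A \<Longrightarrow> \<rho> x \<le> (R::real)"
  obtains D where "D \<subseteq> A"
    "\<And>x y. x \<in> D \<Longrightarrow> y \<in> D \<Longrightarrow> x \<noteq> y \<Longrightarrow> cball x (\<rho> x) \<inter> cball y (\<rho> y) = {}"
    "\<And>x. x \<in> A \<Longrightarrow> \<exists>y\<in>D. cball x (\<rho> x) \<subseteq> cball y (5 * \<rho> y)"
proof -
  define meets where "meets x y \<longleftrightarrow> cball x (\<rho> x) \<inter> cball y (\<rho> y) \<noteq> {}" for x y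
  define \<Omega> where "\<Omega> = {F. F \<subseteq> A \<and> (\<forall>x\<in>F. \<forall>y\<in>F. x \<noteq> y \<longrightarrow> \<not> meets x y) \<and>
      (\<forall>x\<in>A. (\<exists>y\<in>F. meets x y) \<longrightarrow> (\<exists>y\<in>F. meets x y \<and> \<rho> x \<le> 2 * \<rho> y))}"
  have "\<exists>F\<in>\<Omega>. \<forall>X\<in>\<Omega>. F \<subseteq> X \<longrightarrow> X = F"
  proof (rule subset_Zorn_nonempty)
    show "\<Omega> \<noteq> {}" unfolding \<Omega>_def by (intro ex_in_conv[THEN iffD1] exI[of _ "{}"]) simp
    fix \<C> assume "\<C> \<noteq> {}" and ch: "subset.chain \<Omega> \<C>"
    have sub: "F \<in> \<Omega>" if "F \<in> \<C>" for F using ch that by (auto simp: subset.chain_def)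
    have tot: "F \<subseteq> G \<or> G \<subseteq> F" if "F \<in> \<C>" "G \<in> \<C>" for F G
      using ch that by (auto simp: subset.chain_def)
    show "\<Union>\<C> \<in> \<Omega>"
      unfolding \<Omega>_def mem_Collect_eq
    proof (intro conjI ballI impI)
      have "F \<subseteq> A" if "F \<in> \<C>" for F using sub[OF that] by (simp add: \<Omega>_def)
      then show "\<Union>\<C> \<subseteq> A" by blast
    next
      fix x y assume "x \<in> \<Union>\<C>" "y \<in> \<Union>\<C>" and "x \<noteq> y"
      then obtain F G where FG: "x \<in> F" "F \<in> \<C>" "y \<in> G" "G \<in> \<C>" by blast
      then have "\<exists>H\<in>\<C>. x \<in> H \<and> y \<in> H" using tot[of F G] by blast
      then show "\<not> meets x y" using sub \<open>x \<noteq> y\<close> unfolding \<Omega>_def by blast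
    next
      fix x assume "x \<in> A" "\<exists>y\<in>\<Union>\<C>. meets x y"
      then obtain y F where "y \<in> F" "F \<in> \<C>" "meets x y" by blast
      then have "\<exists>y\<in>F. meets x y \<and> \<rho> x \<le> 2 * \<rho> y" using sub[of F] \<open>x \<in> A\<close> unfolding \<Omega>_def by blast
      then show "\<exists>y\<in>\<Union>\<C>. meets x y \<and> \<rho> x \<le> 2 * \<rho> y" using \<open>F \<in> \<C>\<close> by blast
    qed
  qed
  then obtain F where F: "F \<in> \<Omega>" and max: "\<And>X. X \<in> \<Omega> \<Longrightarrow> F \<subseteq> X \<Longrightarrow> X = F" by blast
  have FA: "F \<subseteq> A" and Fd: "\<And>x y. x \<in> F \<Longrightarrow> y \<in> F \<Longrightarrow> x \<noteq> y \<Longrightarrow> \<not> meets x y"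
    and Fm: "\<And>x. x \<in> A \<Longrightarrow> \<exists>y\<in>F. meets x y \<Longrightarrow> \<exists>y\<in>F. meets x y \<and> \<rho> x \<le> 2 * \<rho> y"
    using F by (auto simp: \<Omega>_def)
  have sym: "meets x y \<longleftrightarrow> meets y x" for x y by (auto simp: meets_def)
  have all: "\<exists>y\<in>F. meets x y" if "x \<in> A" for x
  proof (rule ccontr)
    define G where "G = {x \<in> A. \<forall>y\<in>F. \<not> meets x y}"
    assume "\<not> (\<exists>y\<in>F. meets x y)"
    then have xG: "x \<in> G" using that by (auto simp: G_def)
    have bdd: "bdd_above (\<rho> ` G)" using \<rho>(2) by (intro bdd_aboveI[of _ R]) (auto simp: G_def)
    define S where "S = (SUP x\<in>G. \<rho> x)"
    have le: "\<rho> z \<le> S" if "z \<in> G" for z unfolding S_def using bdd that by (rule cSUP_upper2) simp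
    have "0 < S" using le[OF xG] \<rho>(1)[OF that] by simp
    then have "S / 2 < (SUP x\<in>G. \<rho> x)" by (simp add: S_def[symmetric])
    then obtain z where z: "z \<in> G" "S / 2 < \<rho> z"
      using bdd xG by (subst (asm) less_cSUP_iff) auto
    have "insert z F \<in> \<Omega>"
      unfolding \<Omega>_def mem_Collect_eq
    proof (intro conjI ballI impI)
      show "insert z F \<subseteq> A" using FA z by (auto simp: G_def)
    next
      fix u v assume uv: "u \<in> insert z F" "v \<in> insert z F" "u \<noteq> v"
      then show "\<not> meets u v" using Fd z(1) sym by (auto simp: G_def)
    next
      fix u assume u: "u \<in> A" "\<exists>y\<in>insert z F. meets u y"
      show "\<exists>y\<in>insert z F. meets u y \<and> \<rho> u \<le> 2 * \<rho> y"
      proof (cases "\<exists>y\<in>F. meets u y")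
        case True then show ?thesis using Fm[OF u(1)] by blast
      next
        case False
        then have "meets u z" "u \<in> G" using u by (auto simp: G_def)
        then show ?thesis using le[of u] z by auto
      qed
    qed
    then have "z \<in> F" using max[of "insert z F"] by blast
    moreover have "meets z z" using \<rho>(1)[of z] z by (auto simp: meets_def G_def intro!: exI[of _ z])
    ultimately show False using z by (auto simp: G_def)
  qed
  show ?thesis
  proof (rule that[OF FA])
    show "cball x (\<rho> x) \<inter> cball y (\<rho> y) = {}" if "x \<in> F" "y \<in> F" "x \<noteq> y" for x y
      using Fd[OF that] by (simp add: meets_def)
    fix x assume "x \<in> A"
    then obtain y where y: "y \<in> F" "meets x y" "\<rho> x \<le> 2 * \<rho> y" using Fm all by blast
    then obtain w where w: "dist x w \<le> \<rho> x" "dist y w \<le> \<rho> y" by (auto simp: meets_def)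
    have "cball x (\<rho> x) \<subseteq> cball y (5 * \<rho> y)"
    proof
      fix v assume "v \<in> cball x (\<rho> x)"
      then have "dist x v \<le> \<rho> x" by simp
      moreover have "dist y v \<le> dist y w + dist w x + dist x v"
        by (meson add_mono_thms_linordered_semiring(1) dist_triangle order_refl order_trans)
      ultimately show "v \<in> cball y (5 * \<rho> y)" using w y(3) by (simp add: dist_commute)
    qed
    then show "\<exists>y\<in>F. cball x (\<rho> x) \<subseteq> cball y (5 * \<rho> y)" using y(1) by blast
  qed
qed

text \<open>A homeomorphism preserves the Borel sets but possibly not a larger sigma-algebra. For Borel
  measures the pullback measure is again of this kind.\<close>

locale doubling_measure =
  fixes \<mu> :: "'a::metric_space measure" and A :: real
  assumes sets_eq_borel [measurable_cong, simp]: "sets \<mu> = sets borel"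
    and emeasure_ball_pos: "0 < r \<Longrightarrow> 0 < emeasure \<mu> (ball x r)"
    and emeasure_ball_finite: "0 < r \<Longrightarrow> emeasure \<mu> (ball x r) < \<infinity>"
    and measure_ball_double: "0 < r \<Longrightarrow> measure \<mu> (ball x (2 * r)) \<le> A * measure \<mu> (ball x r)"
begin

lemma space_eq_UNIV [simp]: "space \<mu> = UNIV"
  using sets_eq_imp_space_eq[OF sets_eq_borel] by simp

lemma emeasure_bounded_finite:
  assumes "S \<subseteq> cball x r" shows "emeasure \<mu> S < \<infinity>"
proof -
  have "S \<subseteq> ball x (\<bar>r\<bar> + 1)" using assms by force
  then have "emeasure \<mu> S \<le> emeasure \<mu> (ball x (\<bar>r\<bar> + 1))" by (intro emeasure_mono) auto
  also have "\<dots> < \<infinity>" by (intro emeasure_ball_finite) simp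
  finally show ?thesis .
qed

lemma emeasure_eq_measure_bounded:
  assumes "S \<subseteq> cball x r" shows "emeasure \<mu> S = ennreal (measure \<mu> S)"
  using emeasure_bounded_finite[OF assms] by (intro emeasure_eq_ennreal_measure) auto

lemma emeasure_ball: "emeasure \<mu> (ball x r) = ennreal (measure \<mu> (ball x r))"
  by (rule emeasure_eq_measure_bounded[of _ x r]) auto

lemma emeasure_cball: "emeasure \<mu> (cball x r) = ennreal (measure \<mu> (cball x r))"
  by (rule emeasure_eq_measure_bounded[of _ x r]) auto

lemma measure_mono_bounded:
  assumes "S \<subseteq> T" "T \<subseteq> cball x r" "S \<in> sets borel" "T \<in> sets borel"
  shows "measure \<mu> S \<le> measure \<mu> T"
  using emeasure_bounded_finite[OF assms(2)] assms by (intro measure_mono_fmeasurable) (auto simp: fmeasurable_def)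

lemma measure_ball_pos: "0 < r \<Longrightarrow> 0 < measure \<mu> (ball x r)"
  using emeasure_ball_pos[of r x] by (simp add: emeasure_ball)

lemma measure_ball_le_cball: "measure \<mu> (ball x r) \<le> measure \<mu> (cball x r)"
  by (rule measure_mono_bounded[of _ _ x r]) auto

lemma measure_cball_pos: "0 < r \<Longrightarrow> 0 < measure \<mu> (cball x r)"
  using measure_ball_pos[of r x] measure_ball_le_cball[of x r] by simp

text \<open>Iterated doubling compares any two balls whose centres are close and whose radii are
  comparable; all later uses of doubling have this form.\<close>

lemma ball_comparison:
  "\<exists>C\<ge>1. \<forall>x y r r'. 0 < r \<longrightarrow> r' \<le> K * r \<longrightarrow> dist x y \<le> K * r \<longrightarrow>
      measure \<mu> (cball y r') \<le> C * measure \<mu> (ball x r)"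
proof -
  obtain n where n: "2 * K < 2 ^ n" using real_arch_pow[of 2 "2 * K"] by auto
  have A: "0 \<le> A"
  proof -
    have "0 \<le> A * measure \<mu> (ball undefined 1)"
      using measure_ball_double[of 1 undefined] by (rule order_trans[rotated]) simp_all
    then show ?thesis using measure_ball_pos[of 1 undefined] by (simp add: zero_le_mult_iff)
  qed
  have it: "measure \<mu> (ball x (2 ^ n * r)) \<le> A ^ n * measure \<mu> (ball x r)" if "0 < r" for x r
  proof (induction n)
    case (Suc n)
    have "measure \<mu> (ball x (2 ^ Suc n * r)) \<le> A * measure \<mu> (ball x (2 ^ n * r))"
      using measure_ball_double[of "2 ^ n * r" x] that by (simp add: mult_ac)
    also have "\<dots> \<le> A * (A ^ n * measure \<mu> (ball x r))" using Suc A by (intro mult_left_mono) auto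
    finally show ?case by (simp add: mult_ac)
  qed simp
  show ?thesis
  proof (intro exI[of _ "max 1 (A ^ n)"] conjI allI impI)
    fix x y :: 'a and r r' :: real assume r: "0 < r" "r' \<le> K * r" "dist x y \<le> K * r"
    have "cball y r' \<subseteq> ball x (2 ^ n * r)"
    proof
      fix z assume "z \<in> cball y r'"
      then have "dist x z \<le> K * r + K * r" using dist_triangle[of x z y] r by simp
      also have "\<dots> < 2 ^ n * r" using n r(1) by (simp flip: distrib_right mult_2)
      finally show "z \<in> ball x (2 ^ n * r)" by simp
    qed
    then have "measure \<mu> (cball y r') \<le> measure \<mu> (ball x (2 ^ n * r))"
      by (rule measure_mono_bounded[OF _ ball_subset_cball]) auto
    also have "\<dots> \<le> A ^ n * measure \<mu> (ball x r)" by (rule it[OF r(1)])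
    also have "\<dots> \<le> max 1 (A ^ n) * measure \<mu> (ball x r)" by (intro mult_right_mono) auto
    finally show "measure \<mu> (cball y r') \<le> max 1 (A ^ n) * measure \<mu> (ball x r)" .
  qed simp
qed

lemma countable_disjoint_cballs:
  fixes D :: "'a set"
  assumes \<rho>: "\<And>x. x \<in> D \<Longrightarrow> 0 < \<rho> x" "\<And>x. x \<in> D \<Longrightarrow> \<rho> x \<le> R"
    and disj: "\<And>x y. x \<in> D \<Longrightarrow> y \<in> D \<Longrightarrow> x \<noteq> y \<Longrightarrow> cball x (\<rho> x) \<inter> cball y (\<rho> y) = {}"
  shows "countable D"
proof -
  define a :: 'a where "a = undefined"
  define E where "E n = {x\<in>D. dist a x \<le> n \<and> 1 / Suc n \<le> measure \<mu> (cball x (\<rho> x))}" for n :: nat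
  have "finite (E n)" for n
  proof -
    have "card F \<le> nat \<lceil>measure \<mu> (cball a (n + R)) * Suc n\<rceil>" if F: "F \<subseteq> E n" "finite F" for F
   proof -
    have "card F * (1 / Suc n) \<le> (\<Sum>x\<in>F. measure \<mu> (cball x (\<rho> x)))"
      using F by (intro sum_bounded_below) (auto simp: E_def)
    also have "\<dots> = measure \<mu> (\<Union>x\<in>F. cball x (\<rho> x))"
    proof (rule measure_finite_Union[symmetric])
      have "F \<subseteq> D" using F by (auto simp: E_def)
      then show "disjoint_family_on (\<lambda>x. cball x (\<rho> x)) F"
        unfolding disjoint_family_on_def using disj by blast
    qed (use F emeasure_cball in auto)
    also have "\<dots> \<le> measure \<mu> (cball a (n + R))"
    proof (rule measure_mono_bounded[OF _ order_refl])
      show "(\<Union>x\<in>F. cball x (\<rho> x)) \<subseteq> cball a (n + R)"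
      proof (intro UN_least subsetI)
        fix x z assume "x \<in> F" "z \<in> cball x (\<rho> x)"
        then have "dist a x \<le> n" "dist x z \<le> R" using F \<rho>(2)[of x] by (auto simp: E_def)
        then show "z \<in> cball a (n + R)" using dist_triangle[of a z x] by simp
      qed
    qed (use F in auto)
    finally have "card F \<le> measure \<mu> (cball a (n + R)) * Suc n" by (simp add: field_simps)
    then show ?thesis by linarith
   qed
   from finite_if_finite_subsets_card_bdd[OF this] show ?thesis by blast
  qed
  moreover have "D \<subseteq> (\<Union>n. E n)"
  proof
    fix x assume x: "x \<in> D"
    obtain n1 :: nat where n1: "dist a x \<le> n1" using real_arch_simple by blast
    obtain n2 :: nat where n2: "1 / Suc n2 < measure \<mu> (cball x (\<rho> x))"
      using nat_approx_posE[OF measure_cball_pos[OF \<rho>(1)[OF x]]] by metis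
    have "1 / Suc (max n1 n2) \<le> 1 / real (Suc n2)" by (intro divide_left_mono) auto
    then have "x \<in> E (max n1 n2)" using x n1 n2 by (auto simp: E_def)
    then show "x \<in> (\<Union>n. E n)" by blast
  qed
  ultimately show ?thesis
    by (meson countable_UN countable_finite countable_subset countableI_type)
qed

text \<open>If \<open>a\<close> of each enlarged ball is bounded by \<open>b\<close> of the ball itself, then summing over a Vitali
  subfamily bounds \<open>a\<close> of a neighbourhood of the centres. The Borel superset \<open>S'\<close> is the union
  of the enlarged balls; it replaces \<open>S\<close>, whose measurability is unknown in the application to
  density points.\<close>

lemma Vitali_measure_comparison:
  fixes S U :: "'a set"
  assumes sets: "sets a = sets borel" "sets b = sets borel" "U \<in> sets borel"
    and \<rho>: "\<And>x. x \<in> S \<Longrightarrow> 0 < \<rho> x" "\<And>x. x \<in> S \<Longrightarrow> \<rho> x \<le> R"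
    and le: "\<And>x. x \<in> S \<Longrightarrow> emeasure a (cball x (5 * \<rho> x)) \<le> c * emeasure b (cball x (\<rho> x))"
    and sub: "\<And>x. x \<in> S \<Longrightarrow> cball x (\<rho> x) \<subseteq> U"
  shows "\<exists>S'\<in>sets borel. S \<subseteq> S' \<and> emeasure a S' \<le> c * emeasure b U"
proof -
  note [measurable_cong] = sets(1,2)
  obtain D where D: "D \<subseteq> S"
    and disj: "\<And>x y. x \<in> D \<Longrightarrow> y \<in> D \<Longrightarrow> x \<noteq> y \<Longrightarrow> cball x (\<rho> x) \<inter> cball y (\<rho> y) = {}"
    and cover: "\<And>x. x \<in> S \<Longrightarrow> \<exists>y\<in>D. cball x (\<rho> x) \<subseteq> cball y (5 * \<rho> y)"
    using Vitali_covering[of S \<rho> R] \<rho> by metis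
  have "countable D" by (rule countable_disjoint_cballs[of D \<rho> R]) (use \<rho> D disj in auto)
  define f where "f = to_nat_on D"
  have f: "inj_on f D" unfolding f_def using \<open>countable D\<close> by (rule inj_on_to_nat_on)
  define X where "X n = (if n \<in> f ` D then cball (inv_into D f n) (5 * \<rho> (inv_into D f n)) else {})" for n
  define Y where "Y n = (if n \<in> f ` D then cball (inv_into D f n) (\<rho> (inv_into D f n)) else {})" for n
  have inD: "inv_into D f n \<in> D" if "n \<in> f ` D" for n using that by (rule inv_into_into)
  have XY: "emeasure a (X n) \<le> c * emeasure b (Y n)" for n
    using le[of "inv_into D f n"] inD[of n] D by (auto simp: X_def Y_def)
  have dY: "disjoint_family Y"
    unfolding disjoint_family_on_def
  proof (intro ballI impI)
    fix m n :: nat assume "m \<noteq> n"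
    show "Y m \<inter> Y n = {}"
    proof (cases "m \<in> f ` D \<and> n \<in> f ` D")
      case True
      then have "inv_into D f m \<noteq> inv_into D f n" using \<open>m \<noteq> n\<close> by (metis f_inv_into_f)
      then show ?thesis using True disj inD by (simp add: Y_def)
    qed (auto simp: Y_def)
  qed
  have SX: "S \<subseteq> (\<Union>n. X n)"
  proof
    fix x assume x: "x \<in> S"
    then obtain y where y: "y \<in> D" "cball x (\<rho> x) \<subseteq> cball y (5 * \<rho> y)" using cover by blast
    moreover have "x \<in> cball x (\<rho> x)" using \<rho>(1)[OF x] by simp
    ultimately have "x \<in> X (f y)" using f by (auto simp: X_def simp del: mem_cball)
    then show "x \<in> (\<Union>n. X n)" by blast
  qed
  have mXY: "X n \<in> sets borel" "Y n \<in> sets borel" for n by (simp_all add: X_def Y_def)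
  have "emeasure a (\<Union>n. X n) \<le> (\<Sum>n. emeasure a (X n))"
    using mXY by (intro emeasure_subadditive_countably) (auto simp: sets)
  also have "(\<Sum>n. emeasure a (X n)) \<le> (\<Sum>n. c * emeasure b (Y n))"
    by (intro suminf_le XY) auto
  also have "\<dots> = c * emeasure b (\<Union>n. Y n)"
    using mXY by (subst suminf_emeasure[OF _ dY, symmetric]) (auto simp: sets)
  also have "\<dots> \<le> c * emeasure b U"
  proof (intro mult_left_mono emeasure_mono)
    have "Y n \<subseteq> U" for n using sub inD[of n] D by (auto simp: Y_def)
    then show "(\<Union>n. Y n) \<subseteq> U" by blast
  qed (use sets in auto)
  finally have "emeasure a (\<Union>n. X n) \<le> c * emeasure b U" .
  then show ?thesis using mXY SX by blast
qed

text \<open>A family of disjoint balls of a fixed radius is countable, because each of them has positive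
  measure and bounded sets have finite measure. The Vitali lemma turns such families into nets.\<close>

lemma countable_dense:
  obtains Z :: "'a set" where "countable Z" "\<And>x e. 0 < e \<Longrightarrow> \<exists>z\<in>Z. dist z x < e"
proof -
  have "\<exists>D::'a set. countable D \<and> (\<forall>x. \<exists>y\<in>D. dist y x \<le> 5 / Suc n)" for n
  proof -
    obtain D :: "'a set" where D: "\<And>x y. x \<in> D \<Longrightarrow> y \<in> D \<Longrightarrow> x \<noteq> y \<Longrightarrow> cball x (1 / Suc n) \<inter> cball y (1 / Suc n) = {}"
      "\<And>x. \<exists>y\<in>D. cball x (1 / Suc n) \<subseteq> cball y (5 * (1 / Suc n))"
      using Vitali_covering[of UNIV "\<lambda>_. 1 / Suc n" "1 / Suc n"] by auto
    have "countable D"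
      by (rule countable_disjoint_cballs[of D "\<lambda>_. 1 / Suc n" "1 / Suc n"]) (use D(1) in auto)
    moreover have "\<exists>y\<in>D. dist y x \<le> 5 / Suc n" for x
    proof -
      obtain y where "y \<in> D" "cball x (1 / Suc n) \<subseteq> cball y (5 * (1 / Suc n))" using D(2) by blast
      moreover have "x \<in> cball x (1 / Suc n)" by simp
      ultimately have "dist y x \<le> 5 * (1 / Suc n)" by (meson mem_cball subsetD)
      then show ?thesis using \<open>y \<in> D\<close> by auto
    qed
    ultimately show ?thesis by metis
  qed
  then have "\<forall>n. \<exists>D::'a set. countable D \<and> (\<forall>x. \<exists>y\<in>D. dist y x \<le> 5 / Suc n)" by blast
  from choice[OF this] obtain D :: "nat \<Rightarrow> 'a set"
    where D: "\<And>n. countable (D n)" "\<And>n x. \<exists>y\<in>D n. dist y x \<le> 5 / Suc n" by blast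
  show ?thesis
  proof (rule that[of "\<Union>n. D n"])
    show "countable (\<Union>n. D n)" using D(1) by blast
    fix x and e :: real assume "0 < e"
    then obtain n where "1 / real (Suc n) < e / 5" using nat_approx_posE[of "e / 5"] by auto
    then have "5 / real (Suc n) < e" by (simp add: field_simps)
    moreover obtain y where "y \<in> D n" "dist y x \<le> 5 / Suc n" using D(2) by blast
    ultimately show "\<exists>z\<in>\<Union>n. D n. dist z x < e" by (intro bexI[of _ y]) auto
  qed
qed

text \<open>In a separable space, \<open>d(x,y) < e\<close> is witnessed by a point \<open>z\<close> of a countable dense set and a
  rational \<open>q\<close> with \<open>d(z,x) < q\<close> and \<open>d(z,y) < e - q\<close>. So the set of such pairs is a countable
  union of rectangles, as Fubini's theorem requires.\<close>

lemma dist_measurable_pair: "(\<lambda>w. dist (fst w) (snd w)) \<in> borel_measurable (borel \<Otimes>\<^sub>M (borel :: 'a measure))"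
proof -
  obtain Z :: "'a set" where Z: "countable Z" "\<And>x e. 0 < e \<Longrightarrow> \<exists>z\<in>Z. dist z x < e"
    by (rule countable_dense) blast
  have "{w. dist (fst w) (snd w) < e} \<in> sets (borel \<Otimes>\<^sub>M (borel :: 'a measure))" for e
  proof -
    have "{w. dist (fst w) (snd w) < e} = (\<Union>z\<in>Z. \<Union>q\<in>\<rat>. ball z q \<times> ball z (e - q))" (is "?L = ?R")
    proof (intro equalityI subsetI)
      fix w assume "w \<in> ?L"
      then obtain x y where w: "w = (x, y)" and d: "dist x y < e" by (cases w) auto
      define \<delta> where "\<delta> = (e - dist x y) / 4"
      have "0 < \<delta>" using d by (simp add: \<delta>_def)
      then obtain z where z: "z \<in> Z" "dist z x < \<delta>" using Z(2) by blast
      obtain q where q: "q \<in> \<rat>" "\<delta> < q" "q < 2 * \<delta>" using Rats_dense_in_real[of \<delta> "2 * \<delta>"] \<open>0 < \<delta>\<close> by auto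
      have "dist z y < e - q" using dist_triangle[of z y x] z q by (simp add: \<delta>_def)
      moreover have "dist z x < q" using z q by simp
      ultimately have "w \<in> ball z q \<times> ball z (e - q)" by (simp add: w)
      then show "w \<in> ?R" by (intro UN_I[OF z(1)] UN_I[OF q(1)])
    next
      fix w assume "w \<in> ?R"
      then obtain z q where "dist z (fst w) < q" "dist z (snd w) < e - q" by auto
      then show "w \<in> ?L" using dist_triangle3[of "fst w" "snd w" z] by simp
    qed
    also have "\<dots> \<in> sets (borel \<Otimes>\<^sub>M borel)"
      using Z(1) countable_rat by (intro sets.countable_UN' pair_measureI) auto
    finally show ?thesis .
  qed
  then show ?thesis unfolding borel_measurable_iff_less by (simp add: space_pair_measure)
qed

lemma measurable_dist [measurable (raw)]:
  fixes f g :: "'b \<Rightarrow> 'a"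
  assumes "f \<in> measurable M borel" "g \<in> measurable M borel"
  shows "(\<lambda>x. dist (f x) (g x)) \<in> borel_measurable M"
  using measurable_compose[OF measurable_Pair[OF assms] dist_measurable_pair] by simp

sublocale sigma_finite_measure \<mu>
proof
  define a :: 'a where "a = undefined"
  show "\<exists>A. countable A \<and> A \<subseteq> sets \<mu> \<and> \<Union> A = space \<mu> \<and> (\<forall>a\<in>A. emeasure \<mu> a \<noteq> \<infinity>)"
  proof (intro exI[of _ "range (\<lambda>n::nat. ball a n)"] conjI ballI)
    show "\<Union> (range (\<lambda>n::nat. ball a n)) = space \<mu>"
      using reals_Archimedean2 by (auto simp: set_eq_iff)
  qed (auto simp: emeasure_ball)
qed

end

section \<open>Smoothing and density points\<close>

lemma abs_integral_le_integral:
  fixes f g :: "'a \<Rightarrow> real"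
  assumes "integrable M f" "integrable M g" "\<And>x. \<bar>f x\<bar> \<le> g x"
  shows "\<bar>\<integral>x. f x \<partial>M\<bar> \<le> (\<integral>x. g x \<partial>M)"
proof -
  have "\<bar>\<integral>x. f x \<partial>M\<bar> \<le> (\<integral>x. \<bar>f x\<bar> \<partial>M)" by (rule integral_abs_bound)
  also have "\<dots> \<le> (\<integral>x. g x \<partial>M)" using assms by (intro integral_mono) auto
  finally show ?thesis .
qed

context doubling_measure begin

lemma kernel_integral:
  fixes k g :: "'a \<Rightarrow> real"
  assumes [measurable]: "k \<in> borel_measurable borel" "g \<in> borel_measurable borel"
    and k: "\<And>z. \<bar>k z\<bar> \<le> c * indicator (cball y R) z" and g: "\<And>z. z \<in> cball y R \<Longrightarrow> \<bar>g z\<bar> \<le> T" and c: "0 \<le> c"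
  shows "integrable \<mu> (\<lambda>z. k z * g z)"
    and "\<bar>\<integral>z. k z * g z \<partial>\<mu>\<bar> \<le> c * T * measure \<mu> (cball y R)"
proof -
  have int: "integrable \<mu> (\<lambda>z. indicator (cball y R) z * (c * T))"
    by (intro integrable_mult_left integrable_real_indicator) (auto simp: emeasure_cball)
  have bd: "norm (k z * g z) \<le> indicator (cball y R) z * (c * T)" for z
  proof (cases "z \<in> cball y R")
    case True
    then show ?thesis using mult_mono[OF k[of z] g[OF True]] c by (simp add: abs_mult)
  next
    case False
    then show ?thesis using k[of z] by simp
  qed
  show "integrable \<mu> (\<lambda>z. k z * g z)"
    using bd by (intro Bochner_Integration.integrable_bound[OF int] AE_I2)
      (auto intro: order_trans[OF _ abs_ge_self])
  then have "\<bar>\<integral>z. k z * g z \<partial>\<mu>\<bar> \<le> (\<integral>z. indicator (cball y R) z * (c * T) \<partial>\<mu>)"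
    using int bd by (intro abs_integral_le_integral) auto
  then show "\<bar>\<integral>z. k z * g z \<partial>\<mu>\<bar> \<le> c * T * measure \<mu> (cball y R)"
    by (simp add: mult_ac)
qed

text \<open>The smoothed function is the average of \<open>u\<close> with respect to the kernel \<open>max 0 (1 - d(y,z)/\<epsilon>)\<close>.
  The kernel is Lipschitz in \<open>y\<close> with constant \<open>1/\<epsilon>\<close> and its integral is comparable with the
  measure of a ball of radius \<open>\<epsilon>\<close>, so the local Lipschitz constant of the average at \<open>y\<close> is the
  oscillation of \<open>u\<close> near \<open>y\<close> divided by \<open>\<epsilon>\<close>.\<close>

lemma Lipschitz_smoothing:
  "\<exists>C\<ge>1. \<forall>u::'a \<Rightarrow> real. \<forall>\<epsilon>>0. u \<in> borel_measurable borel \<longrightarrow> (\<forall>x r. bounded (u ` cball x r)) \<longrightarrow>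
     (\<exists>v. continuous_on UNIV v \<and> (\<forall>y T. (\<forall>z\<in>cball y (2 * \<epsilon>). \<bar>u z - u y\<bar> \<le> T) \<longrightarrow>
        \<bar>v y - u y\<bar> \<le> T \<and> (\<forall>y'. dist y y' \<le> \<epsilon> \<longrightarrow> \<bar>v y - v y'\<bar> \<le> C * T / \<epsilon> * dist y y')))"
proof -
  obtain C where C: "1 \<le> C" and comp: "\<And>x y r r'. 0 < r \<Longrightarrow> r' \<le> 4 * r \<Longrightarrow> dist x y \<le> 4 * r \<Longrightarrow>
      measure \<mu> (cball y r') \<le> C * measure \<mu> (ball x r)"
    using ball_comparison[of 4] by blast
  show ?thesis
  proof (intro exI[of _ "4 * C"] conjI allI impI)
    show "1 \<le> 4 * C" using C by simp
    fix u :: "'a \<Rightarrow> real" and \<epsilon> :: real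
    assume \<epsilon>: "0 < \<epsilon>" and u[measurable]: "u \<in> borel_measurable borel"
      and bdd: "\<forall>x r. bounded (u ` cball x r)"
    define \<phi> where "\<phi> y z = max 0 (1 - dist y z / \<epsilon>)" for y z :: 'a
    define \<Phi> where "\<Phi> y = (\<integral>z. \<phi> y z \<partial>\<mu>)" for y
    define v where "v y = (\<integral>z. \<phi> y z * u z \<partial>\<mu>) / \<Phi> y" for y
    have m\<phi>[measurable]: "\<phi> y \<in> borel_measurable borel" for y unfolding \<phi>_def by measurable
    have \<phi>0: "0 \<le> \<phi> y z" for y z by (simp add: \<phi>_def)
    have \<phi>1: "\<bar>\<phi> y z\<bar> \<le> 1 * indicator (cball y \<epsilon>) z" for y z
      using \<epsilon> by (auto simp: \<phi>_def indicator_def field_simps)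
    have \<phi>2: "\<bar>\<phi> y z - \<phi> y' z\<bar> \<le> (dist y y' / \<epsilon>) * indicator (cball y (2 * \<epsilon>)) z" if "dist y y' \<le> \<epsilon>" for y y' z
    proof (cases "z \<in> cball y (2 * \<epsilon>)")
      case True
      have "\<bar>\<phi> y z - \<phi> y' z\<bar> \<le> \<bar>dist y z / \<epsilon> - dist y' z / \<epsilon>\<bar>" by (simp add: \<phi>_def)
      also have "\<dots> = \<bar>dist y z - dist y' z\<bar> / \<epsilon>" using \<epsilon> by (simp flip: diff_divide_distrib)
      also have "\<dots> \<le> dist y y' / \<epsilon>" using \<epsilon> abs_dist_diff_le[of y z y']
        by (intro divide_right_mono) (auto simp: dist_commute)
      finally show ?thesis using True by simp
    next
      case False
      then have "\<epsilon> \<le> dist y z" "\<epsilon> \<le> dist y' z" using that dist_triangle[of y z y'] \<epsilon> by auto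
      then show ?thesis using \<epsilon> by (simp add: \<phi>_def)
    qed
    have \<Phi>: "measure \<mu> (ball y (\<epsilon> / 2)) / 2 \<le> \<Phi> y" for y
    proof -
      have "(\<integral>z. indicator (ball y (\<epsilon> / 2)) z / 2 \<partial>\<mu>) \<le> \<Phi> y"
        unfolding \<Phi>_def
      proof (rule integral_mono)
        show "integrable \<mu> (\<lambda>z. indicator (ball y (\<epsilon> / 2)) z / (2 :: real))"
          by (intro integrable_divide integrable_real_indicator) (auto simp: emeasure_ball)
        show "integrable \<mu> (\<phi> y)"
          using kernel_integral(1)[where g = "\<lambda>_. 1" and T = 1, OF m\<phi> _ \<phi>1] by simp
        show "indicator (ball y (\<epsilon> / 2)) z / 2 \<le> \<phi> y z" for z
          using \<epsilon> by (auto simp: \<phi>_def indicator_def field_simps)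
      qed
      then show ?thesis by simp
    qed
    have \<Phi>_pos: "0 < \<Phi> y" for y using \<Phi>[of y] measure_ball_pos[of "\<epsilon> / 2" y] \<epsilon> by simp
    have main: "\<bar>v y - u y\<bar> \<le> T \<and> (\<forall>y'. dist y y' \<le> \<epsilon> \<longrightarrow> \<bar>v y - v y'\<bar> \<le> 4 * C * T / \<epsilon> * dist y y')"
      if T: "\<forall>z\<in>cball y (2 * \<epsilon>). \<bar>u z - u y\<bar> \<le> T" for y T
    proof -
      have T0: "0 \<le> T" using T[rule_format, of y] \<epsilon> by simp
      define N where "N y' = (\<integral>z. \<phi> y' z * (u z - u y) \<partial>\<mu>)" for y'
      have iu: "integrable \<mu> (\<lambda>z. \<phi> y' z * u z)" for y'
      proof -
        obtain b where b: "\<And>z. z \<in> cball y' \<epsilon> \<Longrightarrow> \<bar>u z\<bar> \<le> b"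
          using bdd by (metis bounded_iff imageI real_norm_def)
        show ?thesis by (rule kernel_integral(1)[OF m\<phi> u \<phi>1 b]) auto
      qed
      have i1: "integrable \<mu> (\<phi> y')" for y'
        using kernel_integral(1)[where g = "\<lambda>_. 1" and T = 1, OF m\<phi> _ \<phi>1] by simp
      have iN: "integrable \<mu> (\<lambda>z. \<phi> y' z * (u z - u y))" for y'
        using Bochner_Integration.integrable_diff[OF iu[of y'] integrable_mult_left[OF i1[of y'], of "u y"]]
        by (simp add: algebra_simps)
      have N: "v y' - u y = N y' / \<Phi> y'" for y'
      proof -
        have "N y' = (\<integral>z. \<phi> y' z * u z \<partial>\<mu>) - \<Phi> y' * u y"
          unfolding N_def \<Phi>_def right_diff_distrib using iu i1 by simp
        then show ?thesis using \<Phi>_pos[of y'] by (simp add: v_def field_simps)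
      qed
      have Ny: "\<bar>N y\<bar> \<le> T * \<Phi> y"
      proof -
        have "\<bar>\<integral>z. \<phi> y z * (u z - u y) \<partial>\<mu>\<bar> \<le> (\<integral>z. \<phi> y z * T \<partial>\<mu>)"
        proof (rule abs_integral_le_integral[OF iN])
          show "integrable \<mu> (\<lambda>z. \<phi> y z * T)" using i1 by simp
          fix z show "\<bar>\<phi> y z * (u z - u y)\<bar> \<le> \<phi> y z * T"
          proof (cases "z \<in> cball y (2 * \<epsilon>)")
            case True then show ?thesis using T \<phi>0[of y z] by (auto simp: abs_mult intro: mult_left_mono)
          next
            case False then have "\<phi> y z = 0" using \<epsilon> by (auto simp: \<phi>_def field_simps)
            then show ?thesis by simp
          qed
        qed
        then show ?thesis by (simp add: N_def \<Phi>_def mult.commute)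
      qed
      have "\<bar>v y - v y'\<bar> \<le> 4 * C * T / \<epsilon> * dist y y'" if d: "dist y y' \<le> \<epsilon>" for y'
      proof -
        define m where "m = measure \<mu> (cball y (2 * \<epsilon>))"
        define D where "D = dist y y' / \<epsilon>"
        have D: "0 \<le> D" using \<epsilon> by (simp add: D_def)
        have "\<bar>\<integral>z. (\<phi> y z - \<phi> y' z) * (u z - u y) \<partial>\<mu>\<bar> \<le> D * T * m"
          unfolding D_def m_def by (rule kernel_integral(2)[OF _ _ \<phi>2[OF d]]) (use T \<epsilon> in auto)
        then have dN: "\<bar>N y - N y'\<bar> \<le> D * T * m"
          using iN by (simp add: N_def left_diff_distrib)
        have "\<bar>\<integral>z. (\<phi> y z - \<phi> y' z) * 1 \<partial>\<mu>\<bar> \<le> D * 1 * m"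
          unfolding D_def m_def by (rule kernel_integral(2)[OF _ _ \<phi>2[OF d]]) (use \<epsilon> in auto)
        then have d\<Phi>: "\<bar>\<Phi> y - \<Phi> y'\<bar> \<le> D * m"
          using i1 by (simp add: \<Phi>_def)
        have "m \<le> C * measure \<mu> (ball y' (\<epsilon> / 2))"
          unfolding m_def using \<epsilon> d by (intro comp) (auto simp: dist_commute)
        also have "\<dots> \<le> C * (2 * \<Phi> y')" using \<Phi>[of y'] C by (intro mult_left_mono) auto
        finally have m: "m \<le> 2 * C * \<Phi> y'" by simp
        have "v y - v y' = N y / \<Phi> y - N y' / \<Phi> y'" using N[of y] N[of y'] by simp
        also have "\<dots> = (N y / \<Phi> y * (\<Phi> y' - \<Phi> y) + (N y - N y')) / \<Phi> y'"
          using \<Phi>_pos[of y] \<Phi>_pos[of y'] by (simp add: field_simps)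
        finally have "\<bar>v y - v y'\<bar> = \<bar>N y / \<Phi> y * (\<Phi> y' - \<Phi> y) + (N y - N y')\<bar> / \<Phi> y'"
          using \<Phi>_pos[of y'] by simp
        also have "\<dots> \<le> (T * (D * m) + D * T * m) / \<Phi> y'"
        proof (intro divide_right_mono order_trans[OF abs_triangle_ineq] add_mono dN)
          have "\<bar>N y / \<Phi> y\<bar> \<le> T" using Ny \<Phi>_pos[of y] by (simp add: field_simps)
          then show "\<bar>N y / \<Phi> y * (\<Phi> y' - \<Phi> y)\<bar> \<le> T * (D * m)"
            unfolding abs_mult using d\<Phi> T0 by (intro mult_mono) (auto simp: abs_minus_commute)
        qed (use \<Phi>_pos[of y'] in simp)
        also have "\<dots> = 2 * T * D * (m / \<Phi> y')" by simp
        also have "\<dots> \<le> 2 * T * D * (2 * C)"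
          using m \<Phi>_pos[of y'] T0 D by (intro mult_left_mono) (auto simp: field_simps)
        finally show ?thesis by (simp add: D_def mult_ac)
      qed
      moreover have "\<bar>v y - u y\<bar> \<le> T" unfolding N using Ny \<Phi>_pos[of y] by (simp add: field_simps)
      ultimately show ?thesis by blast
    qed
    have "continuous_on UNIV v"
    proof (rule continuous_on_of_pointwise_Lipschitz)
      fix y
      obtain b where b: "\<And>z. z \<in> cball y (2 * \<epsilon>) \<Longrightarrow> \<bar>u z\<bar> \<le> b"
        using bdd by (metis bounded_iff imageI real_norm_def)
      have "\<forall>z\<in>cball y (2 * \<epsilon>). \<bar>u z - u y\<bar> \<le> b + \<bar>u y\<bar>" using b by force
      from main[OF this] have "\<forall>y'. dist y y' < \<epsilon> \<longrightarrow> \<bar>v y - v y'\<bar> \<le> 4 * C * (b + \<bar>u y\<bar>) / \<epsilon> * dist y y'"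
        by (simp add: less_imp_le)
      then show "\<exists>\<delta>>0. \<exists>L. \<forall>y'. dist y y' < \<delta> \<longrightarrow> \<bar>v y - v y'\<bar> \<le> L * dist y y'"
        using \<epsilon> by blast
    qed
    then show "\<exists>v. continuous_on UNIV v \<and> (\<forall>y T. (\<forall>z\<in>cball y (2 * \<epsilon>). \<bar>u z - u y\<bar> \<le> T) \<longrightarrow>
        \<bar>v y - u y\<bar> \<le> T \<and> (\<forall>y'. dist y y' \<le> \<epsilon> \<longrightarrow> \<bar>v y - v y'\<bar> \<le> 4 * C * T / \<epsilon> * dist y y'))"
      using main by blast
  qed
qed

end

locale regular_doubling_measure = doubling_measure +
  assumes outer_regular: "E \<in> sets borel \<Longrightarrow> emeasure \<mu> E = (INF U\<in>{U. open U \<and> E \<subseteq> U}. emeasure \<mu> U)"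
begin

text \<open>Outer regularity of \<open>\<mu>\<close> yields a decreasing sequence of open sets whose intersection differs
  from \<open>S\<close> by a \<open>\<mu>\<close>-null set. That set is also \<open>\<nu>\<close>-null, and continuity from above gives the
  approximation for \<open>\<nu>\<close>.\<close>

lemma outer_approximation:
  assumes \<nu>: "sets \<nu> = sets borel" "absolutely_continuous \<mu> \<nu>" "emeasure \<nu> (ball o' r) < \<infinity>"
    and S: "S \<in> sets borel" "S \<subseteq> ball o' r" and \<delta>: "0 < \<delta>"
  obtains U where "open U" "S \<subseteq> U" "U \<subseteq> ball o' r" "emeasure \<nu> (U - S) < \<delta>"
proof -
  note [measurable_cong] = \<nu>(1) and [measurable] = S(1)
  have Sfin: "emeasure \<mu> S < \<infinity>" using S by (intro emeasure_bounded_finite[of _ o' r]) auto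
  have "\<exists>V. open V \<and> S \<subseteq> V \<and> emeasure \<mu> V < emeasure \<mu> S + ennreal (1 / Suc n)" for n
  proof -
    have "emeasure \<mu> S < emeasure \<mu> S + ennreal (1 / Suc n)"
    proof -
      obtain s where s: "emeasure \<mu> S = ennreal s" "0 \<le> s" using Sfin by (cases "emeasure \<mu> S") auto
      have "ennreal s < ennreal (s + 1 / Suc n)" using s by (intro ennreal_lessI) (auto intro: add_nonneg_pos)
      then show ?thesis using s by simp
    qed
    then have "(INF U\<in>{U. open U \<and> S \<subseteq> U}. emeasure \<mu> U) < emeasure \<mu> S + ennreal (1 / Suc n)"
      using outer_regular[OF S(1)] by simp
    then show ?thesis unfolding INF_less_iff by blast
  qed
  then obtain V where V: "\<And>n. open (V n)" "\<And>n. S \<subseteq> V n"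
    "\<And>n. emeasure \<mu> (V n) < emeasure \<mu> S + ennreal (1 / Suc n)" by metis
  define U where "U n = ball o' r \<inter> (\<Inter>i\<le>n. V i)" for n
  have U: "open (U n)" "S \<subseteq> U n" "U n \<subseteq> ball o' r" for n
    using V S by (auto simp: U_def intro!: open_Int open_INT)
  note [measurable] = borel_open[OF U(1)]
  define G where "G = (\<Inter>n. U n)"
  have [measurable]: "G \<in> sets borel" unfolding G_def by measurable
  have "emeasure \<mu> G \<le> emeasure \<mu> S + ennreal (1 / Suc n)" for n
  proof -
    have "G \<subseteq> V n" by (auto simp: G_def U_def)
    then have "emeasure \<mu> G \<le> emeasure \<mu> (V n)" using V(1) by (intro emeasure_mono) auto
    then show ?thesis using V(3)[of n] by simp
  qed
  moreover have "(\<lambda>n. emeasure \<mu> S + ennreal (1 / Suc n)) \<longlonglongrightarrow> emeasure \<mu> S + ennreal 0"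
    using LIMSEQ_inverse_real_of_nat by (intro tendsto_add tendsto_const tendsto_ennrealI) (simp add: inverse_eq_divide)
  ultimately have "emeasure \<mu> G \<le> emeasure \<mu> S"
    by (intro LIMSEQ_le_const[of _ "emeasure \<mu> S"]) auto
  moreover have SG: "S \<subseteq> G" using U by (auto simp: G_def)
  ultimately have "emeasure \<mu> (G - S) = 0"
    using Sfin by (subst emeasure_Diff) (auto simp: diff_eq_0_iff_ennreal)
  then have "G - S \<in> null_sets \<mu>" by auto
  then have "G - S \<in> null_sets \<nu>" using \<nu>(2) by (auto simp: absolutely_continuous_def)
  then have null: "emeasure \<nu> (G - S) = 0" by auto
  have "(\<lambda>n. emeasure \<nu> (U n - S)) \<longlonglongrightarrow> emeasure \<nu> (\<Inter>n. U n - S)"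
  proof (rule Lim_emeasure_decseq)
    show "decseq (\<lambda>n. U n - S)" unfolding decseq_def U_def by (auto intro: order_trans)
    fix n
    have "emeasure \<nu> (U n - S) \<le> emeasure \<nu> (ball o' r)" using U(3)[of n] by (intro emeasure_mono) auto
    then show "emeasure \<nu> (U n - S) \<noteq> \<infinity>" using \<nu>(3) by (auto simp: top_unique)
  qed auto
  moreover have "(\<Inter>n. U n - S) = G - S" by (auto simp: G_def)
  ultimately have "(\<lambda>n. emeasure \<nu> (U n - S)) \<longlonglongrightarrow> 0" using null by simp
  from order_tendstoD(2)[OF this \<delta>] obtain n where "emeasure \<nu> (U n - S) < \<delta>"
    by (auto dest: eventually_happens)
  then show ?thesis by (rule that[OF U(1) U(2) U(3)])
qed

text \<open>At the points outside \<open>E\<close> where the conclusion fails for some \<open>t\<close>, small balls carry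
  \<open>\<nu>(E \<inter> B) > t \<mu>(B)\<close>. They may be chosen inside an open set \<open>U\<close> containing a bounded part of
  the complement of \<open>E\<close> with \<open>\<nu>(E \<inter> U)\<close> arbitrarily small, and the Vitali comparison bounds the
  measure of their centres by a multiple of \<open>\<nu>(E \<inter> U)/t\<close>.\<close>

lemma density_at_outside_points:
  assumes \<nu>: "sets \<nu> = sets borel" "absolutely_continuous \<mu> \<nu>" "\<And>x r. emeasure \<nu> (ball x r) < \<infinity>"
    and E: "E \<in> sets borel"
  shows "AE x in \<mu>. x \<notin> E \<longrightarrow> (\<forall>t>0. \<forall>\<^sub>F r in at_right 0. measure \<nu> (E \<inter> cball x r) \<le> t * measure \<mu> (cball x r))"
proof -
  note [measurable_cong] = \<nu>(1) and [measurable] = E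
  obtain C where C: "1 \<le> C" and comp: "\<And>x r. 0 < r \<Longrightarrow>
      measure \<mu> (cball x (5 * r)) \<le> C * measure \<mu> (ball x r)"
    using ball_comparison[of 5] by (metis dist_self less_eq_real_def mult_nonneg_nonneg zero_le_numeral order_refl)
  define o' :: 'a where "o' = undefined"
  define a where "a = density \<nu> (indicator E)"
  have a[measurable_cong]: "sets a = sets borel" by (simp add: a_def \<nu>)
  have ea: "emeasure a B = emeasure \<nu> (E \<inter> B)" if "B \<in> sets borel" for B
    unfolding a_def using that by (intro emeasure_restricted) auto
  have fin: "emeasure \<nu> (E \<inter> cball x r) = ennreal (measure \<nu> (E \<inter> cball x r))" for x r
  proof (rule emeasure_eq_ennreal_measure)
    have "emeasure \<nu> (E \<inter> cball x r) \<le> emeasure \<nu> (ball x (r + 1))" by (intro emeasure_mono) auto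
    then show "emeasure \<nu> (E \<inter> cball x r) \<noteq> top" using \<nu>(3)[of x "r + 1"] by (auto simp: top_unique)
  qed
  define bad where "bad N k = {x \<in> ball o' (real N). x \<notin> E \<and>
     (\<exists>\<^sub>F r in at_right 0. 1 / Suc k * measure \<mu> (cball x r) < measure \<nu> (E \<inter> cball x r))}" for N k
  have "AE x in \<mu>. x \<notin> bad N k" for N k
  proof -
    have "\<exists>S'\<in>sets borel. bad N k \<subseteq> S' \<and> emeasure \<mu> S' \<le> ennreal (C * Suc k) * ennreal (1 / Suc n)" for n
    proof -
      obtain U where U: "open U" "ball o' N - E \<subseteq> U" "U \<subseteq> ball o' N"
        "emeasure \<nu> (U - (ball o' N - E)) < ennreal (1 / Suc n)"
        by (rule outer_approximation[OF \<nu>(1,2,3), of "ball o' N - E" o' N "ennreal (1 / Suc n)"]) auto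
      have "emeasure a U \<le> emeasure \<nu> (U - (ball o' N - E))"
        using U(1) by (subst ea) (auto intro!: emeasure_mono)
      then have aU: "emeasure a U \<le> ennreal (1 / Suc n)" using U(4) by simp
      have "\<exists>r. 0 < r \<and> r \<le> 1 \<and> cball x r \<subseteq> U \<and> 1 / Suc k * measure \<mu> (cball x r) < measure \<nu> (E \<inter> cball x r)"
        if x: "x \<in> bad N k" for x
      proof -
        obtain e where e: "0 < e" "cball x e \<subseteq> U"
        proof -
          have "x \<in> U" using U(2) x by (auto simp: bad_def)
          then show ?thesis using U(1) that by (meson open_contains_cball)
        qed
        have "\<forall>\<^sub>F r in at_right (0::real). 0 < r \<and> r \<le> 1 \<and> r \<le> e"
          using e(1) by (intro eventually_at_rightI[of 0 "min 1 e"]) auto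
        moreover have "\<exists>\<^sub>F r in at_right 0. 1 / Suc k * measure \<mu> (cball x r) < measure \<nu> (E \<inter> cball x r)"
          using x by (simp add: bad_def)
        ultimately have "\<exists>\<^sub>F r in at_right 0. (0 < r \<and> r \<le> 1 \<and> r \<le> e) \<and>
            1 / Suc k * measure \<mu> (cball x r) < measure \<nu> (E \<inter> cball x r)"
          using frequently_eventually_conj by fast
        then obtain r where "0 < r \<and> r \<le> 1 \<and> r \<le> e" "1 / Suc k * measure \<mu> (cball x r) < measure \<nu> (E \<inter> cball x r)"
          by (auto dest: frequently_ex)
        then show ?thesis using e by (intro exI[of _ r]) (auto simp: subset_iff)
      qed
      then obtain \<rho> where \<rho>: "\<And>x. x \<in> bad N k \<Longrightarrow> 0 < \<rho> x" "\<And>x. x \<in> bad N k \<Longrightarrow> \<rho> x \<le> 1"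
        "\<And>x. x \<in> bad N k \<Longrightarrow> cball x (\<rho> x) \<subseteq> U"
        "\<And>x. x \<in> bad N k \<Longrightarrow> 1 / Suc k * measure \<mu> (cball x (\<rho> x)) < measure \<nu> (E \<inter> cball x (\<rho> x))"
        by metis
      have "\<exists>S'\<in>sets borel. bad N k \<subseteq> S' \<and> emeasure \<mu> S' \<le> ennreal (C * Suc k) * emeasure a U"
      proof (rule Vitali_measure_comparison[OF sets_eq_borel a borel_open[OF U(1)] \<rho>(1,2) _ \<rho>(3)])
        fix x assume x: "x \<in> bad N k"
        have "measure \<mu> (cball x (5 * \<rho> x)) \<le> C * measure \<mu> (ball x (\<rho> x))" using \<rho>(1)[OF x] by (rule comp)
        also have "\<dots> \<le> C * measure \<mu> (cball x (\<rho> x))" using C measure_ball_le_cball by (intro mult_left_mono) auto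
        also have "\<dots> \<le> C * (Suc k * measure \<nu> (E \<inter> cball x (\<rho> x)))"
          using \<rho>(4)[OF x] C by (intro mult_left_mono) (auto simp: field_simps)
        finally show "emeasure \<mu> (cball x (5 * \<rho> x)) \<le> ennreal (C * Suc k) * emeasure a (cball x (\<rho> x))"
          using C by (simp add: ea emeasure_cball fin ennreal_leI mult_ac flip: ennreal_mult)
      qed
      then show ?thesis using aU by (meson mult_left_mono order_trans zero_le)
    qed
    then obtain S where S: "\<And>n. S n \<in> sets borel" "\<And>n. bad N k \<subseteq> S n"
      "\<And>n. emeasure \<mu> (S n) \<le> ennreal (C * Suc k) * ennreal (1 / Suc n)" by metis
    have le: "emeasure \<mu> (\<Inter>n. S n) \<le> ennreal (C * Suc k) * ennreal (1 / Suc n)" for n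
    proof -
      have "emeasure \<mu> (\<Inter>n. S n) \<le> emeasure \<mu> (S n)" using S(1) by (intro emeasure_mono) auto
      then show ?thesis using S(3)[of n] by (rule order_trans)
    qed
    have "(\<lambda>n. ennreal (C * Suc k * (1 / Suc n))) \<longlonglongrightarrow> ennreal (C * Suc k * 0)"
      using LIMSEQ_inverse_real_of_nat by (intro tendsto_ennrealI tendsto_mult tendsto_const) (simp add: inverse_eq_divide)
    then have "emeasure \<mu> (\<Inter>n. S n) \<le> ennreal (C * Suc k * 0)"
    proof (rule LIMSEQ_le_const, intro exI[of _ 0] allI impI)
      fix n
      have "ennreal (C * Suc k) * ennreal (1 / Suc n) = ennreal (C * Suc k * (1 / Suc n))"
        using C by (intro ennreal_mult[symmetric]) auto
      then show "emeasure \<mu> (\<Inter>n. S n) \<le> ennreal (C * Suc k * (1 / Suc n))"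
        using le[of n] by simp
    qed
    then have "(\<Inter>n. S n) \<in> null_sets \<mu>" using S(1) by auto
    then show ?thesis using S(2) by (auto intro!: AE_I'[of "\<Inter>n. S n"])
  qed
  then have "AE x in \<mu>. \<forall>N k. x \<notin> bad N k" by (simp add: AE_all_countable)
  then show ?thesis
  proof eventually_elim
    case (elim x)
    show ?case
    proof (intro impI allI)
      fix t :: real assume x: "x \<notin> E" and t: "0 < t"
      obtain N :: nat where "dist o' x < N" using reals_Archimedean2 by blast
      obtain k where k: "1 / real (Suc k) < t" using nat_approx_posE[OF t] by metis
      have "\<not> (\<exists>\<^sub>F r in at_right 0. 1 / Suc k * measure \<mu> (cball x r) < measure \<nu> (E \<inter> cball x r))"
        using elim[rule_format, of N k] x \<open>dist o' x < N\<close> by (auto simp: bad_def)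
      then have "\<forall>\<^sub>F r in at_right 0. measure \<nu> (E \<inter> cball x r) \<le> 1 / Suc k * measure \<mu> (cball x r)"
        by (simp add: not_frequently not_less)
      then show "\<forall>\<^sub>F r in at_right 0. measure \<nu> (E \<inter> cball x r) \<le> t * measure \<mu> (cball x r)"
      proof eventually_elim
        case (elim r)
        have "1 / Suc k * measure \<mu> (cball x r) \<le> t * measure \<mu> (cball x r)"
          using k by (intro mult_right_mono) auto
        then show ?case using elim by simp
      qed
    qed
  qed
qed

end

section \<open>Differentiation and ball ratios\<close>

context regular_doubling_measure begin

text \<open>Let \<open>b\<close> be rational. Almost every \<open>x\<close> with \<open>h x \<le> b\<close> is a point where the part of \<open>\<nu>\<close> on
  \<open>{b < h}\<close> has density 0 with respect to \<open>\<mu>\<close>, so the ratios are eventually at most \<open>b + t\<close>. At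
  almost every \<open>x\<close> with \<open>h x \<ge> b\<close> the set \<open>{h < b}\<close> has \<open>\<mu>\<close>-density 0, so the ratios are
  eventually at least \<open>b * (1 - t)\<close>.\<close>

lemma Lebesgue_differentiation:
  fixes h :: "'a \<Rightarrow> real"
  assumes h[measurable]: "h \<in> borel_measurable borel" and h0: "\<And>x. 0 \<le> h x"
    and \<nu>: "\<nu> = density \<mu> (\<lambda>x. ennreal (h x))" and fin: "\<And>x r. emeasure \<nu> (ball x r) < \<infinity>"
  shows "AE x in \<mu>. ((\<lambda>r. measure \<nu> (cball x r) / measure \<mu> (cball x r)) \<longlongrightarrow> h x) (at_right 0)"
proof -
  have s\<nu>[measurable_cong]: "sets \<nu> = sets borel" by (simp add: \<nu>)
  have ac: "absolutely_continuous \<mu> \<nu>" unfolding \<nu> by (intro absolutely_continuousI_density) measurable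
  have em: "emeasure \<nu> S = ennreal (measure \<nu> S)" if "S \<subseteq> cball x r" for S x r
  proof (rule emeasure_eq_ennreal_measure)
    have "S \<subseteq> ball x (r + 1)" using that by force
    then have "emeasure \<nu> S \<le> emeasure \<nu> (ball x (r + 1))" by (intro emeasure_mono) auto
    then show "emeasure \<nu> S \<noteq> top" using fin[of x "r + 1"] by (auto simp: top_unique)
  qed
  have upper: "measure \<nu> (cball x r - {x. b < h x}) \<le> b * measure \<mu> (cball x r)" if "0 \<le> b" for b x r
  proof -
    have "emeasure \<nu> (cball x r - {x. b < h x}) = (\<integral>\<^sup>+y. ennreal (h y) * indicator (cball x r - {x. b < h x}) y \<partial>\<mu>)"
      unfolding \<nu> by (intro emeasure_density) measurable
    also have "\<dots> \<le> (\<integral>\<^sup>+y. ennreal b * indicator (cball x r) y \<partial>\<mu>)"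
      by (intro nn_integral_mono) (auto simp: indicator_def intro!: ennreal_leI)
    also have "\<dots> = ennreal (b * measure \<mu> (cball x r))"
      using that by (subst nn_integral_cmult_indicator) (auto simp: emeasure_cball ennreal_mult')
    finally show ?thesis
      using that by (subst (asm) em[of _ x r]) (auto simp: ennreal_le_iff)
  qed
  have lower: "b * measure \<mu> (cball x r - {x. h x < b}) \<le> measure \<nu> (cball x r)" if "0 \<le> b" for b x r
  proof -
    have "ennreal (b * measure \<mu> (cball x r - {x. h x < b})) = ennreal b * emeasure \<mu> (cball x r - {x. h x < b})"
      using that by (subst emeasure_eq_measure_bounded[of _ x r]) (auto simp: ennreal_mult')
    also have "\<dots> = (\<integral>\<^sup>+y. ennreal b * indicator (cball x r - {x. h x < b}) y \<partial>\<mu>)"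
      by (subst nn_integral_cmult_indicator) measurable
    also have "\<dots> \<le> (\<integral>\<^sup>+y. ennreal (h y) * indicator (cball x r) y \<partial>\<mu>)"
      by (intro nn_integral_mono) (auto simp: indicator_def intro!: ennreal_leI)
    also have "\<dots> = emeasure \<nu> (cball x r)" unfolding \<nu> by (intro emeasure_density[symmetric]) measurable
    finally show ?thesis by (subst (asm) em[of _ x r]) (auto simp: ennreal_le_iff)
  qed
  have split\<nu>: "measure \<nu> (cball x r) = measure \<nu> ({x. b < h x} \<inter> cball x r) + measure \<nu> (cball x r - {x. b < h x})" for b x r
  proof -
    have "measure \<nu> (({x. b < h x} \<inter> cball x r) \<union> (cball x r - {x. b < h x})) =
        measure \<nu> ({x. b < h x} \<inter> cball x r) + measure \<nu> (cball x r - {x. b < h x})"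
      using em[of "{x. b < h x} \<inter> cball x r" x r] em[of "cball x r - {x. b < h x}" x r]
      by (intro measure_Union) auto
    moreover have "({x. b < h x} \<inter> cball x r) \<union> (cball x r - {x. b < h x}) = cball x r" by auto
    ultimately show ?thesis by simp
  qed
  have split\<mu>: "measure \<mu> (cball x r) = measure \<mu> ({x. h x < b} \<inter> cball x r) + measure \<mu> (cball x r - {x. h x < b})" for b x r
  proof -
    have "measure \<mu> (({x. h x < b} \<inter> cball x r) \<union> (cball x r - {x. h x < b})) =
        measure \<mu> ({x. h x < b} \<inter> cball x r) + measure \<mu> (cball x r - {x. h x < b})"
      using emeasure_eq_measure_bounded[of "{x. h x < b} \<inter> cball x r" x r]
        emeasure_eq_measure_bounded[of "cball x r - {x. h x < b}" x r]
      by (intro measure_Union) auto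
    moreover have "({x. h x < b} \<inter> cball x r) \<union> (cball x r - {x. h x < b}) = cball x r" by auto
    ultimately show ?thesis by simp
  qed
  have 1: "AE x in \<mu>. \<forall>b\<in>\<rat>. x \<notin> {x. b < h x} \<longrightarrow> (\<forall>t>0. \<forall>\<^sub>F r in at_right 0.
      measure \<nu> ({x. b < h x} \<inter> cball x r) \<le> t * measure \<mu> (cball x r))"
    by (subst AE_ball_countable[OF countable_rat], intro ballI, rule density_at_outside_points[OF s\<nu> ac fin]) measurable
  have fin\<mu>: "emeasure \<mu> (ball x r) < \<infinity>" for x r by (simp add: emeasure_ball)
  have ac\<mu>: "absolutely_continuous \<mu> \<mu>" by (simp add: absolutely_continuous_def)
  have 2: "AE x in \<mu>. \<forall>b\<in>\<rat>. x \<notin> {x. h x < b} \<longrightarrow> (\<forall>t>0. \<forall>\<^sub>F r in at_right 0.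
      measure \<mu> ({x. h x < b} \<inter> cball x r) \<le> t * measure \<mu> (cball x r))"
    by (subst AE_ball_countable[OF countable_rat], intro ballI, rule density_at_outside_points[OF sets_eq_borel ac\<mu> fin\<mu>]) measurable
  have pos: "\<forall>\<^sub>F r in at_right (0::real). 0 < r" by (rule eventually_at_right_less)
  from 1 2 show ?thesis
  proof eventually_elim
    case (elim x)
    show ?case
    proof (rule order_tendstoI)
      fix a assume a: "a < h x"
      show "\<forall>\<^sub>F r in at_right 0. a < measure \<nu> (cball x r) / measure \<mu> (cball x r)"
      proof (cases "a < 0")
        case True
        show ?thesis
          by (rule always_eventually) (use True in \<open>auto intro: less_le_trans divide_nonneg_nonneg\<close>)
      next
        case False
        obtain b where b: "b \<in> \<rat>" "a < b" "b < h x" using Rats_dense_in_real[OF a] by blast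
        define t where "t = (b - a) / (2 * b)"
        have t: "0 < t" "a < b * (1 - t)" using b False by (auto simp: t_def field_simps)
        have "\<forall>\<^sub>F r in at_right 0. measure \<mu> ({x. h x < b} \<inter> cball x r) \<le> t * measure \<mu> (cball x r)"
          using elim(2) b t by auto
        with pos show ?thesis
        proof eventually_elim
          case (elim r)
          have "b * (1 - t) * measure \<mu> (cball x r) \<le> b * measure \<mu> (cball x r - {x. h x < b})"
          proof -
            have "(1 - t) * measure \<mu> (cball x r) \<le> measure \<mu> (cball x r - {x. h x < b})"
              using elim(2) split\<mu>[of x r b] by (simp add: left_diff_distrib)
            then have "b * ((1 - t) * measure \<mu> (cball x r)) \<le> b * measure \<mu> (cball x r - {x. h x < b})"
              using b False by (intro mult_left_mono) auto
            then show ?thesis by (simp only: mult.assoc)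
          qed
          also have "\<dots> \<le> measure \<nu> (cball x r)" using b False by (intro lower) auto
          finally have "b * (1 - t) \<le> measure \<nu> (cball x r) / measure \<mu> (cball x r)"
            using measure_cball_pos[OF elim(1), of x] by (simp add: field_simps)
          then show ?case using t by simp
        qed
      qed
    next
      fix a assume a: "h x < a"
      obtain b where b: "b \<in> \<rat>" "h x < b" "b < a" using Rats_dense_in_real[OF a] by blast
      define t where "t = (a - b) / 2"
      have t: "0 < t" "b + t < a" using b by (auto simp: t_def field_simps)
      have b0: "0 \<le> b" using h0[of x] b by simp
      have "\<forall>\<^sub>F r in at_right 0. measure \<nu> ({x. b < h x} \<inter> cball x r) \<le> t * measure \<mu> (cball x r)"
        using elim(1) b t by auto
      with pos show "\<forall>\<^sub>F r in at_right 0. measure \<nu> (cball x r) / measure \<mu> (cball x r) < a"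
      proof eventually_elim
        case (elim r)
        have "measure \<nu> (cball x r) \<le> (b + t) * measure \<mu> (cball x r)"
          using elim split\<nu>[of x r b] upper[OF b0, of x r] by (simp add: algebra_simps)
        then have "measure \<nu> (cball x r) / measure \<mu> (cball x r) \<le> b + t"
          using measure_cball_pos[OF elim(1), of x] by (simp add: field_simps)
        then show ?case using t by simp
      qed
    qed
  qed
qed

end

context doubling_measure begin

lemma measurable_measure_cball [measurable]: "(\<lambda>x. measure \<mu> (cball x e)) \<in> borel_measurable borel"
proof -
  have "{w. dist (fst w) (snd w) \<le> e} \<in> sets (borel \<Otimes>\<^sub>M (borel :: 'a measure))"
    using measurable_sets[OF dist_measurable_pair, of "{..e}"] by (simp add: space_pair_measure vimage_def)
  also have "sets (borel \<Otimes>\<^sub>M (borel :: 'a measure)) = sets (borel \<Otimes>\<^sub>M \<mu>)"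
    by (intro sets_pair_measure_cong) auto
  finally have "(\<lambda>x. emeasure \<mu> (Pair x -` {w. dist (fst w) (snd w) \<le> e})) \<in> borel_measurable borel"
    by (rule measurable_emeasure_Pair)
  moreover have "Pair x -` {w. dist (fst w) (snd w) \<le> e} = cball x e" for x :: 'a by auto
  ultimately have "(\<lambda>x. emeasure \<mu> (cball x e)) \<in> borel_measurable borel" by (simp only:)
  then have "(\<lambda>x. enn2real (emeasure \<mu> (cball x e))) \<in> borel_measurable borel"
    by (rule measurable_compose) measurable
  then show ?thesis by (simp add: measure_def)
qed

end

locale doubling_pair = \<mu>: doubling_measure \<mu> A + \<nu>: doubling_measure \<nu> A'
  for \<mu> \<nu> :: "'a::metric_space measure" and A A' :: real
begin

definition ratio :: "real \<Rightarrow> 'a \<Rightarrow> real" where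
  "ratio e x = measure \<nu> (cball x e) / measure \<mu> (cball x e)"

lemma ratio_measurable [measurable]: "ratio e \<in> borel_measurable borel"
  unfolding ratio_def by measurable

lemma ratio_nonneg: "0 \<le> ratio e x" by (simp add: ratio_def)

text \<open>Both sides integrate the weight \<open>1 / \<mu>(B(x,e))\<close> over the pairs with \<open>d(x,y) \<le> e\<close>. By doubling,
  the inner integral on the right is comparable with 1 when \<open>B(y,e)\<close> lies in \<open>U\<close>, and it
  vanishes when the ball is disjoint from \<open>U\<close>.\<close>

lemma nn_integral_ratio_Fubini:
  assumes e: "0 < e" and [measurable]: "U \<in> sets borel"
  shows "(\<integral>\<^sup>+x. ennreal (ratio e x) * indicator U x \<partial>\<mu>) =
    (\<integral>\<^sup>+y. (\<integral>\<^sup>+x. ennreal (1 / measure \<mu> (cball x e)) * indicator U x * indicator (cball y e) x \<partial>\<mu>) \<partial>\<nu>)"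
proof -
  interpret pair_sigma_finite \<mu> \<nu> ..
  have "(\<integral>\<^sup>+x. ennreal (ratio e x) * indicator U x \<partial>\<mu>) =
      (\<integral>\<^sup>+x. (\<integral>\<^sup>+y. ennreal (1 / measure \<mu> (cball x e)) * indicator U x * indicator (cball x e) y \<partial>\<nu>) \<partial>\<mu>)"
  proof (intro nn_integral_cong)
    fix x
    have "ennreal (ratio e x) = ennreal (1 / measure \<mu> (cball x e)) * emeasure \<nu> (cball x e)"
      by (simp add: ratio_def \<nu>.emeasure_cball flip: ennreal_mult)
    then show "ennreal (ratio e x) * indicator U x =
        (\<integral>\<^sup>+y. ennreal (1 / measure \<mu> (cball x e)) * indicator U x * indicator (cball x e) y \<partial>\<nu>)"
      by (subst nn_integral_cmult_indicator) (auto simp: mult_ac)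
  qed
  also have "\<dots> = (\<integral>\<^sup>+x. (\<integral>\<^sup>+y. ennreal (1 / measure \<mu> (cball x e)) * indicator U x * indicator {..e} (dist x y) \<partial>\<nu>) \<partial>\<mu>)"
    by (intro nn_integral_cong) (auto simp: indicator_def)
  also have "\<dots> = (\<integral>\<^sup>+y. (\<integral>\<^sup>+x. ennreal (1 / measure \<mu> (cball x e)) * indicator U x * indicator {..e} (dist x y) \<partial>\<mu>) \<partial>\<nu>)"
  proof (rule Fubini'[symmetric])
    have [measurable]: "(\<lambda>w. dist (fst w) (snd w)) \<in> borel_measurable (\<mu> \<Otimes>\<^sub>M \<nu>)"
      using \<mu>.measurable_dist[of fst "\<mu> \<Otimes>\<^sub>M \<nu>" snd] by measurable
    show "(\<lambda>(x, y). ennreal (1 / measure \<mu> (cball x e)) * indicator U x * indicator {..e} (dist x y)) \<in> borel_measurable (\<mu> \<Otimes>\<^sub>M \<nu>)"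
      unfolding split_beta by measurable
  qed
  also have "\<dots> = (\<integral>\<^sup>+y. (\<integral>\<^sup>+x. ennreal (1 / measure \<mu> (cball x e)) * indicator U x * indicator (cball y e) x \<partial>\<mu>) \<partial>\<nu>)"
    by (intro nn_integral_cong) (auto simp: indicator_def dist_commute)
  finally show ?thesis .
qed

lemma nn_integral_ratio_le:
  "\<exists>C\<ge>1. \<forall>x r e. 0 < e \<longrightarrow>
     (\<integral>\<^sup>+y. ennreal (ratio e y) * indicator (cball x r) y \<partial>\<mu>) \<le> ennreal (C * measure \<nu> (cball x (r + e)))"
proof -
  obtain C where C: "1 \<le> C" and comp: "\<And>x y r r'. 0 < r \<Longrightarrow> r' \<le> 1 * r \<Longrightarrow> dist x y \<le> 1 * r \<Longrightarrow>
      measure \<mu> (cball y r') \<le> C * measure \<mu> (ball x r)"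
    using \<mu>.ball_comparison[of 1] by blast
  show ?thesis
  proof (intro exI[of _ C] conjI allI impI C)
    fix x :: 'a and r e :: real assume e: "0 < e"
    have "(\<integral>\<^sup>+z. ennreal (1 / measure \<mu> (cball z e)) * indicator (cball x r) z * indicator (cball y e) z \<partial>\<mu>)
        \<le> ennreal C * indicator (cball x (r + e)) y" for y
    proof (cases "y \<in> cball x (r + e)")
      case True
      have my: "0 < measure \<mu> (cball y e)" by (rule \<mu>.measure_cball_pos[OF e])
      have "(\<integral>\<^sup>+z. ennreal (1 / measure \<mu> (cball z e)) * indicator (cball x r) z * indicator (cball y e) z \<partial>\<mu>)
          \<le> (\<integral>\<^sup>+z. ennreal (C / measure \<mu> (cball y e)) * indicator (cball y e) z \<partial>\<mu>)"
      proof (intro nn_integral_mono)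
        fix z
        show "ennreal (1 / measure \<mu> (cball z e)) * indicator (cball x r) z * indicator (cball y e) z
            \<le> ennreal (C / measure \<mu> (cball y e)) * indicator (cball y e) z"
        proof (cases "z \<in> cball y e")
          case True
          have mz: "0 < measure \<mu> (cball z e)" by (rule \<mu>.measure_cball_pos[OF e])
          have "measure \<mu> (cball y e) \<le> C * measure \<mu> (ball z e)"
            using True e by (intro comp) (auto simp: dist_commute)
          also have "\<dots> \<le> C * measure \<mu> (cball z e)"
            using C \<mu>.measure_ball_le_cball by (intro mult_left_mono) auto
          finally have "1 / measure \<mu> (cball z e) \<le> C / measure \<mu> (cball y e)"
            using my mz by (simp add: field_simps)
          then show ?thesis using True by (auto simp: indicator_def intro!: ennreal_leI)
        qed simp
      qed
      also have "\<dots> = ennreal (C / measure \<mu> (cball y e)) * ennreal (measure \<mu> (cball y e))"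
        by (subst nn_integral_cmult_indicator) (auto simp: \<mu>.emeasure_cball)
      also have "\<dots> = ennreal C" using my C by (simp flip: ennreal_mult)
      finally show ?thesis using True by simp
    next
      case False
      have "z \<notin> cball x r \<or> z \<notin> cball y e" for z
        using False dist_triangle[of x y z] by (auto simp: dist_commute)
      then have "ennreal (1 / measure \<mu> (cball z e)) * indicator (cball x r) z * indicator (cball y e) z = 0" for z
        by (auto simp: indicator_def)
      then have "(\<integral>\<^sup>+z. ennreal (1 / measure \<mu> (cball z e)) * indicator (cball x r) z * indicator (cball y e) z \<partial>\<mu>)
          = (\<integral>\<^sup>+z. 0 \<partial>\<mu>)"
        by (intro nn_integral_cong)
      then show ?thesis unfolding nn_integral_const by simp
    qed
    then have "(\<integral>\<^sup>+y. (\<integral>\<^sup>+z. ennreal (1 / measure \<mu> (cball z e)) * indicator (cball x r) z * indicator (cball y e) z \<partial>\<mu>) \<partial>\<nu>)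
        \<le> (\<integral>\<^sup>+y. ennreal C * indicator (cball x (r + e)) y \<partial>\<nu>)"
      by (intro nn_integral_mono)
    also have "\<dots> = ennreal (C * measure \<nu> (cball x (r + e)))"
      using C by (subst nn_integral_cmult_indicator) (auto simp: \<nu>.emeasure_cball ennreal_mult')
    finally show "(\<integral>\<^sup>+y. ennreal (ratio e y) * indicator (cball x r) y \<partial>\<mu>) \<le> ennreal (C * measure \<nu> (cball x (r + e)))"
      by (subst nn_integral_ratio_Fubini[OF e]) auto
  qed
qed

lemma measure_le_nn_integral_ratio:
  "\<exists>C\<ge>1. \<forall>S U e. 0 < e \<longrightarrow> S \<in> sets borel \<longrightarrow> U \<in> sets borel \<longrightarrow> (\<forall>y\<in>S. cball y e \<subseteq> U) \<longrightarrow>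
     emeasure \<nu> S \<le> ennreal C * (\<integral>\<^sup>+y. ennreal (ratio e y) * indicator U y \<partial>\<mu>)"
proof -
  obtain C where C: "1 \<le> C" and comp: "\<And>x y r r'. 0 < r \<Longrightarrow> r' \<le> 1 * r \<Longrightarrow> dist x y \<le> 1 * r \<Longrightarrow>
      measure \<mu> (cball y r') \<le> C * measure \<mu> (ball x r)"
    using \<mu>.ball_comparison[of 1] by blast
  show ?thesis
  proof (intro exI[of _ C] conjI allI impI C)
    fix S U :: "'a set" and e :: real
    assume e: "0 < e" and S[measurable]: "S \<in> sets borel" and U[measurable]: "U \<in> sets borel" and sub: "\<forall>y\<in>S. cball y e \<subseteq> U"
    have "indicator S y \<le> ennreal C * (\<integral>\<^sup>+z. ennreal (1 / measure \<mu> (cball z e)) * indicator U z * indicator (cball y e) z \<partial>\<mu>)" for y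
    proof (cases "y \<in> S")
      case True
      have my: "0 < measure \<mu> (cball y e)" by (rule \<mu>.measure_cball_pos[OF e])
      have "1 = ennreal C * (ennreal (1 / (C * measure \<mu> (cball y e))) * ennreal (measure \<mu> (cball y e)))"
        using C my by (simp flip: ennreal_mult)
      also have "\<dots> = ennreal C * (\<integral>\<^sup>+z. ennreal (1 / (C * measure \<mu> (cball y e))) * indicator (cball y e) z \<partial>\<mu>)"
        by (subst nn_integral_cmult_indicator) (auto simp: \<mu>.emeasure_cball)
      also have "\<dots> \<le> ennreal C * (\<integral>\<^sup>+z. ennreal (1 / measure \<mu> (cball z e)) * indicator U z * indicator (cball y e) z \<partial>\<mu>)"
      proof (intro mult_left_mono nn_integral_mono)
        fix z
        show "ennreal (1 / (C * measure \<mu> (cball y e))) * indicator (cball y e) z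
            \<le> ennreal (1 / measure \<mu> (cball z e)) * indicator U z * indicator (cball y e) z"
        proof (cases "z \<in> cball y e")
          case zy: True
          have mz: "0 < measure \<mu> (cball z e)" by (rule \<mu>.measure_cball_pos[OF e])
          have "measure \<mu> (cball z e) \<le> C * measure \<mu> (ball y e)"
            using zy e by (intro comp) auto
          also have "\<dots> \<le> C * measure \<mu> (cball y e)"
            using C \<mu>.measure_ball_le_cball by (intro mult_left_mono) auto
          finally have "1 / (C * measure \<mu> (cball y e)) \<le> 1 / measure \<mu> (cball z e)"
            using my mz by (intro divide_left_mono) auto
          moreover have "z \<in> U" using sub True zy by blast
          ultimately show ?thesis using zy by (auto simp: indicator_def intro!: ennreal_leI)
        qed simp
      qed simp
      finally show ?thesis using True by simp
    qed simp
    then have "(\<integral>\<^sup>+y. indicator S y \<partial>\<nu>) \<le> (\<integral>\<^sup>+y. ennreal C *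
        (\<integral>\<^sup>+z. ennreal (1 / measure \<mu> (cball z e)) * indicator U z * indicator (cball y e) z \<partial>\<mu>) \<partial>\<nu>)"
      by (intro nn_integral_mono)
    also have "\<dots> = ennreal C * (\<integral>\<^sup>+y. ennreal (ratio e y) * indicator U y \<partial>\<mu>)"
      unfolding nn_integral_ratio_Fubini[OF e U]
    proof (rule nn_integral_cmult)
      have [measurable]: "(\<lambda>w. dist (fst w) (snd w)) \<in> borel_measurable (\<nu> \<Otimes>\<^sub>M \<mu>)"
        using \<mu>.measurable_dist[of fst "\<nu> \<Otimes>\<^sub>M \<mu>" snd] by measurable
      have "(\<lambda>y. \<integral>\<^sup>+z. (\<lambda>(y, z). ennreal (1 / measure \<mu> (cball z e)) * indicator U z * indicator {..e} (dist y z)) (y, z) \<partial>\<mu>) \<in> borel_measurable \<nu>"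
        by (intro \<mu>.borel_measurable_nn_integral_fst) (simp add: split_beta, measurable)
      moreover have "indicator {..e} (dist y z) = (indicator (cball y e) z :: ennreal)" for y z :: 'a
        by (auto simp: indicator_def)
      ultimately show "(\<lambda>y. \<integral>\<^sup>+z. ennreal (1 / measure \<mu> (cball z e)) * indicator U z * indicator (cball y e) z \<partial>\<mu>) \<in> borel_measurable \<nu>"
        by simp
    qed
    finally show "emeasure \<nu> S \<le> ennreal C * (\<integral>\<^sup>+y. ennreal (ratio e y) * indicator U y \<partial>\<mu>)"
      by simp
  qed
qed

end

section \<open>From a reverse Hoelder inequality to an L log L estimate\<close>

text \<open>Counting the powers of 2 below \<open>W\<close> replaces the layer-cake integral for \<open>ln (max 1 W)\<close>.\<close>

lemma ln_max_le_count_powers: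
  "ennreal (ln (max 1 W)) \<le> (\<Sum>k. if 2 ^ k < W then 1 else 0)" for W :: real
proof (cases "W \<le> 1")
  case False
  define n where "n = (LEAST n. W \<le> 2 ^ n)"
  have ex: "\<exists>n::nat. W \<le> 2 ^ n" using real_arch_pow[of 2 W] by (auto intro: less_imp_le)
  have n: "W \<le> 2 ^ n" unfolding n_def using ex by (rule LeastI_ex)
  have less: "2 ^ k < W" if "k < n" for k using not_less_Least[of k "\<lambda>n. W \<le> 2 ^ n"] that by (simp add: n_def not_le)
  have "ln W \<le> ln (2 ^ n)" using n False by (subst ln_le_cancel_iff) auto
  also have "\<dots> = n * ln 2" by (simp add: ln_realpow)
  also have "\<dots> \<le> real n * 1" using ln_2_less_1 by (intro mult_left_mono) auto
  finally have "ennreal (ln (max 1 W)) \<le> ennreal n" using False by (intro ennreal_leI) auto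
  also have "\<dots> = (\<Sum>k<n. if 2 ^ k < W then 1 else 0)"
    using less by (simp add: ennreal_of_nat_eq_real_of_nat)
  also have "\<dots> \<le> (\<Sum>k. if 2 ^ k < W then 1 else 0)" by (intro sum_le_suminf) auto
  finally show ?thesis .
qed simp

lemma geometric_sum_below:
  fixes \<sigma> l W :: real
  assumes \<sigma>: "0 < \<sigma>" and l: "0 < l" and W: "0 \<le> W"
  shows "(\<Sum>k. if 2 ^ k * l < W then ennreal ((2 ^ k * l) powr \<sigma>) else 0)
    \<le> ennreal (2 powr \<sigma> / (2 powr \<sigma> - 1) * W powr \<sigma>)"
proof -
  define \<theta> where "\<theta> = 2 powr \<sigma>"
  have \<theta>: "1 < \<theta>" using \<sigma> by (simp add: \<theta>_def)
  define a where "a k = (2 ^ k * l) powr \<sigma>" for k :: nat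
  have aS: "a (Suc k) = \<theta> * a k" for k using l by (simp add: a_def \<theta>_def powr_mult mult_ac)
  have a0: "0 \<le> a k" for k by (simp add: a_def)
  define S where "S n = (\<Sum>k<n. if 2 ^ k * l < W then a k else 0)" for n :: nat
  have "S n \<le> a n / (\<theta> - 1) \<and> S n \<le> \<theta> / (\<theta> - 1) * W powr \<sigma>" for n
  proof (induction n)
    case 0
    show ?case using \<theta> a0[of 0] W by (simp add: S_def)
  next
    case (Suc n)
    show ?case
    proof (cases "2 ^ n * l < W")
      case True
      have "S (Suc n) = S n + a n" using True by (simp add: S_def)
      also have "\<dots> \<le> a n / (\<theta> - 1) + a n" using Suc by simp
      also have "\<dots> = \<theta> * a n / (\<theta> - 1)" using \<theta> by (simp add: field_simps)
      finally have 1: "S (Suc n) \<le> \<theta> * a n / (\<theta> - 1)" .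
      have "a n \<le> W powr \<sigma>" unfolding a_def using True l \<sigma> by (intro powr_mono2) auto
      then have "\<theta> / (\<theta> - 1) * a n \<le> \<theta> / (\<theta> - 1) * W powr \<sigma>" using \<theta> by (intro mult_left_mono) auto
      then show ?thesis using 1 by (simp add: aS)
    next
      case False
      have "a n \<le> a (Suc n)" unfolding aS using \<theta> a0[of n] by (simp add: mult_le_cancel_right1)
      then have "a n / (\<theta> - 1) \<le> a (Suc n) / (\<theta> - 1)" using \<theta> by (intro divide_right_mono) auto
      then show ?thesis using Suc False by (auto simp: S_def)
    qed
  qed
  then have S: "ennreal (S n) \<le> ennreal (\<theta> / (\<theta> - 1) * W powr \<sigma>)" for n by (intro ennreal_leI) auto
  have "(\<Sum>k<n. if 2 ^ k * l < W then ennreal (a k) else 0) = ennreal (S n)" for n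
  proof -
    have "ennreal (S n) = (\<Sum>k<n. ennreal (if 2 ^ k * l < W then a k else 0))"
      unfolding S_def by (rule sum_ennreal[symmetric]) (simp add: a0)
    also have "\<dots> = (\<Sum>k<n. if 2 ^ k * l < W then ennreal (a k) else 0)" by (intro sum.cong) auto
    finally show ?thesis ..
  qed
  then have "(\<Sum>k<n. if 2 ^ k * l < W then ennreal (a k) else 0) \<le> ennreal (\<theta> / (\<theta> - 1) * W powr \<sigma>)" for n
    using S by simp
  then have "(\<Sum>k. if 2 ^ k * l < W then ennreal (a k) else 0) \<le> ennreal (\<theta> / (\<theta> - 1) * W powr \<sigma>)"
    unfolding suminf_eq_SUP by (intro SUP_least)
  then show ?thesis unfolding a_def \<theta>_def .
qed

text \<open>With \<open>s < 1\<close> the inequality says that \<open>ratio r x\<close> is at most a constant times the \<open>s\<close>-mean of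
  \<open>ratio e\<close> over \<open>cball x (C\<^sub>0 * r)\<close>. It is required for all scales \<open>e \<le> r\<close> with the same
  constant.\<close>

locale reverse_Holder_pair = doubling_pair +
  fixes s C\<^sub>0 C\<^sub>R :: real
  assumes s: "0 < s" "s < 1" and C0: "1 \<le> C\<^sub>0" and CR: "1 \<le> C\<^sub>R"
    and reverse_Holder: "0 < e \<Longrightarrow> e \<le> r \<Longrightarrow> ennreal (ratio r x powr s * measure \<mu> (cball x r)) \<le>
      ennreal C\<^sub>R * (\<integral>\<^sup>+y. ennreal (ratio e y powr s) * indicator (cball x (C\<^sub>0 * r)) y \<partial>\<mu>)"
begin

text \<open>Each point of the superlevel set has a radius \<open>r = e * 2^n \<le> r\<^sub>0\<close> such that the ratio exceeds
  \<open>l\<close> at the scale \<open>r\<close> but not at \<open>2 * r\<close>, so it is comparable with \<open>l\<close> there. The reverse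
  Hoelder inequality gives \<open>l^s \<mu>(B) \<le> C * \<integral> ratio^s\<close> over the enlarged ball. The part of the
  integral where \<open>ratio e \<le> t * l\<close> is absorbed on the left when \<open>t\<close> is small. The Vitali
  comparison sums up these inequalities.\<close>

lemma superlevel_estimate:
  "\<exists>t>0. \<exists>K\<ge>1. \<exists>C\<ge>0. \<forall>x\<^sub>0 r\<^sub>0 e l. 0 < e \<longrightarrow> e \<le> r\<^sub>0 \<longrightarrow> 0 < l \<longrightarrow> K * ratio r\<^sub>0 x\<^sub>0 \<le> l \<longrightarrow>
    (\<integral>\<^sup>+y. ennreal (ratio e y) * indicator (cball x\<^sub>0 r\<^sub>0 \<inter> {y. l < ratio e y}) y \<partial>\<mu>) \<le>
    ennreal (C * l powr (1 - s)) *
      (\<integral>\<^sup>+y. ennreal (ratio e y powr s) * indicator (cball x\<^sub>0 ((1 + C\<^sub>0) * r\<^sub>0) \<inter> {y. t * l < ratio e y}) y \<partial>\<mu>)"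
proof -
  define K where "K = 10 * C\<^sub>0"
  obtain C\<mu> where C\<mu>: "1 \<le> C\<mu>" and comp\<mu>: "\<And>x y r r'. 0 < r \<Longrightarrow> r' \<le> K * r \<Longrightarrow> dist x y \<le> K * r \<Longrightarrow>
      measure \<mu> (cball y r') \<le> C\<mu> * measure \<mu> (ball x r)"
    using \<mu>.ball_comparison[of K] by blast
  obtain C\<nu> where C\<nu>: "1 \<le> C\<nu>" and comp\<nu>: "\<And>x y r r'. 0 < r \<Longrightarrow> r' \<le> K * r \<Longrightarrow> dist x y \<le> K * r \<Longrightarrow>
      measure \<nu> (cball y r') \<le> C\<nu> * measure \<nu> (ball x r)"
    using \<nu>.ball_comparison[of K] by blast
  obtain Ca where Ca: "1 \<le> Ca" and int: "\<And>x r e. 0 < e \<Longrightarrow>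
     (\<integral>\<^sup>+y. ennreal (ratio e y) * indicator (cball x r) y \<partial>\<mu>) \<le> ennreal (Ca * measure \<nu> (cball x (r + e)))"
    using nn_integral_ratio_le by blast
  have K: "10 \<le> K" using C0 by (simp add: K_def)
  \<comment> \<open>With this \<open>t\<close> the part of the integral below level \<open>t * l\<close> is at most half of the
      left-hand side.\<close>
  define t where "t = (1 / (2 * C\<^sub>R * C\<mu>)) powr (1 / s)"
  have t: "0 < t" "t powr s = 1 / (2 * C\<^sub>R * C\<mu>)" using CR C\<mu> s by (auto simp: t_def powr_powr)
  define C' where "C' = Ca * C\<nu> * C\<mu>"
  have C': "1 \<le> C'" unfolding C'_def using Ca C\<nu> C\<mu> by (metis mult_ge1_I)
  have C\<nu>\<mu>: "1 \<le> C\<nu> * C\<mu>" using C\<nu> C\<mu> by (metis mult_ge1_I)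
  have C'R: "0 \<le> 2 * C' * C\<^sub>R" using C' CR by simp
  show ?thesis
  proof (rule exI[of _ t], rule conjI[OF t(1)], rule exI[of _ "C\<nu> * C\<mu>"], rule conjI[OF C\<nu>\<mu>],
      rule exI[of _ "2 * C' * C\<^sub>R"], rule conjI[OF C'R], intro allI impI)
    fix x\<^sub>0 :: 'a and r\<^sub>0 e l :: real
    assume e: "0 < e" "e \<le> r\<^sub>0" and l: "0 < l" "C\<nu> * C\<mu> * ratio r\<^sub>0 x\<^sub>0 \<le> l"
    have r0: "0 < r\<^sub>0" using e by simp
    define S where "S = cball x\<^sub>0 r\<^sub>0 \<inter> {y. l < ratio e y}"
    define U where "U = cball x\<^sub>0 ((1 + C\<^sub>0) * r\<^sub>0)"
    define a where "a = density \<mu> (\<lambda>y. ennreal (ratio e y))"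
    define b where "b = density \<mu> (\<lambda>y. ennreal (ratio e y powr s) * indicator {y. t * l < ratio e y} y)"
    have sa: "sets a = sets borel" and sb: "sets b = sets borel" by (simp_all add: a_def b_def)
    have [measurable]: "S \<in> sets borel" "U \<in> sets borel" unfolding S_def U_def by measurable
    have ea: "emeasure a E = (\<integral>\<^sup>+y. ennreal (ratio e y) * indicator E y \<partial>\<mu>)" if "E \<in> sets borel" for E
      unfolding a_def using that by (intro emeasure_density) auto
    have eb: "emeasure b E = (\<integral>\<^sup>+y. ennreal (ratio e y powr s) * indicator (E \<inter> {y. t * l < ratio e y}) y \<partial>\<mu>)"
      if "E \<in> sets borel" for E
      unfolding b_def using that by (subst emeasure_density) (auto intro!: nn_integral_cong simp: indicator_def)
    \<comment> \<open>The choice of \<open>l\<close> stops the process at the scale \<open>r\<^sub>0\<close>.\<close>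
    have far: "ratio \<rho> x \<le> l" if x: "x \<in> cball x\<^sub>0 r\<^sub>0" and \<rho>: "r\<^sub>0 \<le> \<rho>" "\<rho> \<le> 2 * r\<^sub>0" for x \<rho>
    proof -
      have 1: "measure \<nu> (cball x \<rho>) \<le> C\<nu> * measure \<nu> (ball x\<^sub>0 r\<^sub>0)"
        using x \<rho> r0 K by (intro comp\<nu>) (auto intro: order_trans mult_right_mono)
      also have "\<dots> \<le> C\<nu> * measure \<nu> (cball x\<^sub>0 r\<^sub>0)"
        using C\<nu> \<nu>.measure_ball_le_cball by (intro mult_left_mono) auto
      finally have 1: "measure \<nu> (cball x \<rho>) \<le> C\<nu> * measure \<nu> (cball x\<^sub>0 r\<^sub>0)" .
      have "r\<^sub>0 \<le> K * \<rho>" using \<rho> K r0 mult_mono[of 1 K r\<^sub>0 \<rho>] by simp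
      then have "measure \<mu> (cball x\<^sub>0 r\<^sub>0) \<le> C\<mu> * measure \<mu> (ball x \<rho>)"
        using x \<rho> r0 by (intro comp\<mu>) (auto simp: dist_commute)
      also have "\<dots> \<le> C\<mu> * measure \<mu> (cball x \<rho>)"
        using C\<mu> \<mu>.measure_ball_le_cball by (intro mult_left_mono) auto
      finally have 2: "measure \<mu> (cball x\<^sub>0 r\<^sub>0) \<le> C\<mu> * measure \<mu> (cball x \<rho>)" .
      have p: "0 < measure \<mu> (cball x \<rho>)" "0 < measure \<mu> (cball x\<^sub>0 r\<^sub>0)"
        using r0 \<rho> by (auto intro!: \<mu>.measure_cball_pos)
      have "ratio \<rho> x \<le> (C\<nu> * measure \<nu> (cball x\<^sub>0 r\<^sub>0)) / (measure \<mu> (cball x\<^sub>0 r\<^sub>0) / C\<mu>)"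
        unfolding ratio_def using 1 2 p C\<mu> C\<nu> by (intro frac_le) (auto simp: field_simps)
      also have "\<dots> = C\<nu> * C\<mu> * ratio r\<^sub>0 x\<^sub>0" by (simp add: ratio_def)
      finally show ?thesis using l by simp
    qed
    have "\<exists>r. e \<le> r \<and> r \<le> r\<^sub>0 \<and> l < ratio r x \<and> ratio (2 * r) x \<le> l" if x: "x \<in> S" for x
    proof -
      define P where "P n \<longleftrightarrow> e * 2 ^ n \<le> r\<^sub>0 \<and> l < ratio (e * 2 ^ n) x" for n :: nat
      have "P 0" using x e by (simp add: P_def S_def)
      obtain N :: nat where N: "r\<^sub>0 / e < 2 ^ N" using real_arch_pow[of 2 "r\<^sub>0 / e"] by auto
      have "\<not> P N" using N e by (simp add: P_def field_simps not_le)
      have "\<exists>n. P n \<and> \<not> P (Suc n)"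
      proof (rule ccontr)
        assume "\<nexists>n. P n \<and> \<not> P (Suc n)"
        then have "P n" for n using \<open>P 0\<close> by (induction n) auto
        then show False using \<open>\<not> P N\<close> by blast
      qed
      then obtain n where n: "P n" "\<not> P (Suc n)" by blast
      have "ratio (2 * (e * 2 ^ n)) x \<le> l"
      proof (cases "e * 2 ^ Suc n \<le> r\<^sub>0")
        case True then show ?thesis using n(2) by (simp add: P_def mult_ac)
      next
        case False
        then show ?thesis using n(1) x by (intro far) (auto simp: P_def S_def mult_ac)
      qed
      moreover have "e * 1 \<le> e * 2 ^ n" using e by (intro mult_left_mono) auto
      ultimately show ?thesis using n(1) by (intro exI[of _ "e * 2 ^ n"]) (auto simp: P_def)
    qed
    then obtain \<rho> where \<rho>: "\<And>x. x \<in> S \<Longrightarrow> e \<le> \<rho> x" "\<And>x. x \<in> S \<Longrightarrow> \<rho> x \<le> r\<^sub>0"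
      "\<And>x. x \<in> S \<Longrightarrow> l < ratio (\<rho> x) x" "\<And>x. x \<in> S \<Longrightarrow> ratio (2 * \<rho> x) x \<le> l" by metis
    have "\<exists>S'\<in>sets borel. S \<subseteq> S' \<and> emeasure a S' \<le> ennreal (2 * C' * C\<^sub>R * l powr (1 - s)) * emeasure b U"
    proof (rule \<mu>.Vitali_measure_comparison[where \<rho> = "\<lambda>x. C\<^sub>0 * \<rho> x" and R = "C\<^sub>0 * r\<^sub>0"])
      show "sets a = sets borel" "sets b = sets borel" "U \<in> sets borel" by fact+
      fix x assume x: "x \<in> S"
      define r where "r = \<rho> x"
      have r: "e \<le> r" "r \<le> r\<^sub>0" "l < ratio r x" "ratio (2 * r) x \<le> l" "0 < r"
        using \<rho>[OF x] e by (auto simp: r_def)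
      have Cr: "r \<le> C\<^sub>0 * r" using C0 r(5) by simp
      show "0 < C\<^sub>0 * \<rho> x" "C\<^sub>0 * \<rho> x \<le> C\<^sub>0 * r\<^sub>0" using r C0 by (auto simp: r_def)
      show "cball x (C\<^sub>0 * \<rho> x) \<subseteq> U"
      proof
        fix z assume "z \<in> cball x (C\<^sub>0 * \<rho> x)"
        then have "dist x z \<le> C\<^sub>0 * r" by (simp add: r_def)
        also have "\<dots> \<le> C\<^sub>0 * r\<^sub>0" using r(2) C0 by (intro mult_left_mono) auto
        finally have "dist x z \<le> C\<^sub>0 * r\<^sub>0" .
        moreover have "dist x\<^sub>0 x \<le> r\<^sub>0" using x by (simp add: S_def)
        ultimately show "z \<in> U" using dist_triangle[of x\<^sub>0 z x] by (simp add: U_def algebra_simps)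
      qed
      define m where "m = measure \<mu> (cball x r)"
      have m: "0 < m" unfolding m_def by (rule \<mu>.measure_cball_pos[OF r(5)])
      define B where "B = emeasure b (cball x (C\<^sub>0 * r))"
      have "emeasure a (cball x (5 * (C\<^sub>0 * r))) \<le> ennreal (Ca * measure \<nu> (cball x (5 * (C\<^sub>0 * r) + e)))"
        unfolding ea[OF borel_closed[OF closed_cball]] by (rule int[OF e(1)])
      also have "\<dots> \<le> ennreal (Ca * (C\<nu> * (l * (C\<mu> * m))))"
      proof (intro ennreal_leI mult_left_mono)
        have "measure \<nu> (cball x (5 * (C\<^sub>0 * r) + e)) \<le> C\<nu> * measure \<nu> (ball x (2 * r))"
        proof (rule comp\<nu>)
          show "5 * (C\<^sub>0 * r) + e \<le> K * (2 * r)" using r(1,5) Cr unfolding K_def by linarith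
        qed (use r(5) K in auto)
        also have "measure \<nu> (ball x (2 * r)) \<le> l * (C\<mu> * m)"
        proof -
          have p: "0 < measure \<mu> (cball x (2 * r))" using r(5) by (intro \<mu>.measure_cball_pos) auto
          have "measure \<nu> (ball x (2 * r)) \<le> measure \<nu> (cball x (2 * r))" by (rule \<nu>.measure_ball_le_cball)
          also have "\<dots> \<le> l * measure \<mu> (cball x (2 * r))" using r(4) p by (simp add: ratio_def field_simps)
          also have "measure \<mu> (cball x (2 * r)) \<le> C\<mu> * measure \<mu> (ball x r)"
            using r K by (intro comp\<mu>) (auto intro: mult_right_mono)
          also have "\<dots> \<le> C\<mu> * m"
            unfolding m_def using C\<mu> \<mu>.measure_ball_le_cball by (intro mult_left_mono) auto
          finally show ?thesis using l by simp
        qed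
        finally show "measure \<nu> (cball x (5 * (C\<^sub>0 * r) + e)) \<le> C\<nu> * (l * (C\<mu> * m))" using C\<nu> by simp
      qed (use Ca in simp)
      also have "\<dots> = ennreal (C' * l powr (1 - s)) * ennreal (l powr s * m)"
      proof -
        have "l powr (1 - s) * l powr s = l" using l by (simp flip: powr_add)
        moreover have "C' * l powr (1 - s) * (l powr s * m) = C' * m * (l powr (1 - s) * l powr s)"
          by (simp only: mult_ac)
        moreover have "C' * m * l = Ca * (C\<nu> * (l * (C\<mu> * m)))" by (simp add: C'_def mult_ac)
        ultimately have "Ca * (C\<nu> * (l * (C\<mu> * m))) = C' * l powr (1 - s) * (l powr s * m)" by metis
        then show ?thesis using C' m by (simp only:) (rule ennreal_mult, auto)
      qed
      also have "ennreal (l powr s * m) \<le> ennreal (2 * C\<^sub>R) * B"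
      proof -
        have 1: "ennreal (l powr s * m) \<le> ennreal (ratio r x powr s * m)"
          using r(3) l m s by (intro ennreal_leI mult_right_mono powr_mono2) auto
        have 2: "ennreal (ratio r x powr s * m) \<le> ennreal C\<^sub>R * (\<integral>\<^sup>+y. ennreal (ratio e y powr s) * indicator (cball x (C\<^sub>0 * r)) y \<partial>\<mu>)"
          unfolding m_def by (rule reverse_Holder[OF e(1) r(1)])
        have "(\<integral>\<^sup>+y. ennreal (ratio e y powr s) * indicator (cball x (C\<^sub>0 * r)) y \<partial>\<mu>)
            \<le> (\<integral>\<^sup>+y. ennreal (ratio e y powr s) * indicator (cball x (C\<^sub>0 * r) \<inter> {y. t * l < ratio e y}) y
                + ennreal ((t * l) powr s) * indicator (cball x (C\<^sub>0 * r)) y \<partial>\<mu>)"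
        proof (intro nn_integral_mono)
          fix y
          show "ennreal (ratio e y powr s) * indicator (cball x (C\<^sub>0 * r)) y \<le>
              ennreal (ratio e y powr s) * indicator (cball x (C\<^sub>0 * r) \<inter> {y. t * l < ratio e y}) y
                + ennreal ((t * l) powr s) * indicator (cball x (C\<^sub>0 * r)) y"
          proof (cases "t * l < ratio e y")
            case True then show ?thesis by (auto simp: indicator_def)
          next
            case False
            then have "ratio e y powr s \<le> (t * l) powr s"
              using s ratio_nonneg[of e y] by (intro powr_mono2) auto
            then have "ennreal (ratio e y powr s) \<le> ennreal ((t * l) powr s)" by (rule ennreal_leI)
            then show ?thesis using False by (simp add: indicator_def)
          qed
        qed
        also have "\<dots> = B + ennreal ((t * l) powr s) * emeasure \<mu> (cball x (C\<^sub>0 * r))"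
        proof -
          have "(\<integral>\<^sup>+y. ennreal ((t * l) powr s) * indicator (cball x (C\<^sub>0 * r)) y \<partial>\<mu>) =
              ennreal ((t * l) powr s) * emeasure \<mu> (cball x (C\<^sub>0 * r))"
            by (rule nn_integral_cmult_indicator) simp
          moreover have "B = (\<integral>\<^sup>+y. ennreal (ratio e y powr s) * indicator (cball x (C\<^sub>0 * r) \<inter> {y. t * l < ratio e y}) y \<partial>\<mu>)"
            unfolding B_def by (rule eb) simp
          moreover have "(\<integral>\<^sup>+y. ennreal (ratio e y powr s) * indicator (cball x (C\<^sub>0 * r) \<inter> {y. t * l < ratio e y}) y
                + ennreal ((t * l) powr s) * indicator (cball x (C\<^sub>0 * r)) y \<partial>\<mu>) =
              (\<integral>\<^sup>+y. ennreal (ratio e y powr s) * indicator (cball x (C\<^sub>0 * r) \<inter> {y. t * l < ratio e y}) y \<partial>\<mu>) +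
              (\<integral>\<^sup>+y. ennreal ((t * l) powr s) * indicator (cball x (C\<^sub>0 * r)) y \<partial>\<mu>)"
          proof (rule nn_integral_add)
            define E where "E = cball x (C\<^sub>0 * r)"
            define F where "F = {y. t * l < ratio e y}"
            have [measurable]: "E \<in> sets borel" by (simp add: E_def)
            have [measurable]: "F \<in> sets borel" unfolding F_def by measurable
            show "(\<lambda>y. ennreal (ratio e y powr s) * indicator (cball x (C\<^sub>0 * r) \<inter> {y. t * l < ratio e y}) y) \<in> borel_measurable \<mu>"
              unfolding E_def[symmetric] F_def[symmetric] by measurable
            show "(\<lambda>y. ennreal ((t * l) powr s) * indicator (cball x (C\<^sub>0 * r)) y) \<in> borel_measurable \<mu>"
              unfolding E_def[symmetric] by measurable
          qed
          ultimately show ?thesis by simp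
        qed
        also have "\<dots> \<le> B + ennreal ((t * l) powr s * (C\<mu> * m))"
        proof -
          have "measure \<mu> (cball x (C\<^sub>0 * r)) \<le> C\<mu> * measure \<mu> (ball x r)"
            using r C0 by (intro comp\<mu>) (auto simp: K_def)
          also have "\<dots> \<le> C\<mu> * m"
            unfolding m_def using C\<mu> \<mu>.measure_ball_le_cball by (intro mult_left_mono) auto
          finally show ?thesis
            by (auto simp: \<mu>.emeasure_cball simp flip: ennreal_mult intro!: add_left_mono ennreal_leI mult_left_mono)
        qed
        also have "(t * l) powr s * (C\<mu> * m) = l powr s * m / (2 * C\<^sub>R)"
          using t l C\<mu> CR by (simp add: powr_mult field_simps)
        finally have *: "ennreal (l powr s * m) \<le> ennreal C\<^sub>R * (B + ennreal (l powr s * m / (2 * C\<^sub>R)))"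
          by (rule order_trans[OF 1 order_trans[OF 2 mult_left_mono[OF _ zero_le]]])
        show ?thesis
        proof (cases B)
          case top then show ?thesis using CR by (simp add: ennreal_mult_eq_top_iff)
        next
          case (real \<beta>)
          have "ennreal (l powr s * m) \<le> ennreal (C\<^sub>R * (\<beta> + l powr s * m / (2 * C\<^sub>R)))"
            using * real m CR by (simp add: ennreal_mult)
          then have "l powr s * m \<le> C\<^sub>R * (\<beta> + l powr s * m / (2 * C\<^sub>R))"
            using real m CR by (subst (asm) ennreal_le_iff) auto
          then have "l powr s * m \<le> 2 * C\<^sub>R * \<beta>" using CR by (simp add: field_simps)
          then show ?thesis using real CR by (simp add: ennreal_leI flip: ennreal_mult)
        qed
      qed
      finally have "emeasure a (cball x (5 * (C\<^sub>0 * r))) \<le> ennreal (C' * l powr (1 - s)) * (ennreal (2 * C\<^sub>R) * B)"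
        by (simp add: mult_left_mono)
      also have "\<dots> = ennreal (2 * C' * C\<^sub>R * l powr (1 - s)) * B"
        using C' CR by (simp add: mult_ac flip: ennreal_mult)
      finally show "emeasure a (cball x (5 * (C\<^sub>0 * \<rho> x)))
          \<le> ennreal (2 * C' * C\<^sub>R * l powr (1 - s)) * emeasure b (cball x (C\<^sub>0 * \<rho> x))"
        by (simp add: B_def r_def)
    qed
    then obtain S' where S': "S' \<in> sets borel" "S \<subseteq> S'"
      "emeasure a S' \<le> ennreal (2 * C' * C\<^sub>R * l powr (1 - s)) * emeasure b U" by blast
    have "emeasure a S \<le> emeasure a S'" using S' by (intro emeasure_mono) (auto simp: sa)
    then have "emeasure a S \<le> ennreal (2 * C' * C\<^sub>R * l powr (1 - s)) * emeasure b U" using S'(3) by simp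
    then show "(\<integral>\<^sup>+y. ennreal (ratio e y) * indicator (cball x\<^sub>0 r\<^sub>0 \<inter> {y. l < ratio e y}) y \<partial>\<mu>) \<le>
        ennreal (2 * C' * C\<^sub>R * l powr (1 - s)) *
        (\<integral>\<^sup>+y. ennreal (ratio e y powr s) * indicator (cball x\<^sub>0 ((1 + C\<^sub>0) * r\<^sub>0) \<inter> {y. t * l < ratio e y}) y \<partial>\<mu>)"
      by (simp add: ea eb flip: S_def U_def)
  qed
qed

text \<open>Apply the superlevel estimate at the levels \<open>l = 2^k K q\<close>, where \<open>q = ratio r\<^sub>0 x\<^sub>0\<close>, and sum
  over \<open>k\<close>. The powers \<open>l^(1-s)\<close> with \<open>t * l < ratio e y\<close> form a geometric series of size
  \<open>(ratio e y)^(1-s)\<close>, which turns the integrand \<open>(ratio e y)^s\<close> into \<open>ratio e y\<close>.\<close>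

lemma LlogL_estimate:
  "\<exists>C\<ge>0. \<forall>x\<^sub>0 r\<^sub>0 e. 0 < e \<longrightarrow> e \<le> r\<^sub>0 \<longrightarrow>
    (\<integral>\<^sup>+y. ennreal (ratio e y * ln (max 1 (ratio e y / ratio r\<^sub>0 x\<^sub>0))) * indicator (cball x\<^sub>0 r\<^sub>0) y \<partial>\<mu>)
      \<le> ennreal (C * measure \<nu> (cball x\<^sub>0 r\<^sub>0))"
proof -
  obtain t K C where t: "0 < t" and K: "1 \<le> K" and C: "0 \<le> C"
    and super: "\<And>x\<^sub>0 r\<^sub>0 e l. 0 < e \<Longrightarrow> e \<le> r\<^sub>0 \<Longrightarrow> 0 < l \<Longrightarrow> K * ratio r\<^sub>0 x\<^sub>0 \<le> l \<Longrightarrow>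
    (\<integral>\<^sup>+y. ennreal (ratio e y) * indicator (cball x\<^sub>0 r\<^sub>0 \<inter> {y. l < ratio e y}) y \<partial>\<mu>) \<le>
    ennreal (C * l powr (1 - s)) *
      (\<integral>\<^sup>+y. ennreal (ratio e y powr s) * indicator (cball x\<^sub>0 ((1 + C\<^sub>0) * r\<^sub>0) \<inter> {y. t * l < ratio e y}) y \<partial>\<mu>)"
    using superlevel_estimate by blast
  obtain C\<nu> where C\<nu>: "1 \<le> C\<nu>" and comp\<nu>: "\<And>x y r r'. 0 < r \<Longrightarrow> r' \<le> (2 + C\<^sub>0) * r \<Longrightarrow> dist x y \<le> (2 + C\<^sub>0) * r \<Longrightarrow>
      measure \<nu> (cball y r') \<le> C\<nu> * measure \<nu> (ball x r)"
    using \<nu>.ball_comparison[of "2 + C\<^sub>0"] by blast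
  obtain Ca where Ca: "1 \<le> Ca" and int: "\<And>x r e. 0 < e \<Longrightarrow>
     (\<integral>\<^sup>+y. ennreal (ratio e y) * indicator (cball x r) y \<partial>\<mu>) \<le> ennreal (Ca * measure \<nu> (cball x (r + e)))"
    using nn_integral_ratio_le by blast
  define G where "G = 2 powr (1 - s) / (2 powr (1 - s) - 1)"
  have "1 < 2 powr (1 - s)" using s by simp
  then have G: "0 \<le> G" by (simp add: G_def)
  define D where "D = C * G / t powr (1 - s)"
  have D: "0 \<le> D" using C G by (simp add: D_def)
  show ?thesis
  proof (intro exI[of _ "(ln K + D) * (Ca * C\<nu>)"] conjI allI impI)
    show "0 \<le> (ln K + D) * (Ca * C\<nu>)" using K D Ca C\<nu> by simp
    fix x\<^sub>0 :: 'a and r\<^sub>0 e :: real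
    assume e: "0 < e" "e \<le> r\<^sub>0"
    have r0: "0 < r\<^sub>0" using e by simp
    define V where "V = measure \<nu> (cball x\<^sub>0 r\<^sub>0)"
    define q where "q = ratio r\<^sub>0 x\<^sub>0"
    have q: "0 < q" using \<mu>.measure_cball_pos[OF r0, of x\<^sub>0] \<nu>.measure_cball_pos[OF r0, of x\<^sub>0] by (simp add: q_def ratio_def)
    define l where "l = K * q"
    have l: "0 < l" using K q by (simp add: l_def)
    define B where "B = cball x\<^sub>0 r\<^sub>0"
    define U where "U = cball x\<^sub>0 ((1 + C\<^sub>0) * r\<^sub>0)"
    have [measurable]: "B \<in> sets borel" "U \<in> sets borel" by (simp_all add: B_def U_def)
    have intU: "(\<integral>\<^sup>+y. ennreal (ratio e y) * indicator U y \<partial>\<mu>) \<le> ennreal (Ca * C\<nu> * V)"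
    proof -
      have "measure \<nu> (cball x\<^sub>0 ((1 + C\<^sub>0) * r\<^sub>0 + e)) \<le> C\<nu> * measure \<nu> (ball x\<^sub>0 r\<^sub>0)"
        using e r0 C0 by (intro comp\<nu>) (auto simp: algebra_simps)
      also have "\<dots> \<le> C\<nu> * V" unfolding V_def using C\<nu> \<nu>.measure_ball_le_cball by (intro mult_left_mono) auto
      finally have "Ca * measure \<nu> (cball x\<^sub>0 ((1 + C\<^sub>0) * r\<^sub>0 + e)) \<le> Ca * (C\<nu> * V)" using Ca by (intro mult_left_mono) auto
      then show ?thesis unfolding U_def using int[OF e(1), of x\<^sub>0 "(1 + C\<^sub>0) * r\<^sub>0"]
        by (simp add: mult.assoc) (meson ennreal_leI order_trans)
    qed
    have BU: "B \<subseteq> U" unfolding B_def U_def using C0 r0 by (intro subset_cball) (simp add: distrib_right)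
    have pt: "ennreal (ratio e y * ln (max 1 (ratio e y / q))) * indicator B y \<le>
        ennreal (ln K) * (ennreal (ratio e y) * indicator U y) +
        (\<Sum>k. ennreal (ratio e y) * indicator (B \<inter> {y. 2 ^ k * l < ratio e y}) y)" for y
    proof (cases "y \<in> B")
      case True
      let ?w = "ratio e y"
      have "max 1 (?w / q) \<le> K * max 1 (?w / l)"
      proof -
        have "?w / q = K * (?w / l)" using K q by (simp add: l_def)
        also have "\<dots> \<le> K * max 1 (?w / l)" using K by (intro mult_left_mono) auto
        finally have "?w / q \<le> K * max 1 (?w / l)" .
        moreover have "1 * 1 \<le> K * max 1 (?w / l)" using K by (intro mult_mono) auto
        ultimately show ?thesis by simp
      qed
      then have "ln (max 1 (?w / q)) \<le> ln (K * max 1 (?w / l))" using K by (subst ln_le_cancel_iff) auto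
      also have "\<dots> = ln K + ln (max 1 (?w / l))" using K by (intro ln_mult_pos) auto
      finally have "?w * ln (max 1 (?w / q)) \<le> ln K * ?w + ?w * ln (max 1 (?w / l))"
        using mult_left_mono[OF _ ratio_nonneg[of e y]] by (fastforce simp: algebra_simps)
      then have "ennreal (?w * ln (max 1 (?w / q))) \<le> ennreal (ln K * ?w + ?w * ln (max 1 (?w / l)))"
        by (rule ennreal_leI)
      also have "\<dots> = ennreal (ln K) * ennreal ?w + ennreal ?w * ennreal (ln (max 1 (?w / l)))"
        using K ratio_nonneg[of e y] by (simp add: ennreal_mult)
      finally have 1: "ennreal (?w * ln (max 1 (?w / q))) \<le> ennreal (ln K) * ennreal ?w + ennreal ?w * ennreal (ln (max 1 (?w / l)))" .
      have "(\<Sum>k. if 2 ^ k < ?w / l then 1 else 0) = (\<Sum>k. indicator (B \<inter> {y. 2 ^ k * l < ratio e y}) y :: ennreal)"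
        using True l by (intro suminf_cong) (auto simp: indicator_def field_simps)
      then have "ennreal (ln (max 1 (?w / l))) \<le> (\<Sum>k. indicator (B \<inter> {y. 2 ^ k * l < ratio e y}) y)"
        using ln_max_le_count_powers[of "?w / l"] by simp
      then have "ennreal ?w * ennreal (ln (max 1 (?w / l))) \<le>
          ennreal ?w * (\<Sum>k. indicator (B \<inter> {y. 2 ^ k * l < ratio e y}) y)"
        by (intro mult_left_mono) auto
      also have "\<dots> = (\<Sum>k. ennreal ?w * indicator (B \<inter> {y. 2 ^ k * l < ratio e y}) y)"
        by (rule ennreal_suminf_cmult[symmetric])
      finally have "ennreal (?w * ln (max 1 (?w / q))) \<le> ennreal (ln K) * ennreal ?w +
          (\<Sum>k. ennreal ?w * indicator (B \<inter> {y. 2 ^ k * l < ratio e y}) y)"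
        by (rule order_trans[OF 1 add_left_mono])
      then show ?thesis using True BU by auto
    qed simp
    have "(\<integral>\<^sup>+y. ennreal (ratio e y * ln (max 1 (ratio e y / q))) * indicator B y \<partial>\<mu>) \<le>
        (\<integral>\<^sup>+y. ennreal (ln K) * (ennreal (ratio e y) * indicator U y) +
        (\<Sum>k. ennreal (ratio e y) * indicator (B \<inter> {y. 2 ^ k * l < ratio e y}) y) \<partial>\<mu>)"
      by (intro nn_integral_mono pt)
    also have "\<dots> = ennreal (ln K) * (\<integral>\<^sup>+y. ennreal (ratio e y) * indicator U y \<partial>\<mu>) +
        (\<Sum>k. \<integral>\<^sup>+y. ennreal (ratio e y) * indicator (B \<inter> {y. 2 ^ k * l < ratio e y}) y \<partial>\<mu>)"
      by (subst nn_integral_add, measurable, subst nn_integral_cmult, measurable, subst nn_integral_suminf, measurable)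
    also have "\<dots> \<le> ennreal (ln K) * ennreal (Ca * C\<nu> * V) + ennreal D * ennreal (Ca * C\<nu> * V)"
    proof (intro add_mono mult_left_mono intU)
      have "(\<Sum>k. \<integral>\<^sup>+y. ennreal (ratio e y) * indicator (B \<inter> {y. 2 ^ k * l < ratio e y}) y \<partial>\<mu>) \<le>
          (\<Sum>k. ennreal (C * (2 ^ k * l) powr (1 - s)) *
            (\<integral>\<^sup>+y. ennreal (ratio e y powr s) * indicator (U \<inter> {y. t * (2 ^ k * l) < ratio e y}) y \<partial>\<mu>))"
      proof (intro suminf_le allI)
        fix k :: nat
        have "1 * l \<le> 2 ^ k * l" using l by (intro mult_right_mono) auto
        then show "(\<integral>\<^sup>+y. ennreal (ratio e y) * indicator (B \<inter> {y. 2 ^ k * l < ratio e y}) y \<partial>\<mu>) \<le>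
            ennreal (C * (2 ^ k * l) powr (1 - s)) *
            (\<integral>\<^sup>+y. ennreal (ratio e y powr s) * indicator (U \<inter> {y. t * (2 ^ k * l) < ratio e y}) y \<partial>\<mu>)"
          unfolding B_def U_def using e l by (intro super) (auto simp: l_def q_def)
      qed auto
      also have "\<dots> = (\<integral>\<^sup>+y. (\<Sum>k. ennreal (C * (2 ^ k * l) powr (1 - s)) *
            (ennreal (ratio e y powr s) * indicator (U \<inter> {y. t * (2 ^ k * l) < ratio e y}) y)) \<partial>\<mu>)"
        by (subst nn_integral_suminf, measurable) (intro suminf_cong nn_integral_cmult[symmetric], measurable)
      also have "\<dots> \<le> (\<integral>\<^sup>+y. ennreal D * (ennreal (ratio e y) * indicator U y) \<partial>\<mu>)"
      proof (intro nn_integral_mono)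
        fix y
        let ?w = "ratio e y"
        show "(\<Sum>k. ennreal (C * (2 ^ k * l) powr (1 - s)) *
            (ennreal (?w powr s) * indicator (U \<inter> {y. t * (2 ^ k * l) < ratio e y}) y)) \<le> ennreal D * (ennreal ?w * indicator U y)"
        proof (cases "y \<in> U")
          case True
          have "(\<Sum>k. ennreal (C * (2 ^ k * l) powr (1 - s)) *
              (ennreal (?w powr s) * indicator (U \<inter> {y. t * (2 ^ k * l) < ratio e y}) y)) =
              (\<Sum>k. ennreal (C * ?w powr s) * (if 2 ^ k * l < ?w / t then ennreal ((2 ^ k * l) powr (1 - s)) else 0))"
            using True t C by (intro suminf_cong) (auto simp: indicator_def field_simps ennreal_mult)
          also have "\<dots> = ennreal (C * ?w powr s) * (\<Sum>k. if 2 ^ k * l < ?w / t then ennreal ((2 ^ k * l) powr (1 - s)) else 0)"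
            by (rule ennreal_suminf_cmult)
          also have "\<dots> \<le> ennreal (C * ?w powr s) * ennreal (G * (?w / t) powr (1 - s))"
            unfolding G_def using s l t ratio_nonneg[of e y] by (intro mult_left_mono geometric_sum_below) auto
          also have "\<dots> = ennreal (C * ?w powr s * (G * (?w / t) powr (1 - s)))"
            using C G by (simp add: ennreal_mult)
          also have "C * ?w powr s * (G * (?w / t) powr (1 - s)) = D * (?w powr s * ?w powr (1 - s))"
            using t ratio_nonneg[of e y] by (simp add: D_def powr_divide)
          also have "?w powr s * ?w powr (1 - s) = ?w"
            using ratio_nonneg[of e y] by (simp flip: powr_add)
          finally show ?thesis using True D ratio_nonneg[of e y] by (simp add: ennreal_mult)
        qed simp
      qed
      also have "\<dots> = ennreal D * (\<integral>\<^sup>+y. ennreal (ratio e y) * indicator U y \<partial>\<mu>)"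
        by (rule nn_integral_cmult) measurable
      also have "\<dots> \<le> ennreal D * ennreal (Ca * C\<nu> * V)" by (intro mult_left_mono intU) simp
      finally show "(\<Sum>k. \<integral>\<^sup>+y. ennreal (ratio e y) * indicator (B \<inter> {y. 2 ^ k * l < ratio e y}) y \<partial>\<mu>)
          \<le> ennreal D * ennreal (Ca * C\<nu> * V)" .
    qed simp
    also have "\<dots> = ennreal ((ln K + D) * (Ca * C\<nu>) * V)"
      using K D Ca C\<nu> by (simp add: V_def distrib_right mult.assoc flip: ennreal_mult ennreal_plus)
    finally show "(\<integral>\<^sup>+y. ennreal (ratio e y * ln (max 1 (ratio e y / ratio r\<^sub>0 x\<^sub>0))) * indicator (cball x\<^sub>0 r\<^sub>0) y \<partial>\<mu>)
      \<le> ennreal ((ln K + D) * (Ca * C\<nu>) * measure \<nu> (cball x\<^sub>0 r\<^sub>0))"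
      by (simp add: q_def B_def V_def)
  qed
qed

end

section \<open>Quasisymmetric maps of Ahlfors regular spaces\<close>

text \<open>Quasisymmetry without a modulus \<open>\<eta>\<close>: the first conjunct says that the distortion of relative
  distances is bounded, the second that it tends to 0 with the relative distance. In this form
  the notion passes to inverse maps by contraposition, which exchanges the two conjuncts.\<close>

definition qs_control :: "('a::metric_space \<Rightarrow> 'a) \<Rightarrow> bool" where
  "qs_control f \<longleftrightarrow>
     (\<forall>\<theta>\<ge>0. \<exists>H\<ge>0. \<forall>x a b. dist x a \<le> \<theta> * dist x b \<longrightarrow> dist (f x) (f a) \<le> H * dist (f x) (f b)) \<and>
     (\<forall>\<delta>>0. \<exists>\<theta>>0. \<forall>x a b. dist x a \<le> \<theta> * dist x b \<longrightarrow> dist (f x) (f a) \<le> \<delta> * dist (f x) (f b))"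

lemma quasisymmetric_imp_qs_control:
  fixes f :: "'a::metric_space \<Rightarrow> 'a"
  assumes "quasisymmetric \<eta> f" shows "qs_control f"
proof -
  obtain \<zeta> where \<zeta>: "homeomorphism {0..} {0..} \<eta> \<zeta>" and mono: "strict_mono_on {0..} \<eta>"
    and qs: "\<And>\<theta> x a b. 0 \<le> \<theta> \<Longrightarrow> x \<noteq> a \<Longrightarrow> x \<noteq> b \<Longrightarrow> a \<noteq> b \<Longrightarrow>
        dist x a / dist x b \<le> \<theta> \<Longrightarrow> dist (f x) (f a) / dist (f x) (f b) \<le> \<eta> \<theta>"
    and "\<exists>g. homeomorphism UNIV UNIV f g"
    using assms unfolding quasisymmetric_def by blast
  then have inj: "f x = f y \<longleftrightarrow> x = y" for x y by (metis UNIV_I homeomorphism_apply1)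
  have main: "dist (f x) (f a) \<le> \<eta> \<theta> * dist (f x) (f b)"
    if "0 \<le> \<theta>" "x \<noteq> a" "a \<noteq> b" "dist x a \<le> \<theta> * dist x b" for \<theta> x a b
  proof -
    have "x \<noteq> b" using that by auto
    then have "dist (f x) (f a) / dist (f x) (f b) \<le> \<eta> \<theta>"
      using that by (intro qs) (auto simp: divide_le_eq)
    then show ?thesis using \<open>x \<noteq> b\<close> inj by (simp add: divide_le_eq)
  qed
  have \<eta>nn: "0 \<le> \<eta> \<theta>" if "0 \<le> \<theta>" for \<theta>
    using homeomorphism_image1[OF \<zeta>] that by (auto simp: set_eq_iff image_iff)
  show ?thesis
    unfolding qs_control_def
  proof (intro conjI allI impI)
    fix \<theta> :: real assume \<theta>: "0 \<le> \<theta>"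
    show "\<exists>H\<ge>0. \<forall>x a b. dist x a \<le> \<theta> * dist x b \<longrightarrow> dist (f x) (f a) \<le> H * dist (f x) (f b)"
    proof (intro exI[of _ "max 1 (\<eta> \<theta>)"] conjI allI impI)
      fix x a b :: 'a assume d: "dist x a \<le> \<theta> * dist x b"
      consider "x = a" | "x \<noteq> a" "a = b" | "x \<noteq> a" "a \<noteq> b" by blast
      then show "dist (f x) (f a) \<le> max 1 (\<eta> \<theta>) * dist (f x) (f b)"
      proof cases
        case 2
        have "1 * dist (f x) (f b) \<le> max 1 (\<eta> \<theta>) * dist (f x) (f b)" by (intro mult_right_mono) auto
        then show ?thesis using 2 by simp
      next
        case 3
        have "\<eta> \<theta> * dist (f x) (f b) \<le> max 1 (\<eta> \<theta>) * dist (f x) (f b)" by (intro mult_right_mono) auto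
        then show ?thesis using main[OF \<theta> 3 d] by simp
      qed simp
    qed simp
  next
    fix \<delta> :: real assume \<delta>: "0 < \<delta>"
    have "\<delta> \<in> \<eta> ` {0..}" using homeomorphism_image1[OF \<zeta>] \<delta> by simp
    then obtain t where t: "0 \<le> t" "\<eta> t = \<delta>" by auto
    have "0 \<in> \<eta> ` {0..}" using homeomorphism_image1[OF \<zeta>] by simp
    then obtain t0 where t0: "0 \<le> t0" "\<eta> t0 = 0" by auto
    have "t \<noteq> 0"
    proof
      assume "t = 0"
      then have "0 < t0" using t t0 \<delta> by (metis less_eq_real_def less_irrefl)
      then have "\<eta> 0 < \<eta> t0" using mono by (intro strict_mono_onD[OF mono]) auto
      then show False using \<open>t = 0\<close> t t0 \<delta> by simp
    qed
    define \<theta> where "\<theta> = min t (1 / 2)"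
    have \<theta>: "0 < \<theta>" "\<theta> < 1" "\<theta> \<le> t" using t \<open>t \<noteq> 0\<close> by (auto simp: \<theta>_def)
    have "\<eta> \<theta> \<le> \<delta>"
      using strict_mono_onD[OF mono, of \<theta> t] \<theta> t by (cases "\<theta> = t") auto
    show "\<exists>\<theta>>0. \<forall>x a b. dist x a \<le> \<theta> * dist x b \<longrightarrow> dist (f x) (f a) \<le> \<delta> * dist (f x) (f b)"
    proof (intro exI[of _ \<theta>] conjI allI impI \<theta>(1))
      fix x a b :: 'a assume d: "dist x a \<le> \<theta> * dist x b"
      show "dist (f x) (f a) \<le> \<delta> * dist (f x) (f b)"
      proof (cases "x = a")
        case False
        have "a \<noteq> b"
        proof
          assume "a = b"
          moreover have "\<theta> * dist x a < 1 * dist x a" using \<theta> False by (intro mult_strict_right_mono) auto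
          ultimately show False using d by simp
        qed
        have "\<eta> \<theta> * dist (f x) (f b) \<le> \<delta> * dist (f x) (f b)" using \<open>\<eta> \<theta> \<le> \<delta>\<close> by (intro mult_right_mono) auto
        then show ?thesis using main[OF _ False \<open>a \<noteq> b\<close> d] \<theta> by simp
      qed (use \<delta> in simp)
    qed
  qed
qed

lemma qs_control_inverse:
  fixes f g :: "'a::metric_space \<Rightarrow> 'a"
  assumes qs: "qs_control f" and fg: "\<And>x. f (g x) = x"
  shows "qs_control g"
  unfolding qs_control_def
proof (intro conjI allI impI)
  fix \<theta> :: real assume \<theta>: "0 \<le> \<theta>"
  obtain t where t: "0 < t" "\<And>x a b. dist x a \<le> t * dist x b \<Longrightarrow> dist (f x) (f a) \<le> 1 / (\<theta> + 1) * dist (f x) (f b)"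
    using qs \<theta> unfolding qs_control_def by (metis add_nonneg_pos divide_pos_pos zero_less_one)
  show "\<exists>H\<ge>0. \<forall>x a b. dist x a \<le> \<theta> * dist x b \<longrightarrow> dist (g x) (g a) \<le> H * dist (g x) (g b)"
  proof (intro exI[of _ "1 / t"] conjI allI impI)
    fix x a b :: 'a assume d: "dist x a \<le> \<theta> * dist x b"
    show "dist (g x) (g a) \<le> 1 / t * dist (g x) (g b)"
    proof (rule ccontr)
      assume "\<not> dist (g x) (g a) \<le> 1 / t * dist (g x) (g b)"
      then have less: "dist (g x) (g b) < t * dist (g x) (g a)" using t by (simp add: field_simps not_le)
      then have "dist x b \<le> 1 / (\<theta> + 1) * dist x a" using t(2)[of "g x" "g b" "g a"] by (simp add: fg)
      then have "(\<theta> + 1) * dist x b \<le> dist x a" using \<theta> by (simp add: field_simps)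
      then have "dist x b \<le> 0" using d unfolding distrib_right by linarith
      then have "x = b" by simp
      then have "x = a" using d by simp
      then show False using \<open>x = b\<close> less by simp
    qed
  qed (use t in simp)
next
  fix \<delta> :: real assume \<delta>: "0 < \<delta>"
  obtain H where H: "0 \<le> H" "\<And>x a b. dist x a \<le> 1 / \<delta> * dist x b \<Longrightarrow> dist (f x) (f a) \<le> H * dist (f x) (f b)"
    using qs \<delta> unfolding qs_control_def by (metis divide_nonneg_pos zero_le_one)
  show "\<exists>\<theta>>0. \<forall>x a b. dist x a \<le> \<theta> * dist x b \<longrightarrow> dist (g x) (g a) \<le> \<delta> * dist (g x) (g b)"
  proof (intro exI[of _ "1 / (2 * (H + 1))"] conjI allI impI)
    fix x a b :: 'a assume d: "dist x a \<le> 1 / (2 * (H + 1)) * dist x b"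
    show "dist (g x) (g a) \<le> \<delta> * dist (g x) (g b)"
    proof (rule ccontr)
      assume "\<not> dist (g x) (g a) \<le> \<delta> * dist (g x) (g b)"
      then have less: "\<delta> * dist (g x) (g b) < dist (g x) (g a)" by simp
      then have "dist (g x) (g b) \<le> 1 / \<delta> * dist (g x) (g a)" using \<delta> by (simp add: field_simps)
      then have "dist x b \<le> H * dist x a" using H(2)[of "g x" "g b" "g a"] by (simp add: fg)
      also have "\<dots> \<le> H * (1 / (2 * (H + 1)) * dist x b)" using d H by (intro mult_left_mono) auto
      also have "\<dots> = H / (2 * (H + 1)) * dist x b" by simp
      also have "\<dots> \<le> 1 / 2 * dist x b" using H by (intro mult_right_mono) (auto simp: field_simps)
      finally have "x = b" by simp
      then have "x = a" using d by simp
      then show False using less \<open>x = b\<close> by simp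
    qed
  qed (use H in simp)
qed

text \<open>The lower Ahlfors bound is stated for radii not exceeding some distance in the space; this
  covers the bounded case without mentioning the diameter.\<close>

locale poincare_space = regular_doubling_measure \<mu> A
  for \<mu> :: "'a::metric_space measure" and A :: real +
  fixes \<alpha> \<kappa> p C\<^sub>p C\<^sub>0 :: real
  assumes p: "1 \<le> p" "p < \<alpha>" and \<kappa>: "1 \<le> \<kappa>" and Cp: "1 \<le> C\<^sub>p" and C0: "1 \<le> C\<^sub>0"
    and connected_UNIV: "connected (UNIV :: 'a set)"
    and nontrivial: "\<exists>x y :: 'a. x \<noteq> y"
    and ahlfors_upper: "0 < r \<Longrightarrow> measure \<mu> (ball x r) \<le> \<kappa> * r powr \<alpha>"
    and ahlfors_lower: "0 < r \<Longrightarrow> r \<le> dist x y \<Longrightarrow> r powr \<alpha> \<le> \<kappa> * measure \<mu> (ball z r)"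
    and poincare: "0 < r \<Longrightarrow> 0 < \<delta> \<Longrightarrow> u \<in> borel_measurable borel \<Longrightarrow> bounded (u ` ball x (C\<^sub>0 * r)) \<Longrightarrow>
       \<Lambda> \<in> borel_measurable borel \<Longrightarrow> (\<And>y. 0 \<le> \<Lambda> y) \<Longrightarrow>
       (\<And>y y'. dist y y' < \<delta> \<Longrightarrow> \<bar>u y - u y'\<bar> \<le> \<Lambda> y * dist y y') \<Longrightarrow>
       ennreal (average \<mu> (ball x r) (\<lambda>y. \<bar>u y - average \<mu> (ball x r) u\<bar>) powr p * measure \<mu> (ball x (C\<^sub>0 * r)))
        \<le> ennreal ((2 * C\<^sub>p * r) powr p) * (\<integral>\<^sup>+ y\<in>ball x (C\<^sub>0 * r). ennreal (\<Lambda> y powr p) \<partial>\<mu>)"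
begin

text \<open>In a connected space the radius \<open>r\<close> is attained as a distance from \<open>x\<close>, unless the whole space
  lies within \<open>r\<close> of \<open>x\<close>; then any point at more than half the maximal distance does. Every ball
  thus has a witness \<open>b\<close> whose distance controls the ball, also when its radius exceeds the
  diameter of the space.\<close>

lemma nearby_point:
  fixes x :: 'a
  assumes r: "0 < r"
  obtains b where "b \<noteq> x" "dist x b \<le> r" "\<And>K a. 1 \<le> K \<Longrightarrow> dist x a \<le> K * r \<Longrightarrow> dist x a \<le> 2 * K * dist x b"
proof (cases "\<exists>y. r \<le> dist x y")
  case True
  then obtain y where y: "r \<le> dist x y" by blast
  have "connected (dist x ` UNIV)" by (intro connected_continuous_image connected_UNIV continuous_intros)
  moreover have "dist x x \<in> dist x ` UNIV" "dist x y \<in> dist x ` UNIV" by blast+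
  ultimately have "r \<in> dist x ` UNIV" using connectedD_interval[of "dist x ` UNIV" "dist x x" "dist x y" r] y r by simp
  then obtain b where b: "dist x b = r" by auto
  show ?thesis
  proof (rule that[of b])
    show "dist x a \<le> 2 * K * dist x b" if "1 \<le> K" "dist x a \<le> K * r" for K a
      unfolding b using that r mult_nonneg_nonneg[of K r] by linarith
  qed (use b r in auto)
next
  case False
  define S where "S = (SUP y. dist x y)"
  have bdd: "bdd_above (range (dist x))" using False by (intro bdd_aboveI[of _ r]) (auto simp: not_le less_imp_le)
  have le: "dist x y \<le> S" for y unfolding S_def by (rule cSUP_upper[OF UNIV_I bdd])
  obtain y where "y \<noteq> x" using nontrivial by metis
  then have "0 < S" using le[of y] by (metis dual_order.strict_trans1 zero_less_dist_iff)
  then have "S / 2 < (SUP y. dist x y)" by (simp add: S_def[symmetric])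
  then obtain b where b: "S / 2 < dist x b" using bdd by (subst (asm) less_cSUP_iff) auto
  show ?thesis
  proof (rule that[of b])
    show "b \<noteq> x" using b \<open>0 < S\<close> by auto
    show "dist x b \<le> r" using False by (auto simp: not_le less_imp_le)
    fix K a assume K: "(1::real) \<le> K"
    have "dist x a \<le> 2 * dist x b" using le[of a] b by simp
    also have "\<dots> \<le> 2 * K * dist x b" using K by (intro mult_right_mono) auto
    finally show "dist x a \<le> 2 * K * dist x b" .
  qed
qed

end

locale qs_map = poincare_space \<mu> A \<alpha> \<kappa> p C\<^sub>p C\<^sub>0
  for \<mu> :: "'a::metric_space measure" and A \<alpha> \<kappa> p C\<^sub>p C\<^sub>0 +
  fixes f g :: "'a \<Rightarrow> 'a"
  assumes homeo: "homeomorphism UNIV UNIV f g" and qs: "qs_control f"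
begin

lemma fg: "f (g x) = x" and gf: "g (f x) = x"
  using homeo by (auto simp: homeomorphism_def)

lemma f_continuous: "continuous_on UNIV f" and g_continuous: "continuous_on UNIV g"
  using homeo by (auto simp: homeomorphism_def)

lemma f_measurable [measurable]: "f \<in> borel_measurable borel" and g_measurable [measurable]: "g \<in> borel_measurable borel"
  by (rule borel_measurable_continuous_onI[OF f_continuous], rule borel_measurable_continuous_onI[OF g_continuous])

lemma image_eq_vimage: "f ` E = g -` E"
  using fg gf by (auto simp: image_iff) (metis)

definition \<nu> :: "'a measure" where "\<nu> = distr \<mu> borel g"

lemma sets_\<nu> [measurable_cong, simp]: "sets \<nu> = sets borel" by (simp add: \<nu>_def)

lemma emeasure_\<nu>: "E \<in> sets borel \<Longrightarrow> emeasure \<nu> E = emeasure \<mu> (f ` E)"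
  unfolding \<nu>_def image_eq_vimage by (subst emeasure_distr) auto

lemma measure_\<nu>: "E \<in> sets borel \<Longrightarrow> measure \<nu> E = measure \<mu> (f ` E)"
  by (simp add: measure_def emeasure_\<nu>)

lemma image_measurable: "E \<in> sets borel \<Longrightarrow> f ` E \<in> sets borel"
  unfolding image_eq_vimage using measurable_sets[OF g_measurable, of E] by simp

lemma qs_bound:
  assumes "0 \<le> \<theta>"
  obtains H where "0 \<le> H" "\<And>x a b. dist x a \<le> \<theta> * dist x b \<Longrightarrow> dist (f x) (f a) \<le> H * dist (f x) (f b)"
  using qs assms unfolding qs_control_def by metis

lemma qs_small:
  assumes "0 < \<delta>"
  obtains \<theta> where "0 < \<theta>" "\<And>x a b. dist x a \<le> \<theta> * dist x b \<Longrightarrow> dist (f x) (f a) \<le> \<delta> * dist (f x) (f b)"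
  using qs assms unfolding qs_control_def by metis

lemma image_bounded:
  obtains D where "0 \<le> D" "f ` cball x r \<subseteq> cball (f x) D"
proof -
  obtain H where H: "0 \<le> H" "\<And>x a b. dist x a \<le> 2 * dist x b \<Longrightarrow> dist (f x) (f a) \<le> H * dist (f x) (f b)"
    by (rule qs_bound[of 2]) auto
  obtain b where b: "\<And>K a. 1 \<le> K \<Longrightarrow> dist x a \<le> K * (\<bar>r\<bar> + 1) \<Longrightarrow> dist x a \<le> 2 * K * dist x b"
    by (rule nearby_point[of "\<bar>r\<bar> + 1" x]) auto
  show ?thesis
  proof (rule that[of "H * dist (f x) (f b)"])
    show "f ` cball x r \<subseteq> cball (f x) (H * dist (f x) (f b))"
    proof (rule image_subsetI)
      fix a assume "a \<in> cball x r"
      then have "dist x a \<le> 1 * (\<bar>r\<bar> + 1)" by simp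
      from H(2)[of x a b] b[OF _ this] show "f a \<in> cball (f x) (H * dist (f x) (f b))" by simp
    qed
  qed (use H in simp)
qed

lemma emeasure_\<nu>_bounded_finite: "E \<subseteq> cball x r \<Longrightarrow> E \<in> sets borel \<Longrightarrow> emeasure \<nu> E < \<infinity>"
proof -
  assume E: "E \<subseteq> cball x r" "E \<in> sets borel"
  obtain D where "f ` cball x r \<subseteq> cball (f x) D" by (rule image_bounded)
  then have "f ` E \<subseteq> cball (f x) D" using E by blast
  then show ?thesis using E emeasure_bounded_finite[of "f ` E" "f x" D] by (simp add: emeasure_\<nu>)
qed

text \<open>With \<open>b\<close> near \<open>x\<close> as above and \<open>R = d(f x, f b)\<close>, quasisymmetry bounds \<open>d(f x, f a)\<close> by a
  multiple of \<open>R\<close> and puts a ball around \<open>f x\<close> of radius comparable with \<open>R\<close> into \<open>f(B(x,r))\<close>.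
  The lower Ahlfors bound applies to this ball.\<close>

lemma image_dist_le:
  assumes K: "1 \<le> K"
  shows "\<exists>C\<ge>1. \<forall>x r a. 0 < r \<longrightarrow> dist x a \<le> K * r \<longrightarrow> dist (f x) (f a) powr \<alpha> \<le> C * measure \<nu> (ball x r)"
proof -
  obtain H where H: "0 \<le> H" "\<And>x a b. dist x a \<le> 4 * K * dist x b \<Longrightarrow> dist (f x) (f a) \<le> H * dist (f x) (f b)"
    by (rule qs_bound[of "4 * K"]) (use K in auto)
  obtain H1 where H1: "0 \<le> H1" "\<And>x a b. dist x a \<le> 1 * dist x b \<Longrightarrow> dist (f x) (f a) \<le> H1 * dist (f x) (f b)"
    by (rule qs_bound[of 1]) auto
  define C where "C = (H * (H1 + 1)) powr \<alpha> * \<kappa>"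
  show ?thesis
  proof (intro exI[of _ "max 1 C"] conjI allI impI)
    fix x a :: 'a and r :: real assume r: "0 < r" and a: "dist x a \<le> K * r"
    obtain b where b: "b \<noteq> x" "dist x b \<le> r / 2" "\<And>K a. 1 \<le> K \<Longrightarrow> dist x a \<le> K * (r / 2) \<Longrightarrow> dist x a \<le> 2 * K * dist x b"
      using nearby_point[of "r / 2" x] r by (metis half_gt_zero)
    define R where "R = dist (f x) (f b)"
    have R: "0 < R" using b(1) gf by (metis R_def zero_less_dist_iff)
    have "dist x a \<le> 2 * (2 * K) * dist x b" using a K by (intro b(3)) auto
    then have d: "dist (f x) (f a) \<le> H * R" unfolding R_def by (intro H(2)) simp
    define R' where "R' = R / (H1 + 1)"
    have R': "0 < R'" "R' \<le> R" "R = (H1 + 1) * R'" using R H1 by (auto simp: R'_def field_simps)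
    have "ball (f x) R' \<subseteq> f ` ball x r"
    proof
      fix w assume w: "w \<in> ball (f x) R'"
      have "dist x (g w) < r"
      proof (rule ccontr)
        assume "\<not> dist x (g w) < r"
        then have "dist x b \<le> 1 * dist x (g w)" using b(2) r by simp
        then have "R \<le> H1 * dist (f x) w" unfolding R_def using H1(2)[of x b "g w"] by (simp add: fg)
        also have "\<dots> \<le> H1 * R'" using w H1 by (intro mult_left_mono) auto
        finally show False using R' by (simp add: algebra_simps)
      qed
      then show "w \<in> f ` ball x r" using fg by (metis imageI mem_ball)
    qed
    moreover obtain D where "f ` cball x r \<subseteq> cball (f x) D" by (rule image_bounded)
    then have "f ` ball x r \<subseteq> cball (f x) D" by force
    ultimately have "measure \<mu> (ball (f x) R') \<le> measure \<nu> (ball x r)"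
      unfolding measure_\<nu>[OF borel_open[OF open_ball]]
      by (intro measure_mono_bounded) (auto intro: image_measurable)
    moreover have "R' powr \<alpha> \<le> \<kappa> * measure \<mu> (ball (f x) R')"
      using R' by (intro ahlfors_lower[of R' "f x" "f b"]) (auto simp: R_def)
    ultimately have le: "R' powr \<alpha> \<le> \<kappa> * measure \<nu> (ball x r)"
      using \<kappa> by (meson mult_left_mono order_trans zero_le_one)
    have "dist (f x) (f a) powr \<alpha> \<le> (H * (H1 + 1) * R') powr \<alpha>"
      using d R' p by (intro powr_mono2) (auto simp: mult_ac)
    also have "\<dots> = (H * (H1 + 1)) powr \<alpha> * R' powr \<alpha>" by (rule powr_mult)
    also have "\<dots> \<le> (H * (H1 + 1)) powr \<alpha> * (\<kappa> * measure \<nu> (ball x r))" using le by (intro mult_left_mono) auto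
    also have "\<dots> = C * measure \<nu> (ball x r)" by (simp add: C_def)
    also have "\<dots> \<le> max 1 C * measure \<nu> (ball x r)" by (intro mult_right_mono) auto
    finally show "dist (f x) (f a) powr \<alpha> \<le> max 1 C * measure \<nu> (ball x r)" .
  qed simp
qed

lemma measure_\<nu>_le_image_dist:
  "\<exists>C\<ge>1. \<forall>x b \<rho>. x \<noteq> b \<longrightarrow> \<rho> \<le> 4 * dist x b \<longrightarrow> measure \<nu> (cball x \<rho>) \<le> C * dist (f x) (f b) powr \<alpha>"
proof -
  obtain H where H: "0 \<le> H" "\<And>x a b. dist x a \<le> 4 * dist x b \<Longrightarrow> dist (f x) (f a) \<le> H * dist (f x) (f b)"
    by (rule qs_bound[of 4]) auto
  show ?thesis
  proof (intro exI[of _ "\<kappa> * (H + 1) powr \<alpha>"] conjI allI impI)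
    have "1 \<le> (H + 1) powr \<alpha>" using H p by (intro ge_one_powr_ge_zero) auto
    then show "1 \<le> \<kappa> * (H + 1) powr \<alpha>" using \<kappa> by (metis mult_ge1_I)
    fix x b :: 'a and \<rho> :: real assume xb: "x \<noteq> b" and \<rho>: "\<rho> \<le> 4 * dist x b"
    define R where "R = dist (f x) (f b)"
    have R: "0 < R" using xb gf by (metis R_def zero_less_dist_iff)
    have "f ` cball x \<rho> \<subseteq> ball (f x) ((H + 1) * R)"
    proof (rule image_subsetI)
      fix z assume "z \<in> cball x \<rho>"
      then have "dist (f x) (f z) \<le> H * R" unfolding R_def using \<rho> by (intro H(2)) simp
      then show "f z \<in> ball (f x) ((H + 1) * R)" using R by (simp add: algebra_simps)
    qed
    then have "measure \<nu> (cball x \<rho>) \<le> measure \<mu> (ball (f x) ((H + 1) * R))"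
      unfolding measure_\<nu>[OF borel_closed[OF closed_cball]]
      by (rule measure_mono_bounded[OF _ ball_subset_cball]) (auto intro: image_measurable)
    also have "\<dots> \<le> \<kappa> * ((H + 1) * R) powr \<alpha>" using H R by (intro ahlfors_upper) auto
    also have "\<dots> = \<kappa> * (H + 1) powr \<alpha> * R powr \<alpha>" using H R by (simp add: powr_mult)
    finally show "measure \<nu> (cball x \<rho>) \<le> \<kappa> * (H + 1) powr \<alpha> * dist (f x) (f b) powr \<alpha>" by (simp add: R_def)
  qed
qed

text \<open>The image of \<open>B(x,2r)\<close> lies in a ball whose radius is controlled by \<open>\<nu>(B(x,r)) powr (1/\<alpha>)\<close>;
  the upper Ahlfors bound applies to it.\<close>

lemma \<nu>_doubling: "\<exists>A'. doubling_measure \<nu> A'"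
proof -
  obtain C where C: "1 \<le> C" and le: "\<And>x r a. 0 < r \<Longrightarrow> dist x a \<le> 2 * r \<Longrightarrow> dist (f x) (f a) powr \<alpha> \<le> C * measure \<nu> (ball x r)"
    using image_dist_le[of 2] by auto
  have pos: "0 < emeasure \<nu> (ball x r)" if r: "0 < r" for x r
  proof -
    have "open (f ` ball x r)" unfolding image_eq_vimage using g_continuous by (intro open_vimage) auto
    moreover have "f x \<in> f ` ball x r" using r by simp
    ultimately obtain e where e: "0 < e" "ball (f x) e \<subseteq> f ` ball x r" by (meson open_contains_ball)
    have "0 < emeasure \<mu> (ball (f x) e)" using e by (intro emeasure_ball_pos)
    also have "\<dots> \<le> emeasure \<mu> (f ` ball x r)" using e by (intro emeasure_mono) (auto intro: image_measurable)
    finally show ?thesis by (simp add: emeasure_\<nu>)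
  qed
  have fin: "emeasure \<nu> (ball x r) < \<infinity>" for x r by (rule emeasure_\<nu>_bounded_finite[of _ x r]) auto
  have "measure \<nu> (ball x (2 * r)) \<le> \<kappa> * 2 powr \<alpha> * C * measure \<nu> (ball x r)" if r: "0 < r" for x r
  proof -
    define T where "T = (C * measure \<nu> (ball x r)) powr (1 / \<alpha>)"
    have m: "0 < measure \<nu> (ball x r)" using pos[OF r, of x] fin[of x r] by (simp add: measure_def enn2real_positive_iff)
    then have T: "0 < T" "T powr \<alpha> = C * measure \<nu> (ball x r)" using C p by (auto simp: T_def powr_powr)
    have "f ` ball x (2 * r) \<subseteq> ball (f x) (2 * T)"
    proof (rule image_subsetI)
      fix a assume "a \<in> ball x (2 * r)"
      then have "dist (f x) (f a) powr \<alpha> \<le> T powr \<alpha>" unfolding T(2) using r by (intro le) auto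
      then have "dist (f x) (f a) \<le> T" using powr_less_mono2[of \<alpha> T "dist (f x) (f a)"] T p by force
      then show "f a \<in> ball (f x) (2 * T)" using T by simp
    qed
    then have "measure \<nu> (ball x (2 * r)) \<le> measure \<mu> (ball (f x) (2 * T))"
      unfolding measure_\<nu>[OF borel_open[OF open_ball]]
      by (rule measure_mono_bounded[OF _ ball_subset_cball]) (auto intro: image_measurable)
    also have "\<dots> \<le> \<kappa> * (2 * T) powr \<alpha>" using T by (intro ahlfors_upper) auto
    also have "\<dots> = \<kappa> * 2 powr \<alpha> * C * measure \<nu> (ball x r)" using T by (simp add: powr_mult)
    finally show ?thesis .
  qed
  then show ?thesis using pos fin by (intro exI[of _ "\<kappa> * 2 powr \<alpha> * C"] doubling_measure.intro) auto
qed

end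

section \<open>The reverse Hoelder inequality for the pullback measure\<close>

lemma cball_in_borel [measurable]: "cball x r \<in> sets borel"
  and ball_in_borel [measurable]: "ball x r \<in> sets borel"
  by simp_all

context qs_map begin

text \<open>The function \<open>u y = d(f y, f x\<^sub>0)\<close> is small near \<open>x\<^sub>0\<close> and about \<open>R = d(f x\<^sub>0, f b)\<close> near \<open>b\<close>,
  so its mean oscillation over the ball is at least a multiple of \<open>R\<close>. This survives smoothing
  at a scale \<open>e\<close> that is small against \<open>d(x\<^sub>0,b)\<close>. The Poincare inequality is applied to the
  smoothed function, whose local Lipschitz constant at \<open>y\<close> is at most a multiple of
  \<open>(ratio e y) powr (1/\<alpha>)\<close>.\<close>

lemma Poincare_for_image_distance:
  assumes pair: "doubling_pair \<mu> \<nu> A A'"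
  shows "\<exists>C\<ge>0. \<exists>c>0. c \<le> 1 \<and> (\<forall>x\<^sub>0 b e. x\<^sub>0 \<noteq> b \<longrightarrow> 0 < e \<longrightarrow> e \<le> c * dist x\<^sub>0 b \<longrightarrow>
    ennreal (dist (f x\<^sub>0) (f b) powr p * measure \<mu> (ball x\<^sub>0 (C\<^sub>0 * (2 * dist x\<^sub>0 b)))) \<le>
    ennreal (C * (2 * dist x\<^sub>0 b) powr p) *
      (\<integral>\<^sup>+y. ennreal (doubling_pair.ratio \<mu> \<nu> e y powr (p / \<alpha>)) * indicator (ball x\<^sub>0 (C\<^sub>0 * (2 * dist x\<^sub>0 b))) y \<partial>\<mu>))"
proof -
  interpret P: doubling_pair \<mu> \<nu> A A' by (rule pair)
  have \<alpha>: "0 < \<alpha>" using p by simp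
  obtain C1 where C1: "1 \<le> C1" and L1: "\<And>x r a. 0 < r \<Longrightarrow> dist x a \<le> 2 * r \<Longrightarrow> dist (f x) (f a) powr \<alpha> \<le> C1 * measure \<nu> (ball x r)"
    using image_dist_le[of 2] by auto
  obtain CS where CS: "1 \<le> CS" and smooth: "\<And>u::'a \<Rightarrow> real. \<And>\<epsilon>. 0 < \<epsilon> \<Longrightarrow> u \<in> borel_measurable borel \<Longrightarrow> (\<forall>x r. bounded (u ` cball x r)) \<Longrightarrow>
     (\<exists>v. continuous_on UNIV v \<and> (\<forall>y T. (\<forall>z\<in>cball y (2 * \<epsilon>). \<bar>u z - u y\<bar> \<le> T) \<longrightarrow>
        \<bar>v y - u y\<bar> \<le> T \<and> (\<forall>y'. dist y y' \<le> \<epsilon> \<longrightarrow> \<bar>v y - v y'\<bar> \<le> CS * T / \<epsilon> * dist y y')))"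
    using Lipschitz_smoothing by blast
  obtain \<theta>\<^sub>0 where \<theta>\<^sub>0: "0 < \<theta>\<^sub>0" and small0: "\<And>x a b. dist x a \<le> \<theta>\<^sub>0 * dist x b \<Longrightarrow> dist (f x) (f a) \<le> 1 / 16 * dist (f x) (f b)"
    by (rule qs_small[of "1 / 16"]) auto
  define \<theta> where "\<theta> = min \<theta>\<^sub>0 1"
  have \<theta>: "0 < \<theta>" "\<theta> \<le> 1" using \<theta>\<^sub>0 by (auto simp: \<theta>_def)
  have small: "dist (f x) (f a) \<le> 1 / 16 * dist (f x) (f b)" if "dist x a \<le> \<theta> * dist x b" for x a b
  proof (rule small0)
    have "\<theta> * dist x b \<le> \<theta>\<^sub>0 * dist x b" by (intro mult_right_mono) (auto simp: \<theta>_def)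
    then show "dist x a \<le> \<theta>\<^sub>0 * dist x b" using that by simp
  qed
  obtain C\<mu> where C\<mu>: "1 \<le> C\<mu>" and comp\<mu>: "\<And>x y r r'. 0 < r \<Longrightarrow> r' \<le> 4 / \<theta> * r \<Longrightarrow> dist x y \<le> 4 / \<theta> * r \<Longrightarrow>
      measure \<mu> (cball y r') \<le> C\<mu> * measure \<mu> (ball x r)"
    using ball_comparison[of "4 / \<theta>"] by blast
  define CL where "CL = CS * 2 * (C1 * \<kappa>) powr (1 / \<alpha>)"
  have CL: "0 \<le> CL" using CS by (simp add: CL_def)
  define C where "C = (4 * C\<mu> * C\<^sub>p * CL * 2) powr p"
  show ?thesis
  proof (rule exI[of _ C], rule conjI, simp add: C_def, rule exI[of _ "\<theta> / 4"], intro conjI allI impI)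
    show "0 < \<theta> / 4" "\<theta> / 4 \<le> 1" using \<theta> by auto
    fix x\<^sub>0 b :: 'a and e :: real
    assume ne: "x\<^sub>0 \<noteq> b" and e: "0 < e" "e \<le> \<theta> / 4 * dist x\<^sub>0 b"
    define \<rho> where "\<rho> = dist x\<^sub>0 b"
    define r where "r = 2 * \<rho>"
    define R where "R = dist (f x\<^sub>0) (f b)"
    have \<rho>: "0 < \<rho>" "0 < r" using ne by (auto simp: \<rho>_def r_def)
    have R: "0 < R" using ne gf by (metis R_def zero_less_dist_iff)
    define u where "u y = dist (f y) (f x\<^sub>0)" for y
    have um: "u \<in> borel_measurable borel" unfolding u_def
      by (intro borel_measurable_continuous_onI continuous_intros f_continuous)
    have ub: "bounded (u ` cball x r)" for x r
    proof -
      obtain D where "f ` cball x r \<subseteq> cball (f x) D" by (rule image_bounded)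
      then have "\<bar>u z\<bar> \<le> D + dist (f x) (f x\<^sub>0)" if "z \<in> cball x r" for z
        using that dist_triangle[of "f z" "f x\<^sub>0" "f x"] by (force simp: u_def dist_commute)
      then show ?thesis by (intro boundedI[of _ "D + dist (f x) (f x\<^sub>0)"]) auto
    qed
    obtain v where vc: "continuous_on UNIV v" and v: "\<And>y T. (\<forall>z\<in>cball y (2 * e). \<bar>u z - u y\<bar> \<le> T) \<Longrightarrow>
        \<bar>v y - u y\<bar> \<le> T \<and> (\<forall>y'. dist y y' \<le> e \<longrightarrow> \<bar>v y - v y'\<bar> \<le> CS * T / e * dist y y')"
      using smooth[OF e(1) um] ub by blast
    have vm: "v \<in> borel_measurable borel" using vc by (rule borel_measurable_continuous_onI)
    have lip: "\<bar>u z - u y\<bar> \<le> dist (f z) (f y)" for y z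
      using dist_triangle[of "f z" "f x\<^sub>0" "f y"] dist_triangle[of "f y" "f x\<^sub>0" "f z"] by (auto simp: u_def dist_commute)
    have e2: "2 * e \<le> \<theta> * \<rho> / 2" using e by (simp add: \<rho>_def)
    have near: "dist (f x\<^sub>0) (f z) \<le> R / 16" if "dist x\<^sub>0 z \<le> \<theta> * \<rho>" for z
      using small[of x\<^sub>0 z b] that by (simp add: \<rho>_def R_def)
    have far: "dist (f b) (f z) \<le> R / 16" if "dist b z \<le> \<theta> * \<rho>" for z
      using small[of b z x\<^sub>0] that by (simp add: \<rho>_def R_def dist_commute)
    have B1: "v y \<le> R / 4" if y: "y \<in> ball x\<^sub>0 (\<theta> * \<rho> / 2)" for y
    proof -
      have "u z \<le> R / 16" if "z \<in> cball y (2 * e)" for z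
        using near[of z] dist_triangle[of x\<^sub>0 z y] y that e2 by (auto simp: u_def dist_commute)
      moreover have "0 \<le> u z" for z by (simp add: u_def)
      moreover have "y \<in> cball y (2 * e)" using e by simp
      ultimately have uy: "u y \<le> R / 16" and uz: "\<forall>z\<in>cball y (2 * e). \<bar>u z - u y\<bar> \<le> R / 16"
        by (blast, smt (verit))
      have "\<bar>v y - u y\<bar> \<le> R / 16" using v[OF uz] by blast
      then show ?thesis using uy R by linarith
    qed
    have B2: "3 * R / 4 \<le> v y" if y: "y \<in> ball b (\<theta> * \<rho> / 2)" for y
    proof -
      have d: "dist (f b) (f z) \<le> R / 16" if "z \<in> cball y (2 * e)" for z
        using far[of z] dist_triangle[of b z y] y that e2 by auto
      have yy: "dist (f b) (f y) \<le> R / 16" using d[of y] e by simp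
      have "\<bar>u z - u y\<bar> \<le> R / 8" if "z \<in> cball y (2 * e)" for z
        using lip[of z y] d[OF that] yy dist_triangle[of "f z" "f y" "f b"] by (simp add: dist_commute)
      then have "\<bar>v y - u y\<bar> \<le> R / 8" using v by blast
      moreover have "R - R / 16 \<le> u y"
        using yy dist_triangle[of "f x\<^sub>0" "f b" "f y"] by (simp add: u_def R_def dist_commute)
      ultimately show ?thesis using R by linarith
    qed
    define B where "B = ball x\<^sub>0 r"
    define a where "a = average \<mu> B (\<lambda>y. \<bar>v y - average \<mu> B v\<bar>)"
    have vb: "bounded (v ` ball x\<^sub>0 s)" for s
    proof -
      obtain D where D: "\<And>z. z \<in> cball x\<^sub>0 (s + 2 * e) \<Longrightarrow> \<bar>u z\<bar> \<le> D"
        using ub[of x\<^sub>0 "s + 2 * e"] by (metis bounded_iff imageI real_norm_def)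
      have "\<bar>v y\<bar> \<le> 3 * D" if y: "y \<in> ball x\<^sub>0 s" for y
      proof -
        have "z \<in> cball x\<^sub>0 (s + 2 * e)" if "z \<in> cball y (2 * e)" for z
          using y that dist_triangle[of x\<^sub>0 z y] by simp
        then have "\<bar>u z\<bar> \<le> D" if "z \<in> cball y (2 * e)" for z using that D by blast
        moreover have "y \<in> cball y (2 * e)" using e by simp
        ultimately have uy: "\<bar>u y\<bar> \<le> D" and uz: "\<forall>z\<in>cball y (2 * e). \<bar>u z - u y\<bar> \<le> 2 * D"
          by (blast, smt (verit))
        have "\<bar>v y - u y\<bar> \<le> 2 * D" using v[OF uz] by blast
        then show ?thesis using uy by linarith
      qed
      then show ?thesis by (intro boundedI[of _ "3 * D"]) auto
    qed
    have lower: "R / (4 * C\<mu>) \<le> a"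
    proof -
      define m where "m = average \<mu> B v"
      have int: "integrable \<mu> (\<lambda>y. indicator B y * \<bar>v y - m\<bar>)"
      proof -
        obtain D where "\<And>y. y \<in> B \<Longrightarrow> \<bar>v y\<bar> \<le> D"
          using vb[of r] unfolding B_def by (metis bounded_iff imageI real_norm_def)
        then have bd: "norm (indicator B y * \<bar>v y - m\<bar>) \<le> norm (indicator B y * (D + \<bar>m\<bar>))" for y
          by (force simp: indicator_def)
        have "integrable \<mu> (\<lambda>y. indicator B y * (D + \<bar>m\<bar>))"
          by (intro integrable_mult_left integrable_real_indicator) (auto simp: B_def emeasure_ball)
        moreover have "(\<lambda>y. indicator B y * \<bar>v y - m\<bar>) \<in> borel_measurable \<mu>"
          using vm unfolding B_def by measurable
        ultimately show ?thesis
          using bd by (rule Bochner_Integration.integrable_bound[OF _ _ AE_I2])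
      qed
      have "\<exists>y. dist x\<^sub>0 y \<le> \<rho> \<and> (\<forall>z\<in>ball y (\<theta> * \<rho> / 2). R / 4 \<le> \<bar>v z - m\<bar>)"
      proof (cases "R / 2 \<le> m")
        case True
        have "\<forall>z\<in>ball x\<^sub>0 (\<theta> * \<rho> / 2). R / 4 \<le> \<bar>v z - m\<bar>"
        proof
          fix z assume "z \<in> ball x\<^sub>0 (\<theta> * \<rho> / 2)"
          from B1[OF this] True show "R / 4 \<le> \<bar>v z - m\<bar>" by linarith
        qed
        then show ?thesis using \<rho> by (intro exI[of _ x\<^sub>0]) auto
      next
        case False
        have "\<forall>z\<in>ball b (\<theta> * \<rho> / 2). R / 4 \<le> \<bar>v z - m\<bar>"
        proof
          fix z assume "z \<in> ball b (\<theta> * \<rho> / 2)"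
          from B2[OF this] False show "R / 4 \<le> \<bar>v z - m\<bar>" by linarith
        qed
        then show ?thesis by (intro exI[of _ b]) (auto simp: \<rho>_def)
      qed
      then obtain y where y: "dist x\<^sub>0 y \<le> \<rho>" "\<And>z. z \<in> ball y (\<theta> * \<rho> / 2) \<Longrightarrow> R / 4 \<le> \<bar>v z - m\<bar>" by blast
      define B' where "B' = ball y (\<theta> * \<rho> / 2)"
      have "B' \<subseteq> B"
      proof
        fix z assume "z \<in> B'"
        then have "dist x\<^sub>0 z < \<rho> + \<theta> * \<rho> / 2" using dist_triangle[of x\<^sub>0 z y] y(1) by (simp add: B'_def)
        moreover have "\<theta> * \<rho> \<le> 1 * \<rho>" using \<theta> \<rho> by (intro mult_right_mono) auto
        ultimately have "dist x\<^sub>0 z < 2 * \<rho>" using \<rho>(1) by linarith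
        then show "z \<in> B" by (simp add: B_def r_def)
      qed
      have "R / 4 * measure \<mu> B' = (\<integral>z. indicator B' z * (R / 4) \<partial>\<mu>)" by (simp add: B'_def)
      also have "\<dots> \<le> (\<integral>z. indicator B z * \<bar>v z - m\<bar> \<partial>\<mu>)"
      proof (rule integral_mono[OF _ int])
        show "integrable \<mu> (\<lambda>z. indicator B' z * (R / 4))"
          by (intro integrable_mult_left integrable_real_indicator) (auto simp: B'_def emeasure_ball)
        show "indicator B' z * (R / 4) \<le> indicator B z * \<bar>v z - m\<bar>" for z
          using y(2)[of z] \<open>B' \<subseteq> B\<close> by (auto simp: indicator_def B'_def)
      qed
      finally have 1: "R / 4 * measure \<mu> B' \<le> a * measure \<mu> B"
        using measure_ball_pos[OF \<rho>(2), of x\<^sub>0] by (simp add: a_def m_def average_def set_lebesgue_integral_def B_def)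
      have "measure \<mu> B \<le> measure \<mu> (cball x\<^sub>0 r)" unfolding B_def by (rule measure_ball_le_cball)
      also have "\<dots> \<le> C\<mu> * measure \<mu> B'"
        unfolding B'_def using \<theta> \<rho> y(1) by (intro comp\<mu>) (auto simp: r_def dist_commute)
      finally have 2: "measure \<mu> B \<le> C\<mu> * measure \<mu> B'" .
      have pos: "0 < measure \<mu> B'" "0 < measure \<mu> B" unfolding B'_def B_def using \<theta> \<rho> by (auto intro!: measure_ball_pos)
      have "0 < R / 4 * measure \<mu> B'" using R pos by simp
      also note 1
      finally have "0 \<le> a" using pos by (simp add: zero_less_mult_iff)
      then have "a * measure \<mu> B \<le> a * (C\<mu> * measure \<mu> B')" using 2 by (intro mult_left_mono)
      then have "R / 4 * measure \<mu> B' \<le> (a * C\<mu>) * measure \<mu> B'" using 1 by (simp add: mult.assoc)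
      then have "R / 4 \<le> a * C\<mu>" using pos by (simp only: mult_le_cancel_right_pos)
      then show ?thesis using C\<mu> by (simp add: field_simps)
    qed
    define \<Lambda> where "\<Lambda> y = CL * P.ratio e y powr (1 / \<alpha>)" for y
    have \<Lambda>m: "\<Lambda> \<in> borel_measurable borel" unfolding \<Lambda>_def by measurable
    have \<Lambda>0: "0 \<le> \<Lambda> y" for y using CL by (simp add: \<Lambda>_def)
    have vL: "\<bar>v y - v y'\<bar> \<le> \<Lambda> y * dist y y'" if "dist y y' < e" for y y'
    proof -
      define T where "T = (C1 * measure \<nu> (cball y e)) powr (1 / \<alpha>)"
      have T0: "0 \<le> T" by (simp add: T_def)
      have "\<bar>u z - u y\<bar> \<le> T" if "z \<in> cball y (2 * e)" for z
      proof -
        have "dist (f y) (f z) powr \<alpha> \<le> C1 * measure \<nu> (ball y e)" using that e by (intro L1) auto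
        also have "\<dots> \<le> C1 * measure \<nu> (cball y e)" using C1 P.\<nu>.measure_ball_le_cball by (intro mult_left_mono) auto
        finally have "(dist (f y) (f z) powr \<alpha>) powr (1 / \<alpha>) \<le> T" unfolding T_def using \<alpha> by (intro powr_mono2) auto
        then have "dist (f y) (f z) \<le> T" using \<alpha> by (simp add: powr_powr)
        then show ?thesis using lip[of z y] by (simp add: dist_commute)
      qed
      then have "\<bar>v y - v y'\<bar> \<le> CS * T / e * dist y y'" using v[of y T] that by auto
      also have "\<dots> \<le> \<Lambda> y * dist y y'"
      proof (intro mult_right_mono)
        have my: "0 < measure \<mu> (cball y e)" by (rule measure_cball_pos[OF e(1)])
        have "measure \<mu> (cball y e) \<le> measure \<mu> (ball y (2 * e))"
          using e by (intro measure_mono_bounded[OF _ ball_subset_cball]) auto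
        also have "\<dots> \<le> \<kappa> * (2 * e) powr \<alpha>" using e by (intro ahlfors_upper) auto
        finally have "P.ratio e y * measure \<mu> (cball y e) \<le> P.ratio e y * (\<kappa> * (2 * e) powr \<alpha>)"
          using P.ratio_nonneg by (intro mult_left_mono)
        then have "C1 * measure \<nu> (cball y e) \<le> C1 * (P.ratio e y * (\<kappa> * (2 * e) powr \<alpha>))"
          using my C1 by (intro mult_left_mono) (auto simp: P.ratio_def)
        then have "T \<le> (C1 * (P.ratio e y * (\<kappa> * (2 * e) powr \<alpha>))) powr (1 / \<alpha>)"
          unfolding T_def using \<alpha> C1 by (intro powr_mono2) auto
        also have "\<dots> = (C1 * \<kappa>) powr (1 / \<alpha>) * P.ratio e y powr (1 / \<alpha>) * (2 * e)"
          using \<alpha> e C1 \<kappa> P.ratio_nonneg[of e y] by (simp add: powr_mult powr_powr)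
        finally have "CS * T / e \<le> CS * ((C1 * \<kappa>) powr (1 / \<alpha>) * P.ratio e y powr (1 / \<alpha>) * (2 * e)) / e"
          using CS e by (intro divide_right_mono mult_left_mono) auto
        also have "\<dots> = \<Lambda> y" using e by (simp add: \<Lambda>_def CL_def)
        finally show "CS * T / e \<le> \<Lambda> y" .
      qed simp
      finally show ?thesis .
    qed
    define m0 where "m0 = measure \<mu> (ball x\<^sub>0 (C\<^sub>0 * r))"
    define I where "I = (\<integral>\<^sup>+y. ennreal (P.ratio e y powr (p / \<alpha>)) * indicator (ball x\<^sub>0 (C\<^sub>0 * r)) y \<partial>\<mu>)"
    have "(\<integral>\<^sup>+y\<in>ball x\<^sub>0 (C\<^sub>0 * r). ennreal (\<Lambda> y powr p) \<partial>\<mu>) =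
        (\<integral>\<^sup>+y. ennreal (CL powr p) * (ennreal (P.ratio e y powr (p / \<alpha>)) * indicator (ball x\<^sub>0 (C\<^sub>0 * r)) y) \<partial>\<mu>)"
      using CL P.ratio_nonneg
      by (intro nn_integral_cong) (simp add: \<Lambda>_def powr_mult powr_powr ennreal_mult mult.assoc)
    also have "\<dots> = ennreal (CL powr p) * I"
      unfolding I_def by (rule nn_integral_cmult) measurable
    finally have I: "(\<integral>\<^sup>+y\<in>ball x\<^sub>0 (C\<^sub>0 * r). ennreal (\<Lambda> y powr p) \<partial>\<mu>) = ennreal (CL powr p) * I" .
    have a: "ennreal (a powr p * m0) \<le> ennreal ((2 * C\<^sub>p * r) powr p) * (ennreal (CL powr p) * I)"
      using poincare[OF \<rho>(2) e(1) vm vb \<Lambda>m \<Lambda>0 vL] unfolding I by (simp add: a_def B_def m0_def)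
    have "R powr p * m0 \<le> (4 * C\<mu>) powr p * (a powr p * m0)"
    proof -
      have "R \<le> 4 * C\<mu> * a" using lower C\<mu> by (simp add: field_simps)
      then have "R powr p \<le> (4 * C\<mu> * a) powr p" using R p by (intro powr_mono2) auto
      also have "\<dots> = (4 * C\<mu>) powr p * a powr p" by (rule powr_mult)
      finally show ?thesis unfolding mult.assoc[symmetric] by (rule mult_right_mono) (simp add: m0_def)
    qed
    then have "ennreal (R powr p * m0) \<le> ennreal ((4 * C\<mu>) powr p) * ennreal (a powr p * m0)"
      by (simp add: ennreal_leI m0_def flip: ennreal_mult)
    also have "\<dots> \<le> ennreal ((4 * C\<mu>) powr p) * (ennreal ((2 * C\<^sub>p * r) powr p) * (ennreal (CL powr p) * I))"
      by (intro mult_left_mono a) simp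
    also have "\<dots> = ennreal ((4 * C\<mu>) powr p * (2 * C\<^sub>p * r) powr p * CL powr p) * I"
      by (simp add: ennreal_mult mult.assoc)
    also have "(4 * C\<mu>) powr p * (2 * C\<^sub>p * r) powr p * CL powr p = C * r powr p"
      unfolding C_def powr_mult[symmetric] by (simp add: mult_ac)
    finally show "ennreal (dist (f x\<^sub>0) (f b) powr p * measure \<mu> (ball x\<^sub>0 (C\<^sub>0 * (2 * dist x\<^sub>0 b)))) \<le>
      ennreal (C * (2 * dist x\<^sub>0 b) powr p) *
        (\<integral>\<^sup>+y. ennreal (P.ratio e y powr (p / \<alpha>)) * indicator (ball x\<^sub>0 (C\<^sub>0 * (2 * dist x\<^sub>0 b))) y \<partial>\<mu>)"
      by (simp add: R_def m0_def I_def r_def \<rho>_def)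
  qed
qed

text \<open>If \<open>e\<close> is small against the ball, combine the preceding lemma with the comparisons
  \<open>\<nu>(B) \<le> C R^\<alpha>\<close> and \<open>\<rho>^\<alpha> \<le> C \<mu>(B)\<close>. Otherwise \<open>e\<close> is comparable with the ball, and doubling of
  both measures gives the bound pointwise.\<close>

lemma reverse_Holder_inequality:
  assumes pair: "doubling_pair \<mu> \<nu> A A'"
  shows "\<exists>C\<ge>1. \<forall>e r x. 0 < e \<longrightarrow> e \<le> r \<longrightarrow>
    ennreal (doubling_pair.ratio \<mu> \<nu> r x powr (p / \<alpha>) * measure \<mu> (cball x r)) \<le>
    ennreal C * (\<integral>\<^sup>+y. ennreal (doubling_pair.ratio \<mu> \<nu> e y powr (p / \<alpha>)) * indicator (cball x (C\<^sub>0 * r)) y \<partial>\<mu>)"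
proof -
  interpret P: doubling_pair \<mu> \<nu> A A' by (rule pair)
  define s where "s = p / \<alpha>"
  have s: "0 < s" "\<alpha> * s = p" using p by (auto simp: s_def)
  obtain CP c where CP: "0 \<le> CP" and c: "0 < c" "c \<le> 1" and core: "\<And>x\<^sub>0 b e. x\<^sub>0 \<noteq> b \<Longrightarrow> 0 < e \<Longrightarrow> e \<le> c * dist x\<^sub>0 b \<Longrightarrow>
    ennreal (dist (f x\<^sub>0) (f b) powr p * measure \<mu> (ball x\<^sub>0 (C\<^sub>0 * (2 * dist x\<^sub>0 b)))) \<le>
    ennreal (CP * (2 * dist x\<^sub>0 b) powr p) *
      (\<integral>\<^sup>+y. ennreal (P.ratio e y powr (p / \<alpha>)) * indicator (ball x\<^sub>0 (C\<^sub>0 * (2 * dist x\<^sub>0 b))) y \<partial>\<mu>)"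
    using Poincare_for_image_distance[OF pair] by blast
  obtain C2 where C2: "1 \<le> C2" and L2: "\<And>x b \<rho>. x \<noteq> b \<Longrightarrow> \<rho> \<le> 4 * dist x b \<Longrightarrow> measure \<nu> (cball x \<rho>) \<le> C2 * dist (f x) (f b) powr \<alpha>"
    using measure_\<nu>_le_image_dist by blast
  obtain C3 where C3: "1 \<le> C3" and comp\<mu>: "\<And>x y r r'. 0 < r \<Longrightarrow> r' \<le> 2 * r \<Longrightarrow> dist x y \<le> 2 * r \<Longrightarrow>
      measure \<mu> (cball y r') \<le> C3 * measure \<mu> (ball x r)"
    using ball_comparison[of 2] by blast
  obtain C4 where C4: "1 \<le> C4" and comp\<nu>: "\<And>x y r r'. 0 < r \<Longrightarrow> r' \<le> 4 / c * r \<Longrightarrow> dist x y \<le> 4 / c * r \<Longrightarrow>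
      measure \<nu> (cball y r') \<le> C4 * measure \<nu> (ball x r)"
    using P.\<nu>.ball_comparison[of "4 / c"] by blast
  define D1 where "D1 = (C2 * \<kappa>) powr s * C3 * (CP * 2 powr p)"
  define D2 where "D2 = (C4 * C3) powr s"
  have D: "0 \<le> D1" "0 \<le> D2" using C3 CP by (auto simp: D1_def D2_def)
  show ?thesis
  proof (intro exI[of _ "max 1 (max D1 D2)"] conjI allI impI)
    fix e r :: real and x :: 'a
    assume e: "0 < e" "e \<le> r"
    have r: "0 < r" using e by simp
    define I where "I = (\<integral>\<^sup>+y. ennreal (P.ratio e y powr s) * indicator (cball x (C\<^sub>0 * r)) y \<partial>\<mu>)"
    obtain b where b: "b \<noteq> x" "dist x b \<le> r / 2" "\<And>K a. 1 \<le> K \<Longrightarrow> dist x a \<le> K * (r / 2) \<Longrightarrow> dist x a \<le> 2 * K * dist x b"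
      using nearby_point[of "r / 2" x] r by (metis half_gt_zero)
    define \<rho> where "\<rho> = dist x b"
    define R where "R = dist (f x) (f b)"
    have \<rho>: "0 < \<rho>" "2 * \<rho> \<le> r" using b by (auto simp: \<rho>_def)
    have sub: "cball x r \<subseteq> cball x (4 * \<rho>)"
      using b(3)[of 2] by (auto simp: \<rho>_def)
    have mr: "0 < measure \<mu> (cball x r)" by (rule measure_cball_pos[OF r])
    have "ennreal (P.ratio r x powr s * measure \<mu> (cball x r)) \<le> ennreal (max D1 D2) * I"
    proof (cases "e \<le> c * \<rho>")
      case True
      define m where "m = measure \<mu> (ball x (C\<^sub>0 * (2 * \<rho>)))"
      define J where "J = (\<integral>\<^sup>+y. ennreal (P.ratio e y powr s) * indicator (ball x (C\<^sub>0 * (2 * \<rho>))) y \<partial>\<mu>)"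
      have CR: "C\<^sub>0 * (2 * \<rho>) \<le> C\<^sub>0 * r" using \<rho> C0 by (intro mult_left_mono) auto
      have JI: "J \<le> I"
        unfolding J_def I_def using CR by (intro nn_integral_mono mult_left_mono) (auto simp: indicator_def)
      have core': "ennreal (R powr p * m) \<le> ennreal (CP * (2 * \<rho>) powr p) * J"
        using core[of x b e] b(1) e(1) True by (simp add: R_def m_def J_def \<rho>_def s_def)
      have "measure \<nu> (cball x r) \<le> measure \<nu> (cball x (4 * \<rho>))"
        by (rule P.\<nu>.measure_mono_bounded[OF sub order_refl]) auto
      also have "\<dots> \<le> C2 * R powr \<alpha>" unfolding R_def using b(1) by (intro L2) (auto simp: \<rho>_def)
      finally have 1: "measure \<nu> (cball x r) \<le> C2 * R powr \<alpha>" .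
      have "\<rho> powr \<alpha> \<le> \<kappa> * measure \<mu> (ball x \<rho>)" using \<rho> by (intro ahlfors_lower[of \<rho> x b]) (auto simp: \<rho>_def)
      also have "\<dots> \<le> \<kappa> * measure \<mu> (cball x r)"
        using \<kappa> \<rho> by (intro mult_left_mono measure_mono_bounded[of _ _ x r]) auto
      finally have 2: "\<rho> powr \<alpha> \<le> \<kappa> * measure \<mu> (cball x r)" .
      have "P.ratio r x \<le> (C2 * R powr \<alpha>) / (\<rho> powr \<alpha> / \<kappa>)"
        unfolding P.ratio_def using 1 2 \<rho> \<kappa> C2 by (intro frac_le) (auto simp: field_simps)
      also have "\<dots> = C2 * \<kappa> * (R / \<rho>) powr \<alpha>" using \<rho> by (simp add: powr_divide R_def)
      finally have "P.ratio r x powr s \<le> (C2 * \<kappa> * (R / \<rho>) powr \<alpha>) powr s"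
        using s P.ratio_nonneg by (intro powr_mono2) auto
      also have "\<dots> = (C2 * \<kappa>) powr s * (R powr p / \<rho> powr p)"
        using s \<rho> by (simp add: powr_mult powr_powr powr_divide R_def)
      finally have 3: "P.ratio r x powr s \<le> (C2 * \<kappa>) powr s * (R powr p / \<rho> powr p)" .
      have "1 * (2 * \<rho>) \<le> C\<^sub>0 * (2 * \<rho>)" using C0 \<rho> by (intro mult_right_mono) auto
      then have "measure \<mu> (cball x (4 * \<rho>)) \<le> C3 * m"
        unfolding m_def using \<rho> C0 by (intro comp\<mu>) auto
      moreover have "measure \<mu> (cball x r) \<le> measure \<mu> (cball x (4 * \<rho>))"
        by (rule measure_mono_bounded[OF sub order_refl]) auto
      ultimately have 4: "measure \<mu> (cball x r) \<le> C3 * m" by simp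
      have "P.ratio r x powr s * measure \<mu> (cball x r) \<le> ((C2 * \<kappa>) powr s * (R powr p / \<rho> powr p)) * (C3 * m)"
        using 3 4 by (intro mult_mono) auto
      also have "\<dots> = ((C2 * \<kappa>) powr s * C3 / \<rho> powr p) * (R powr p * m)" by simp
      finally have "ennreal (P.ratio r x powr s * measure \<mu> (cball x r)) \<le>
          ennreal ((C2 * \<kappa>) powr s * C3 / \<rho> powr p) * ennreal (R powr p * m)"
        using C3 by (simp add: ennreal_leI m_def flip: ennreal_mult)
      also have "\<dots> \<le> ennreal ((C2 * \<kappa>) powr s * C3 / \<rho> powr p) * (ennreal (CP * (2 * \<rho>) powr p) * J)"
        by (intro mult_left_mono core') simp
      also have "\<dots> = ennreal ((C2 * \<kappa>) powr s * C3 / \<rho> powr p * (CP * (2 * \<rho>) powr p)) * J"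
        unfolding mult.assoc[symmetric]
        using C3 CP by (subst (1) ennreal_mult[symmetric]) (auto simp: mult.assoc)
      also have "(C2 * \<kappa>) powr s * C3 / \<rho> powr p * (CP * (2 * \<rho>) powr p) = D1"
        using \<rho> by (simp add: D1_def powr_mult)
      also have "ennreal D1 * J \<le> ennreal (max D1 D2) * I"
        by (intro mult_mono JI) (auto intro: ennreal_leI)
      finally show ?thesis .
    next
      case False
      have le: "P.ratio r x powr s \<le> D2 * P.ratio e y powr s" if y: "y \<in> cball x r" for y
      proof -
        have "\<rho> \<le> e / c" using False c by (simp add: field_simps)
        then have e4: "4 * \<rho> \<le> 4 / c * e" by (simp add: mult_left_mono)
        have "measure \<nu> (cball x r) \<le> measure \<nu> (cball x (4 * \<rho>))"
          by (rule P.\<nu>.measure_mono_bounded[OF sub order_refl]) auto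
        also have "\<dots> \<le> C4 * measure \<nu> (ball y e)"
          using e e4 y sub by (intro comp\<nu>) (auto simp: dist_commute subset_iff)
        also have "\<dots> \<le> C4 * measure \<nu> (cball y e)" using C4 P.\<nu>.measure_ball_le_cball by (intro mult_left_mono) auto
        finally have 1: "measure \<nu> (cball x r) \<le> C4 * measure \<nu> (cball y e)" .
        have "measure \<mu> (cball y e) \<le> C3 * measure \<mu> (ball x r)" using e y r by (intro comp\<mu>) auto
        also have "\<dots> \<le> C3 * measure \<mu> (cball x r)" using C3 measure_ball_le_cball by (intro mult_left_mono) auto
        finally have 2: "measure \<mu> (cball y e) \<le> C3 * measure \<mu> (cball x r)" .
        have my: "0 < measure \<mu> (cball y e)" by (rule measure_cball_pos[OF e(1)])
        have "P.ratio r x \<le> (C4 * measure \<nu> (cball y e)) / (measure \<mu> (cball y e) / C3)"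
          unfolding P.ratio_def using 1 2 my C3 C4 by (intro frac_le) (auto simp: field_simps)
        also have "\<dots> = C4 * C3 * P.ratio e y" by (simp add: P.ratio_def)
        finally have "P.ratio r x powr s \<le> (C4 * C3 * P.ratio e y) powr s"
          using s P.ratio_nonneg by (intro powr_mono2) auto
        then show ?thesis by (simp add: D2_def powr_mult)
      qed
      have rC: "cball x r \<subseteq> cball x (C\<^sub>0 * r)" using C0 r by (intro subset_cball) simp
      have "ennreal (P.ratio r x powr s * measure \<mu> (cball x r)) = (\<integral>\<^sup>+y. ennreal (P.ratio r x powr s) * indicator (cball x r) y \<partial>\<mu>)"
        by (subst nn_integral_cmult_indicator) (auto simp: emeasure_cball ennreal_mult)
      also have "\<dots> \<le> (\<integral>\<^sup>+y. ennreal D2 * (ennreal (P.ratio e y powr s) * indicator (cball x (C\<^sub>0 * r)) y) \<partial>\<mu>)"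
      proof (intro nn_integral_mono)
        fix y
        show "ennreal (P.ratio r x powr s) * indicator (cball x r) y \<le> ennreal D2 * (ennreal (P.ratio e y powr s) * indicator (cball x (C\<^sub>0 * r)) y)"
        proof (cases "y \<in> cball x r")
          case True
          then have "y \<in> cball x (C\<^sub>0 * r)" using rC by blast
          moreover have "ennreal (P.ratio r x powr s) \<le> ennreal D2 * ennreal (P.ratio e y powr s)"
            using le[OF True] D by (simp add: ennreal_leI flip: ennreal_mult)
          ultimately show ?thesis using True by simp
        qed simp
      qed
      also have "\<dots> = ennreal D2 * I" unfolding I_def by (rule nn_integral_cmult) measurable
      also have "\<dots> \<le> ennreal (max D1 D2) * I" by (intro mult_right_mono ennreal_leI) auto
      finally show ?thesis .
    qed
    also have "\<dots> \<le> ennreal (max 1 (max D1 D2)) * I" by (intro mult_right_mono ennreal_leI) auto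
    finally show "ennreal (P.ratio r x powr (p / \<alpha>) * measure \<mu> (cball x r)) \<le>
      ennreal (max 1 (max D1 D2)) * (\<integral>\<^sup>+y. ennreal (P.ratio e y powr (p / \<alpha>)) * indicator (cball x (C\<^sub>0 * r)) y \<partial>\<mu>)"
      by (simp add: I_def s_def)
  qed simp
qed

end

section \<open>Absolute continuity and the density of the pullback measure\<close>

locale regular_reverse_Holder_pair =
  reverse_Holder_pair \<mu> \<nu> A A' s C\<^sub>0 C\<^sub>R + regular_doubling_measure \<mu> A
  for \<mu> \<nu> :: "'a::metric_space measure" and A A' s C\<^sub>0 C\<^sub>R
begin

text \<open>A bounded \<open>\<mu>\<close>-null set has bounded open neighbourhoods \<open>U\<close> of small measure. The \<open>L log L\<close>
  bound makes the integrals of \<open>ratio e\<close> over \<open>U\<close> small uniformly in \<open>e\<close>, and they dominate \<open>\<nu>\<close>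
  of the points whose \<open>e\<close>-ball lies in \<open>U\<close>. These points exhaust \<open>U\<close> as \<open>e\<close> tends to 0.\<close>

lemma absolutely_continuous_\<mu>_\<nu>: "absolutely_continuous \<mu> \<nu>"
proof -
  define o' :: 'a where "o' = undefined"
  obtain C where C: "0 \<le> C" and LlogL: "\<And>x\<^sub>0 r\<^sub>0 e. 0 < e \<Longrightarrow> e \<le> r\<^sub>0 \<Longrightarrow>
    (\<integral>\<^sup>+y. ennreal (ratio e y * ln (max 1 (ratio e y / ratio r\<^sub>0 x\<^sub>0))) * indicator (cball x\<^sub>0 r\<^sub>0) y \<partial>\<mu>)
      \<le> ennreal (C * measure \<nu> (cball x\<^sub>0 r\<^sub>0))"
    using LlogL_estimate by blast
  obtain C1 where C1: "1 \<le> C1" and meas: "\<And>S U e. 0 < e \<Longrightarrow> S \<in> sets borel \<Longrightarrow> U \<in> sets borel \<Longrightarrow> (\<forall>y\<in>S. cball y e \<subseteq> U) \<Longrightarrow>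
     emeasure \<nu> S \<le> ennreal C1 * (\<integral>\<^sup>+y. ennreal (ratio e y) * indicator U y \<partial>\<mu>)"
    using measure_le_nn_integral_ratio by blast
  have ball_null: "emeasure \<nu> (E \<inter> ball o' (Suc N)) = 0" if E: "E \<in> null_sets \<mu>" for E and N :: nat
  proof -
    define r where "r = real (Suc N)"
    have r: "1 \<le> r" "0 < r" by (auto simp: r_def)
    define V where "V = measure \<nu> (cball o' r)"
    define q where "q = ratio r o'"
    have q: "0 < q" using \<mu>.measure_cball_pos[OF r(2), of o'] \<nu>.measure_cball_pos[OF r(2), of o'] by (simp add: q_def ratio_def)
    define S where "S = E \<inter> ball o' r"
    have [measurable]: "E \<in> sets borel" using E by auto
    have Sm[measurable]: "S \<in> sets borel" unfolding S_def by simp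
    have S0: "emeasure \<mu> S = 0" using null_sets_subset[of E \<mu> S] E by (auto simp: S_def)
    have bound: "emeasure \<nu> S \<le> ennreal (C1 * (1 + C * V) / Suc k)" for k :: nat
    proof -
      define M where "M = exp (real (Suc k))"
      \<comment> \<open>Below the threshold \<open>q * M\<close> the integral over \<open>U\<close> is at most \<open>q * M * \<delta> = 1 / Suc k\<close>;
          above it the factor \<open>ln M = Suc k\<close> is gained.\<close>
      define \<delta> where "\<delta> = 1 / (q * M * Suc k)"
      have \<delta>: "0 < \<delta>" using q by (simp add: \<delta>_def M_def)
      obtain U where U: "open U" "S \<subseteq> U" "U \<subseteq> ball o' r" "emeasure \<mu> (U - S) < ennreal \<delta>"
      proof (rule outer_approximation[of \<mu> o' r S "ennreal \<delta>"])
        show "absolutely_continuous \<mu> \<mu>" by (simp add: absolutely_continuous_def)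
      qed (use \<delta> r in \<open>auto simp: S_def \<mu>.emeasure_ball\<close>)
      have Um[measurable]: "U \<in> sets borel" using U(1) by simp
      have "emeasure \<mu> U = emeasure \<mu> S + emeasure \<mu> (U - S)"
        using U(2) plus_emeasure[of S \<mu> "U - S"] by (simp add: Un_absorb1)
      then have \<mu>U: "emeasure \<mu> U \<le> ennreal \<delta>" using U(4) S0 by simp
      \<comment> \<open>\<open>W n\<close> consists of the points whose open ball of radius \<open>1 / Suc n\<close> lies in \<open>U\<close>; in
          this form it is visibly closed.\<close>
      define W where "W n = - (\<Union>z\<in>-U. ball z (1 / Suc n))" for n
      have Wm: "W n \<in> sets borel" for n unfolding W_def by (intro borel_closed closed_Compl open_UN) auto
      have WU: "(\<Union>n. W n) = U"
      proof (intro equalityI subsetI)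
        fix x assume "x \<in> (\<Union>n. W n)"
        then obtain n where "x \<in> W n" by blast
        then have "x \<notin> - U" unfolding W_def by (auto dest!: bspec[of _ _ x])
        then show "x \<in> U" by simp
      next
        fix x assume "x \<in> U"
        then obtain e where e: "0 < e" "ball x e \<subseteq> U" using U(1) by (meson open_contains_ball)
        obtain n where n: "1 / real (Suc n) < e" using nat_approx_posE[OF e(1)] by metis
        have "x \<notin> ball z (1 / Suc n)" if "z \<notin> U" for z
        proof
          assume "x \<in> ball z (1 / Suc n)"
          then have "z \<in> ball x e" using n by (auto simp: dist_commute)
          then show False using e that by blast
        qed
        then have "x \<in> W n" by (auto simp: W_def)
        then show "x \<in> (\<Union>n. W n)" by blast
      qed
      have inc: "incseq W"
      proof (rule incseq_SucI)
        fix n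
        have "1 / real (Suc (Suc n)) \<le> 1 / real (Suc n)" by (intro divide_left_mono) auto
        then have "ball z (1 / Suc (Suc n)) \<subseteq> ball z (1 / Suc n)" for z :: 'a by (intro subset_ball)
        then show "W n \<subseteq> W (Suc n)" unfolding W_def by blast
      qed
      have Wb: "emeasure \<nu> (W n) \<le> ennreal (C1 * (1 + C * V) / Suc k)" for n
      proof -
        define e where "e = 1 / real (Suc (Suc n))"
        have "e \<le> 1" by (simp add: e_def)
        then have "e \<le> r" using r(1) by linarith
        moreover have "0 < e" "e < 1 / Suc n" by (auto simp: e_def field_simps)
        ultimately have e: "0 < e" "e \<le> r" "e < 1 / Suc n" by blast+
        have sub: "\<forall>y\<in>W n. cball y e \<subseteq> U"
        proof (intro ballI subsetI)
          fix y z assume y: "y \<in> W n" "z \<in> cball y e"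
          show "z \<in> U"
          proof (rule ccontr)
            assume "z \<notin> U"
            moreover have "y \<in> ball z (1 / Suc n)" using y(2) e by (simp add: dist_commute)
            ultimately show False using y(1) unfolding W_def by blast
          qed
        qed
        have pt: "ennreal (ratio e y) * indicator U y \<le> ennreal (q * M) * indicator U y +
            ennreal (1 / Suc k) * (ennreal (ratio e y * ln (max 1 (ratio e y / q))) * indicator (cball o' r) y)" for y
        proof (cases "y \<in> U")
          case True
          then have yB: "y \<in> cball o' r" using U(3) by auto
          have "ratio e y \<le> q * M + 1 / Suc k * (ratio e y * ln (max 1 (ratio e y / q)))"
          proof (cases "ratio e y \<le> q * M")
            case True
            have "0 \<le> 1 / Suc k * (ratio e y * ln (max 1 (ratio e y / q)))" using ratio_nonneg by simp
            then show ?thesis using True by simp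
          next
            case False
            then have "M < ratio e y / q" using q by (simp add: field_simps)
            then have "ln M \<le> ln (max 1 (ratio e y / q))" by (subst ln_le_cancel_iff) (auto simp: M_def)
            then have "Suc k \<le> ln (max 1 (ratio e y / q))" by (simp add: M_def)
            then have "ratio e y * Suc k \<le> ratio e y * ln (max 1 (ratio e y / q))"
              using ratio_nonneg by (intro mult_left_mono) auto
            then have "ratio e y \<le> 1 / Suc k * (ratio e y * ln (max 1 (ratio e y / q)))" by (simp add: field_simps)
            moreover have "0 \<le> q * M" using q by (simp add: M_def)
            ultimately show ?thesis by linarith
          qed
          then have "ennreal (ratio e y) \<le> ennreal (q * M + 1 / Suc k * (ratio e y * ln (max 1 (ratio e y / q))))"
            by (rule ennreal_leI)
          also have "\<dots> = ennreal (q * M) + ennreal (1 / Suc k) * ennreal (ratio e y * ln (max 1 (ratio e y / q)))"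
          proof -
            have "0 \<le> ratio e y * ln (max 1 (ratio e y / q))" using ratio_nonneg by simp
            then have "ennreal (1 / Suc k * (ratio e y * ln (max 1 (ratio e y / q)))) =
                ennreal (1 / Suc k) * ennreal (ratio e y * ln (max 1 (ratio e y / q)))" (is "_ = ?X")
              by (intro ennreal_mult) auto
            moreover have "ennreal (q * M + 1 / Suc k * (ratio e y * ln (max 1 (ratio e y / q)))) =
                ennreal (q * M) + ennreal (1 / Suc k * (ratio e y * ln (max 1 (ratio e y / q))))"
              using q ratio_nonneg[of e y] by (intro ennreal_plus) (auto simp: M_def)
            ultimately show ?thesis by (simp only:)
          qed
          finally show ?thesis using True yB by simp
        qed simp
        have "(\<integral>\<^sup>+y. ennreal (ratio e y) * indicator U y \<partial>\<mu>) \<le> (\<integral>\<^sup>+y. ennreal (q * M) * indicator U y +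
            ennreal (1 / Suc k) * (ennreal (ratio e y * ln (max 1 (ratio e y / q))) * indicator (cball o' r) y) \<partial>\<mu>)"
          by (intro nn_integral_mono pt)
        also have "\<dots> = (\<integral>\<^sup>+y. ennreal (q * M) * indicator U y \<partial>\<mu>) +
            (\<integral>\<^sup>+y. ennreal (1 / Suc k) * (ennreal (ratio e y * ln (max 1 (ratio e y / q))) * indicator (cball o' r) y) \<partial>\<mu>)"
          by (rule nn_integral_add) simp_all
        also have "(\<integral>\<^sup>+y. ennreal (q * M) * indicator U y \<partial>\<mu>) = ennreal (q * M) * emeasure \<mu> U"
          by (rule nn_integral_cmult_indicator) simp
        also have "(\<integral>\<^sup>+y. ennreal (1 / Suc k) * (ennreal (ratio e y * ln (max 1 (ratio e y / q))) * indicator (cball o' r) y) \<partial>\<mu>) =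
            ennreal (1 / Suc k) * (\<integral>\<^sup>+y. ennreal (ratio e y * ln (max 1 (ratio e y / q))) * indicator (cball o' r) y \<partial>\<mu>)"
          by (rule nn_integral_cmult) simp
        also have "ennreal (q * M) * emeasure \<mu> U + ennreal (1 / Suc k) * (\<integral>\<^sup>+y. ennreal (ratio e y * ln (max 1 (ratio e y / q))) * indicator (cball o' r) y \<partial>\<mu>)
            \<le> ennreal (q * M) * ennreal \<delta> + ennreal (1 / Suc k) * ennreal (C * V)"
          using LlogL[OF e(1,2), of o'] by (intro add_mono mult_left_mono \<mu>U) (simp_all add: q_def V_def)
        also have "\<dots> = ennreal (q * M * \<delta> + 1 / Suc k * (C * V))"
          using q \<delta> C by (simp add: M_def V_def flip: ennreal_mult ennreal_plus)
        also have "q * M * \<delta> + 1 / Suc k * (C * V) = (1 + C * V) / Suc k"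
          using q by (simp add: \<delta>_def M_def add_divide_distrib)
        finally have "ennreal C1 * (\<integral>\<^sup>+y. ennreal (ratio e y) * indicator U y \<partial>\<mu>) \<le> ennreal C1 * ennreal ((1 + C * V) / Suc k)"
          by (rule mult_left_mono) simp
        also have "\<dots> = ennreal (C1 * (1 + C * V) / Suc k)"
          using C1 C by (simp add: V_def flip: ennreal_mult)
        finally show ?thesis using meas[OF e(1) Wm Um sub] by (rule order_trans[rotated])
      qed
      have "emeasure \<nu> S \<le> emeasure \<nu> (\<Union>n. W n)" unfolding WU using U(2) by (intro emeasure_mono) auto
      also have "\<dots> = (SUP n. emeasure \<nu> (W n))"
        using Wm inc by (intro SUP_emeasure_incseq[symmetric]) auto
      also have "\<dots> \<le> ennreal (C1 * (1 + C * V) / Suc k)" by (intro SUP_least Wb)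
      finally show ?thesis .
    qed
    have "(\<lambda>k. ennreal (C1 * (1 + C * V) * (1 / Suc k))) \<longlonglongrightarrow> ennreal (C1 * (1 + C * V) * 0)"
      using LIMSEQ_inverse_real_of_nat by (intro tendsto_ennrealI tendsto_mult tendsto_const) (simp add: inverse_eq_divide)
    then have "emeasure \<nu> S \<le> ennreal (C1 * (1 + C * V) * 0)"
      by (rule LIMSEQ_le_const) (use bound in auto)
    then show ?thesis by (simp add: S_def r_def)
  qed
  show ?thesis
    unfolding absolutely_continuous_def
  proof
    fix E assume E: "E \<in> null_sets \<mu>"
    then have [measurable]: "E \<in> sets borel" by auto
    have "(\<Union>N. E \<inter> ball o' (Suc N)) \<in> null_sets \<nu>"
      using ball_null[OF E] by (intro null_sets_UN) auto
    moreover have "(\<Union>N::nat. E \<inter> ball o' (Suc N)) = E"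
    proof (intro equalityI subsetI)
      fix x assume "x \<in> E"
      obtain N :: nat where "dist o' x < N" using reals_Archimedean2 by blast
      then have "x \<in> E \<inter> ball o' (Suc N)" using \<open>x \<in> E\<close> by simp
      then show "x \<in> (\<Union>N::nat. E \<inter> ball o' (Suc N))" by blast
    qed blast
    ultimately show "E \<in> null_sets \<nu>" by simp
  qed
qed

lemma density_LlogL:
  obtains h C where "h \<in> borel_measurable borel" "\<And>x. 0 \<le> h x" "\<nu> = density \<mu> (\<lambda>x. ennreal (h x))"
    "AE x in \<mu>. ((\<lambda>r. ratio r x) \<longlongrightarrow> h x) (at_right 0)" "0 \<le> C"
    "\<And>x r. 0 < r \<Longrightarrow> (\<integral>\<^sup>+y. ennreal (h y * ln (max 1 (h y / ratio r x))) * indicator (cball x r) y \<partial>\<mu>)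
       \<le> ennreal (C * measure \<nu> (cball x r))"
proof -
  obtain C where C: "0 \<le> C" and LlogL: "\<And>x\<^sub>0 r\<^sub>0 e. 0 < e \<Longrightarrow> e \<le> r\<^sub>0 \<Longrightarrow>
    (\<integral>\<^sup>+y. ennreal (ratio e y * ln (max 1 (ratio e y / ratio r\<^sub>0 x\<^sub>0))) * indicator (cball x\<^sub>0 r\<^sub>0) y \<partial>\<mu>)
      \<le> ennreal (C * measure \<nu> (cball x\<^sub>0 r\<^sub>0))"
    using LlogL_estimate by blast
  define h where "h x = enn2real (RN_deriv \<mu> \<nu> x)" for x
  have hm[measurable]: "h \<in> borel_measurable borel"
    unfolding h_def using borel_measurable_RN_deriv[of \<mu> \<nu>] by measurable
  have h0: "0 \<le> h x" for x by (simp add: h_def)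
  have sets: "sets \<nu> = sets \<mu>" by simp
  have fin: "AE x in \<mu>. RN_deriv \<mu> \<nu> x \<noteq> \<infinity>"
    by (rule \<mu>.RN_deriv_finite[OF \<nu>.sigma_finite_measure_axioms absolutely_continuous_\<mu>_\<nu> sets])
  have "density \<mu> (\<lambda>x. ennreal (h x)) = density \<mu> (RN_deriv \<mu> \<nu>)"
  proof (rule density_cong)
    show "AE x in \<mu>. ennreal (h x) = RN_deriv \<mu> \<nu> x" using fin by eventually_elim (simp add: h_def less_top)
  qed measurable
  then have \<nu>: "\<nu> = density \<mu> (\<lambda>x. ennreal (h x))"
    using \<mu>.density_RN_deriv[OF absolutely_continuous_\<mu>_\<nu> sets] by simp
  have lim: "AE x in \<mu>. ((\<lambda>r. ratio r x) \<longlongrightarrow> h x) (at_right 0)"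
    unfolding ratio_def
    by (rule Lebesgue_differentiation[OF hm h0 \<nu>]) (simp add: \<nu>.emeasure_ball)
  show ?thesis
  proof (rule that[OF hm h0 \<nu> lim C])
    fix x and r :: real assume r: "0 < r"
    define q where "q = ratio r x"
    have q: "0 < q" using \<mu>.measure_cball_pos[OF r, of x] \<nu>.measure_cball_pos[OF r, of x] by (simp add: q_def ratio_def)
    define e where "e n = r / real (Suc n)" for n
    have e: "0 < e n" "e n \<le> r" for n using r by (auto simp: e_def field_simps)
    have e0: "filterlim e (at_right 0) sequentially"
    proof (rule tendsto_imp_filterlim_at_right)
      have "(\<lambda>n. r * (1 / real (Suc n))) \<longlonglongrightarrow> r * 0"
        using LIMSEQ_inverse_real_of_nat by (intro tendsto_mult tendsto_const) (simp add: inverse_eq_divide)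
      then show "e \<longlonglongrightarrow> 0" by (simp add: e_def[abs_def])
    qed (use e in auto)
    define F where "F t = t * ln (max 1 (t / q))" for t
    define B where "B = cball x r"
    have [measurable]: "B \<in> sets borel" by (simp add: B_def)
    have "AE y in \<mu>. ennreal (F (h y)) * indicator B y = liminf (\<lambda>n. ennreal (F (ratio (e n) y)) * indicator B y)"
      using lim
    proof eventually_elim
      case (elim y)
      have "(\<lambda>n. ratio (e n) y) \<longlonglongrightarrow> h y" by (rule filterlim_compose[OF elim e0])
      then have "(\<lambda>n. F (ratio (e n) y)) \<longlonglongrightarrow> F (h y)"
        unfolding F_def using q by (intro tendsto_intros) auto
      then have "(\<lambda>n. ennreal (F (ratio (e n) y)) * indicator B y) \<longlonglongrightarrow> ennreal (F (h y)) * indicator B y"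
        by (cases "y \<in> B") (auto intro: tendsto_ennrealI)
      then show ?case by (intro lim_imp_Liminf[symmetric]) auto
    qed
    then have "(\<integral>\<^sup>+y. ennreal (F (h y)) * indicator B y \<partial>\<mu>) = (\<integral>\<^sup>+y. liminf (\<lambda>n. ennreal (F (ratio (e n) y)) * indicator B y) \<partial>\<mu>)"
      by (rule nn_integral_cong_AE)
    also have "\<dots> \<le> liminf (\<lambda>n. \<integral>\<^sup>+y. ennreal (F (ratio (e n) y)) * indicator B y \<partial>\<mu>)"
      unfolding F_def by (intro nn_integral_liminf) measurable
    also have "\<dots> \<le> liminf (\<lambda>n. ennreal (C * measure \<nu> (cball x r)))"
      by (intro Liminf_mono always_eventually allI) (use LlogL[OF e] in \<open>simp add: F_def B_def q_def\<close>)
    also have "\<dots> = ennreal (C * measure \<nu> (cball x r))" by (intro Liminf_const) simp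
    finally show "(\<integral>\<^sup>+y. ennreal (h y * ln (max 1 (h y / ratio r x))) * indicator (cball x r) y \<partial>\<mu>)
       \<le> ennreal (C * measure \<nu> (cball x r))" by (simp add: F_def B_def q_def)
  qed
qed

end

context qs_map begin

lemma Jacobian_density:
  obtains h C where "h \<in> borel_measurable borel" "\<And>x. 0 \<le> h x" "\<nu> = density \<mu> (\<lambda>x. ennreal (h x))"
    "AE x in \<mu>. ((\<lambda>r. measure \<nu> (cball x r) / measure \<mu> (cball x r)) \<longlongrightarrow> h x) (at_right 0)" "0 \<le> C"
    "\<And>x r. 0 < r \<Longrightarrow> (\<integral>\<^sup>+y. ennreal (h y * ln (max 1 (h y / (measure \<nu> (cball x r) / measure \<mu> (cball x r))))) * indicator (cball x r) y \<partial>\<mu>)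
       \<le> ennreal (C * measure \<nu> (cball x r))"
proof -
  obtain A' where A': "doubling_measure \<nu> A'" using \<nu>_doubling by blast
  have pair: "doubling_pair \<mu> \<nu> A A'" using A' doubling_measure_axioms by (intro doubling_pair.intro)
  interpret P: doubling_pair \<mu> \<nu> A A' by (rule pair)
  obtain C\<^sub>R where CR: "1 \<le> C\<^sub>R" "\<And>e r x. 0 < e \<Longrightarrow> e \<le> r \<Longrightarrow>
    ennreal (P.ratio r x powr (p / \<alpha>) * measure \<mu> (cball x r)) \<le>
    ennreal C\<^sub>R * (\<integral>\<^sup>+y. ennreal (P.ratio e y powr (p / \<alpha>)) * indicator (cball x (C\<^sub>0 * r)) y \<partial>\<mu>)"
    using reverse_Holder_inequality[OF pair] by blast
  have "reverse_Holder_pair \<mu> \<nu> A A' (p / \<alpha>) C\<^sub>0 C\<^sub>R"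
    using CR p C0 by (intro reverse_Holder_pair.intro pair reverse_Holder_pair_axioms.intro) auto
  then interpret R: regular_reverse_Holder_pair \<mu> \<nu> A A' "p / \<alpha>" C\<^sub>0 C\<^sub>R
    by (intro regular_reverse_Holder_pair.intro regular_doubling_measure_axioms)
  show ?thesis
    by (rule R.density_LlogL[unfolded P.ratio_def, OF that])
qed

end

section \<open>Oscillation of the logarithm of the density\<close>

lemma ln_max_le_self: "ln (max 1 t) \<le> t" if "0 \<le> t" for t :: real
  using ln_le_minus_one[of "max 1 t"] that by (auto simp: max_def split: if_splits)

lemma abs_ln_diff_le:
  assumes "0 < a" "0 < b"
  shows "\<bar>ln a - ln b\<bar> \<le> ln (max 1 (a / b)) + ln (max 1 (b / a :: real))"
proof (cases "a \<le> b")
  case True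
  then have "ln (max 1 (b / a)) = ln b - ln a" "ln (max 1 (a / b)) \<ge> 0" "ln a \<le> ln b"
    using assms by (auto simp: ln_div max_def field_simps)
  then show ?thesis by simp
next
  case False
  then have "ln (max 1 (a / b)) = ln a - ln b" "ln (max 1 (b / a)) \<ge> 0" "ln b \<le> ln a"
    using assms by (auto simp: ln_div max_def field_simps)
  then show ?thesis by simp
qed

context poincare_space begin

text \<open>Bound \<open>|ln h - ln c|\<close> by the sum of \<open>ln (max 1 (h/c))\<close> and \<open>ln (max 1 (c/h))\<close>. The first term
  is at most \<open>h/c\<close>. The second equals \<open>ln (max 1 (c * k(f x)))\<close> almost everywhere, where \<open>k\<close> is
  the density for the inverse map, and is transported to \<open>f(B)\<close>.\<close>

lemma log_Jacobian_estimate: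
  assumes homeo: "homeomorphism UNIV UNIV f g" and qs: "qs_control f"
  obtains h C where "h \<in> borel_measurable borel" "\<And>x. 0 \<le> h x" "AE x in \<mu>. 0 < h x"
    "AE x in \<mu>. ((\<lambda>r. measure \<mu> (f ` cball x r) / measure \<mu> (cball x r)) \<longlongrightarrow> h x) (at_right 0)"
    "0 \<le> C" "\<And>x r. 0 < r \<Longrightarrow> \<exists>c>0. (\<integral>\<^sup>+y. ennreal \<bar>ln (h y) - ln c\<bar> * indicator (ball x r) y \<partial>\<mu>)
       \<le> ennreal (C * measure \<mu> (ball x r))"
proof -
  have fg: "f (g x) = x" and gf: "g (f x) = x" for x using homeo by (auto simp: homeomorphism_def)
  have homeo': "homeomorphism UNIV UNIV g f" using homeo by (rule homeomorphism_symD)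
  have qs': "qs_control g" by (rule qs_control_inverse[OF qs fg])
  interpret F: qs_map \<mu> A \<alpha> \<kappa> p C\<^sub>p C\<^sub>0 f g by unfold_locales (rule homeo qs)+
  interpret G: qs_map \<mu> A \<alpha> \<kappa> p C\<^sub>p C\<^sub>0 g f by unfold_locales (rule homeo' qs')+
  obtain h Cf where hm[measurable]: "h \<in> borel_measurable borel" and h0: "\<And>x. 0 \<le> h x"
    and Fh: "F.\<nu> = density \<mu> (\<lambda>x. ennreal (h x))"
    and hlim: "AE x in \<mu>. ((\<lambda>r. measure F.\<nu> (cball x r) / measure \<mu> (cball x r)) \<longlongrightarrow> h x) (at_right 0)"
    by (rule F.Jacobian_density) blast
  obtain k Ck where km[measurable]: "k \<in> borel_measurable borel" and k0: "\<And>x. 0 \<le> k x"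
    and Gk: "G.\<nu> = density \<mu> (\<lambda>x. ennreal (k x))" and Ck: "0 \<le> Ck"
    and LlogL: "\<And>x r. 0 < r \<Longrightarrow> (\<integral>\<^sup>+y. ennreal (k y * ln (max 1 (k y / (measure G.\<nu> (cball x r) / measure \<mu> (cball x r))))) * indicator (cball x r) y \<partial>\<mu>)
       \<le> ennreal (Ck * measure G.\<nu> (cball x r))"
    by (rule G.Jacobian_density) blast
  have F\<nu>: "F.\<nu> = distr \<mu> borel g" and G\<nu>: "G.\<nu> = distr \<mu> borel f" by (simp_all add: F.\<nu>_def G.\<nu>_def)
  have fm: "f \<in> measurable \<mu> borel" and gm: "g \<in> measurable \<mu> borel" by measurable
  \<comment> \<open>The density of the identity map, computed as that of \<open>g\<close> after \<open>f\<close>.\<close>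
  have "density \<mu> (\<lambda>x. ennreal (h x) * ennreal (k (f x))) = density \<mu> (\<lambda>x. 1)"
  proof (rule measure_eqI)
    fix E assume "E \<in> sets (density \<mu> (\<lambda>x. ennreal (h x) * ennreal (k (f x))))"
    then have E[measurable]: "E \<in> sets borel" by simp
    have "emeasure (density \<mu> (\<lambda>x. ennreal (h x) * ennreal (k (f x)))) E =
        (\<integral>\<^sup>+x. ennreal (h x) * (ennreal (k (f x)) * indicator E x) \<partial>\<mu>)"
      by (subst emeasure_density) (simp_all add: mult.assoc)
    also have "\<dots> = (\<integral>\<^sup>+x. ennreal (k (f x)) * indicator E x \<partial>F.\<nu>)"
      unfolding Fh by (rule nn_integral_density[symmetric]) measurable
    also have "\<dots> = (\<integral>\<^sup>+y. ennreal (k (f (g y))) * indicator E (g y) \<partial>\<mu>)"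
      unfolding F\<nu> by (rule nn_integral_distr[OF gm]) measurable
    also have "\<dots> = (\<integral>\<^sup>+y. indicator E (g y) \<partial>G.\<nu>)"
      unfolding fg Gk by (rule nn_integral_density[symmetric]) measurable
    also have "\<dots> = (\<integral>\<^sup>+x. indicator E (g (f x)) \<partial>\<mu>)"
      unfolding G\<nu> by (rule nn_integral_distr[OF fm]) measurable
    also have "\<dots> = emeasure (density \<mu> (\<lambda>x. 1)) E" unfolding gf by (simp add: density_1)
    finally show "emeasure (density \<mu> (\<lambda>x. ennreal (h x) * ennreal (k (f x)))) E = emeasure (density \<mu> (\<lambda>x. 1)) E" .
  qed simp
  then have "AE x in \<mu>. ennreal (h x) * ennreal (k (f x)) = 1"
    by (intro density_unique) measurable
  then have hk: "AE x in \<mu>. 0 < h x \<and> k (f x) = 1 / h x"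
  proof eventually_elim
    case (elim x)
    then have "ennreal (h x * k (f x)) = ennreal 1" by (simp add: ennreal_mult h0 k0)
    then have 1: "h x * k (f x) = 1" by (subst (asm) ennreal_inj) (auto simp: h0 k0)
    then have "h x \<noteq> 0" by auto
    then show ?case using 1 h0[of x] by (auto simp: field_simps)
  qed
  have m\<nu>: "measure F.\<nu> (cball x r) = measure \<mu> (f ` cball x r)" for x r by (rule F.measure_\<nu>) simp
  obtain H where H: "0 \<le> H" "\<And>x a b. dist x a \<le> 4 * dist x b \<Longrightarrow> dist (f x) (f a) \<le> H * dist (f x) (f b)"
    by (rule F.qs_bound[of 4]) auto
  obtain H' where H': "0 \<le> H'" "\<And>x a b. dist x a \<le> (H + 1) * dist x b \<Longrightarrow> dist (g x) (g a) \<le> H' * dist (g x) (g b)"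
    by (rule G.qs_bound[of "H + 1"]) (use H in auto)
  obtain C\<mu> where C\<mu>: "1 \<le> C\<mu>" and comp: "\<And>x y r r'. 0 < r \<Longrightarrow> r' \<le> H' * r \<Longrightarrow> dist x y \<le> H' * r \<Longrightarrow>
      measure \<mu> (cball y r') \<le> C\<mu> * measure \<mu> (ball x r)"
    using ball_comparison[of H'] by blast
  define C where "C = 1 + (ln C\<mu> + Ck) * C\<mu>"
  have C: "0 \<le> C" using C\<mu> Ck by (simp add: C_def)
  show ?thesis
  proof (rule that[OF hm h0 _ hlim[unfolded m\<nu>] C])
    show "AE x in \<mu>. 0 < h x" using hk by eventually_elim simp
    fix x :: 'a and r :: real assume r: "0 < r"
    define B where "B = ball x r"
    have Bm[measurable]: "B \<in> sets borel" by (simp add: B_def)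
    define m where "m = measure \<mu> B"
    have m: "0 < m" "emeasure \<mu> B = ennreal m" unfolding m_def B_def by (rule measure_ball_pos[OF r], rule emeasure_ball)
    define V where "V = measure F.\<nu> B"
    obtain A' where "doubling_measure F.\<nu> A'" using F.\<nu>_doubling by blast
    then interpret FD: doubling_measure F.\<nu> A' .
    have V: "0 < V" "emeasure F.\<nu> B = ennreal V" unfolding V_def B_def by (rule FD.measure_ball_pos[OF r], rule FD.emeasure_ball)
    define c where "c = V / m"
    have c: "0 < c" using V m by (simp add: c_def)
    obtain b where b: "b \<noteq> x" "dist x b \<le> r / 2" "\<And>K a. 1 \<le> K \<Longrightarrow> dist x a \<le> K * (r / 2) \<Longrightarrow> dist x a \<le> 2 * K * dist x b"
      using nearby_point[of "r / 2" x] r by (metis half_gt_zero)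
    define \<rho> where "\<rho> = (H + 1) * dist (f x) (f b)"
    have "0 < dist (f x) (f b)" using b(1) gf by (metis zero_less_dist_iff)
    then have \<rho>: "0 < \<rho>" using H by (simp add: \<rho>_def)
    define B' where "B' = cball (f x) \<rho>"
    have B'm[measurable]: "B' \<in> sets borel" by (simp add: B'_def)
    have fB: "f y \<in> B'" if "y \<in> B" for y
    proof -
      have "dist x y \<le> 2 * (r / 2)" using that by (simp add: B_def)
      from b(3)[OF _ this] have "dist (f x) (f y) \<le> H * dist (f x) (f b)" by (intro H(2)) simp
      also have "\<dots> \<le> \<rho>" unfolding \<rho>_def by (intro mult_right_mono) auto
      finally show ?thesis by (simp add: B'_def)
    qed
    have gB': "dist x (g y) \<le> H' * r" if "y \<in> B'" for y
    proof -
      have "dist (g (f x)) (g y) \<le> H' * dist (g (f x)) (g (f b))"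
        using that by (intro H'(2)) (simp add: B'_def \<rho>_def)
      also have "\<dots> \<le> H' * r" unfolding gf using b(2) r H' by (intro mult_left_mono) auto
      finally show ?thesis by (simp add: gf)
    qed
    define m' where "m' = measure \<mu> B'"
    define V' where "V' = measure G.\<nu> B'"
    have m': "0 < m'" unfolding m'_def B'_def by (rule measure_cball_pos[OF \<rho>])
    obtain A'' where "doubling_measure G.\<nu> A''" using G.\<nu>_doubling by blast
    then interpret GD: doubling_measure G.\<nu> A'' .
    have V': "0 < V'" "emeasure G.\<nu> B' = ennreal V'"
      unfolding V'_def B'_def by (rule GD.measure_cball_pos[OF \<rho>], rule GD.emeasure_cball)
    have V'm: "V' \<le> C\<mu> * m"
    proof -
      have "V' = measure \<mu> (g ` B')" unfolding V'_def by (rule G.measure_\<nu>) simp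
      also have "\<dots> \<le> measure \<mu> (cball x (H' * r))"
        using gB' by (intro measure_mono_bounded[OF _ order_refl]) (auto intro: G.image_measurable)
      also have "\<dots> \<le> C\<mu> * m" unfolding m_def B_def using r H' by (intro comp) auto
      finally show ?thesis .
    qed
    have Vm': "V \<le> m'"
    proof -
      have "V = measure \<mu> (f ` B)" unfolding V_def by (rule F.measure_\<nu>) simp
      also have "\<dots> \<le> m'" unfolding m'_def
        using fB by (intro measure_mono_bounded[of _ _ "f x" \<rho>]) (auto simp: B'_def[symmetric] intro: F.image_measurable)
      finally show ?thesis .
    qed
    \<comment> \<open>By quasisymmetry of both maps, \<open>c\<close> is at most a constant times the reciprocal of the
        mean \<open>V' / m'\<close> of \<open>k\<close> over \<open>B'\<close>.\<close>
    have cq: "c * k y \<le> C\<mu> * (k y / (V' / m'))" for y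
    proof -
      have "c * V' \<le> C\<mu> * m'"
      proof -
        have "c * V' \<le> c * (C\<mu> * m)" using V'm c by (intro mult_left_mono) auto
        also have "\<dots> = C\<mu> * V" using m by (simp add: c_def)
        also have "\<dots> \<le> C\<mu> * m'" using Vm' C\<mu> by (intro mult_left_mono) auto
        finally show ?thesis .
      qed
      then have "c \<le> C\<mu> * m' / V'" using V' by (simp add: field_simps)
      then have "c * k y \<le> C\<mu> * m' / V' * k y" using k0 by (intro mult_right_mono)
      then show ?thesis by (simp add: mult_ac)
    qed
    have posp: "(\<integral>\<^sup>+y. ennreal (ln (max 1 (h y / c))) * indicator B y \<partial>\<mu>) \<le> ennreal m"
    proof -
      have "(\<integral>\<^sup>+y. ennreal (ln (max 1 (h y / c))) * indicator B y \<partial>\<mu>) \<le> (\<integral>\<^sup>+y. ennreal (1 / c) * (ennreal (h y) * indicator B y) \<partial>\<mu>)"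
      proof (intro nn_integral_mono)
        fix y
        have "ennreal (ln (max 1 (h y / c))) \<le> ennreal (h y / c)" using c h0[of y] by (intro ennreal_leI ln_max_le_self) auto
        also have "\<dots> = ennreal (1 / c) * ennreal (h y)" using c h0[of y] by (simp flip: ennreal_mult)
        finally show "ennreal (ln (max 1 (h y / c))) * indicator B y \<le> ennreal (1 / c) * (ennreal (h y) * indicator B y)"
          by (simp add: indicator_def)
      qed
      also have "\<dots> = ennreal (1 / c) * (\<integral>\<^sup>+y. ennreal (h y) * indicator B y \<partial>\<mu>)" by (rule nn_integral_cmult) measurable
      also have "(\<integral>\<^sup>+y. ennreal (h y) * indicator B y \<partial>\<mu>) = emeasure F.\<nu> B"
        unfolding Fh by (rule emeasure_density[symmetric]) measurable
      also have "ennreal (1 / c) * emeasure F.\<nu> B = ennreal m"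
        unfolding V(2) using V m c by (simp add: c_def flip: ennreal_mult)
      finally show ?thesis .
    qed
    have negp: "(\<integral>\<^sup>+y. ennreal (ln (max 1 (c * k (f y)))) * indicator B y \<partial>\<mu>) \<le> ennreal ((ln C\<mu> + Ck) * C\<mu> * m)"
    proof -
      have "(\<integral>\<^sup>+y. ennreal (ln (max 1 (c * k (f y)))) * indicator B y \<partial>\<mu>) =
          (\<integral>\<^sup>+y. ennreal (ln (max 1 (c * k (f y)))) * indicator B (g (f y)) \<partial>\<mu>)" unfolding gf ..
      also have "\<dots> = (\<integral>\<^sup>+y. ennreal (ln (max 1 (c * k y))) * indicator B (g y) \<partial>G.\<nu>)"
        unfolding G\<nu> by (rule nn_integral_distr[OF fm, symmetric]) measurable
      also have "\<dots> = (\<integral>\<^sup>+y. ennreal (k y) * (ennreal (ln (max 1 (c * k y))) * indicator B (g y)) \<partial>\<mu>)"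
        unfolding Gk by (rule nn_integral_density) measurable
      also have "\<dots> \<le> (\<integral>\<^sup>+y. ennreal (ln C\<mu>) * (ennreal (k y) * indicator B' y) +
          ennreal (k y * ln (max 1 (k y / (V' / m')))) * indicator B' y \<partial>\<mu>)"
      proof (intro nn_integral_mono)
        fix y
        show "ennreal (k y) * (ennreal (ln (max 1 (c * k y))) * indicator B (g y)) \<le>
            ennreal (ln C\<mu>) * (ennreal (k y) * indicator B' y) + ennreal (k y * ln (max 1 (k y / (V' / m')))) * indicator B' y"
        proof (cases "g y \<in> B")
          case True
          then have yB': "y \<in> B'" using fB[OF True] by (simp add: fg)
          let ?t = "k y / (V' / m')"
          have "C\<mu> * ?t \<le> C\<mu> * max 1 ?t" "1 * 1 \<le> C\<mu> * max 1 ?t"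
            using C\<mu> by (intro mult_left_mono, simp, simp, intro mult_mono, auto)
          then have "max 1 (c * k y) \<le> C\<mu> * max 1 ?t" using cq[of y] by simp
          then have "ln (max 1 (c * k y)) \<le> ln (C\<mu> * max 1 ?t)" using C\<mu> by (subst ln_le_cancel_iff) auto
          also have "\<dots> = ln C\<mu> + ln (max 1 ?t)" using C\<mu> by (intro ln_mult_pos) auto
          finally have "k y * ln (max 1 (c * k y)) \<le> k y * (ln C\<mu> + ln (max 1 ?t))" using k0 by (intro mult_left_mono)
          then have "ennreal (k y * ln (max 1 (c * k y))) \<le> ennreal (ln C\<mu> * k y + k y * ln (max 1 ?t))"
            by (intro ennreal_leI) (simp add: algebra_simps)
          also have "\<dots> = ennreal (ln C\<mu>) * ennreal (k y) + ennreal (k y * ln (max 1 ?t))"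
          proof -
            have "0 \<le> ln C\<mu>" "0 \<le> ln (max 1 ?t)" using C\<mu> by auto
            then show ?thesis using k0[of y] by (simp add: ennreal_mult)
          qed
          finally show ?thesis using True yB' k0[of y] by (simp add: ennreal_mult)
        qed simp
      qed
      also have "\<dots> = (\<integral>\<^sup>+y. ennreal (ln C\<mu>) * (ennreal (k y) * indicator B' y) \<partial>\<mu>) +
          (\<integral>\<^sup>+y. ennreal (k y * ln (max 1 (k y / (V' / m')))) * indicator B' y \<partial>\<mu>)"
        by (rule nn_integral_add) measurable
      also have "(\<integral>\<^sup>+y. ennreal (ln C\<mu>) * (ennreal (k y) * indicator B' y) \<partial>\<mu>) = ennreal (ln C\<mu>) * (\<integral>\<^sup>+y. ennreal (k y) * indicator B' y \<partial>\<mu>)"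
        by (rule nn_integral_cmult) measurable
      also have "(\<integral>\<^sup>+y. ennreal (k y) * indicator B' y \<partial>\<mu>) = emeasure G.\<nu> B'"
        unfolding Gk by (rule emeasure_density[symmetric]) measurable
      also have "ennreal (ln C\<mu>) * emeasure G.\<nu> B' + (\<integral>\<^sup>+y. ennreal (k y * ln (max 1 (k y / (V' / m')))) * indicator B' y \<partial>\<mu>)
          \<le> ennreal (ln C\<mu>) * ennreal V' + ennreal (Ck * V')"
        unfolding V'(2) using LlogL[OF \<rho>, of "f x"] by (intro add_left_mono) (simp add: B'_def V'_def m'_def)
      also have "\<dots> = ennreal ((ln C\<mu> + Ck) * V')"
      proof -
        have "0 \<le> ln C\<mu>" using C\<mu> by simp
        then show ?thesis using V' Ck by (simp add: distrib_right flip: ennreal_mult ennreal_plus)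
      qed
      also have "\<dots> \<le> ennreal ((ln C\<mu> + Ck) * C\<mu> * m)"
      proof (rule ennreal_leI)
        have "(ln C\<mu> + Ck) * V' \<le> (ln C\<mu> + Ck) * (C\<mu> * m)" using C\<mu> Ck V'm by (intro mult_left_mono) auto
        then show "(ln C\<mu> + Ck) * V' \<le> (ln C\<mu> + Ck) * C\<mu> * m" by (simp add: mult.assoc)
      qed
      finally show ?thesis .
    qed
    have "(\<integral>\<^sup>+y. ennreal \<bar>ln (h y) - ln c\<bar> * indicator B y \<partial>\<mu>) \<le>
        (\<integral>\<^sup>+y. ennreal (ln (max 1 (h y / c))) * indicator B y + ennreal (ln (max 1 (c * k (f y)))) * indicator B y \<partial>\<mu>)"
    proof (rule nn_integral_mono_AE)
      show "AE y in \<mu>. ennreal \<bar>ln (h y) - ln c\<bar> * indicator B y \<le>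
        ennreal (ln (max 1 (h y / c))) * indicator B y + ennreal (ln (max 1 (c * k (f y)))) * indicator B y"
        using hk
      proof eventually_elim
        case (elim y)
        have "\<bar>ln (h y) - ln c\<bar> \<le> ln (max 1 (h y / c)) + ln (max 1 (c / h y))"
          using elim c by (intro abs_ln_diff_le) auto
        then have "ennreal \<bar>ln (h y) - ln c\<bar> \<le> ennreal (ln (max 1 (h y / c)) + ln (max 1 (c / h y)))"
          by (rule ennreal_leI)
        also have "\<dots> = ennreal (ln (max 1 (h y / c))) + ennreal (ln (max 1 (c / h y)))"
          by (rule ennreal_plus) auto
        finally show ?case using elim by (simp add: indicator_def)
      qed
    qed
    also have "\<dots> = (\<integral>\<^sup>+y. ennreal (ln (max 1 (h y / c))) * indicator B y \<partial>\<mu>) +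
        (\<integral>\<^sup>+y. ennreal (ln (max 1 (c * k (f y)))) * indicator B y \<partial>\<mu>)"
      by (rule nn_integral_add) measurable
    also have "\<dots> \<le> ennreal m + ennreal ((ln C\<mu> + Ck) * C\<mu> * m)" by (intro add_mono posp negp)
    also have "\<dots> = ennreal (C * m)"
    proof -
      have "0 \<le> (ln C\<mu> + Ck) * C\<mu> * m" using C\<mu> Ck m by simp
      then show ?thesis using m by (simp add: C_def distrib_right flip: ennreal_plus)
    qed
    finally show "\<exists>c>0. (\<integral>\<^sup>+y. ennreal \<bar>ln (h y) - ln c\<bar> * indicator (ball x r) y \<partial>\<mu>)
       \<le> ennreal (C * measure \<mu> (ball x r))"
      using c by (intro exI[of _ c]) (simp add: B_def m_def)
  qed
qed

end

section \<open>The generalised Jacobian and bounded mean oscillation\<close>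

text \<open>For a function that is continuous from the right, suprema and infima over intervals may be
  taken over rational radii, so convergence is a condition on countably many values.\<close>

lemma tendsto_at_right_0_iff_rational_limits:
  fixes \<phi> :: "real \<Rightarrow> ennreal"
  assumes rc: "\<And>r. 0 < r \<Longrightarrow> (\<phi> \<longlongrightarrow> \<phi> r) (at_right r)"
  defines "Q \<equiv> \<lambda>n::nat. \<rat> \<inter> {0<..<1 / real (Suc n)}"
  shows "(\<phi> \<longlongrightarrow> L) (at_right 0) \<longleftrightarrow> (INF n. SUP q\<in>Q n. \<phi> q) = L \<and> (SUP n. INF q\<in>Q n. \<phi> q) = L"
proof (intro iffI conjI)
  assume lim: "(\<phi> \<longlongrightarrow> L) (at_right 0)"
  have ex: "\<exists>q\<in>Q n. q < b" if "0 < b" for b n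
  proof -
    have "0 < min b (1 / real (Suc n))" using that by simp
    then obtain q where "q \<in> \<rat>" "0 < q" "q < min b (1 / real (Suc n))" using Rats_dense_in_real by blast
    then show ?thesis by (intro bexI[of _ q]) (auto simp: Q_def)
  qed
  have small: "\<exists>n. \<forall>q\<in>Q n. P q" if ev: "eventually P (at_right 0)" for P
  proof -
    obtain b where b: "0 < b" "\<And>y. 0 < y \<Longrightarrow> y < b \<Longrightarrow> P y"
      using ev unfolding eventually_at_right_field by blast
    obtain n where "1 / real (Suc n) < b" using nat_approx_posE[OF b(1)] by metis
    then show ?thesis using b(2) by (intro exI[of _ n]) (auto simp: Q_def)
  qed
  have often: "\<exists>q\<in>Q n. P q" if ev: "eventually P (at_right 0)" for P n
  proof -
    obtain b where b: "0 < b" "\<And>y. 0 < y \<Longrightarrow> y < b \<Longrightarrow> P y"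
      using ev unfolding eventually_at_right_field by blast
    obtain q where "q \<in> Q n" "q < b" using ex[OF b(1)] by blast
    then show ?thesis using b(2)[of q] by (intro bexI[of _ q]) (auto simp: Q_def)
  qed
  show "(INF n. SUP q\<in>Q n. \<phi> q) = L"
  proof (rule antisym)
    show "(INF n. SUP q\<in>Q n. \<phi> q) \<le> L"
    proof (rule dense_ge)
      fix a assume "L < a"
      then obtain n where "\<forall>q\<in>Q n. \<phi> q < a" using small[OF order_tendstoD(2)[OF lim]] by blast
      then have "(SUP q\<in>Q n. \<phi> q) \<le> a" by (intro SUP_least) (simp add: less_imp_le)
      then show "(INF n. SUP q\<in>Q n. \<phi> q) \<le> a" by (rule INF_lower2[OF UNIV_I])
    qed
    show "L \<le> (INF n. SUP q\<in>Q n. \<phi> q)"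
    proof (rule INF_greatest, rule dense_le)
      fix n a assume "a < L"
      then obtain q where "q \<in> Q n" "a < \<phi> q" using often[OF order_tendstoD(1)[OF lim]] by blast
      then show "a \<le> (SUP q\<in>Q n. \<phi> q)" by (intro SUP_upper2[of q]) auto
    qed
  qed
  show "(SUP n. INF q\<in>Q n. \<phi> q) = L"
  proof (rule antisym)
    show "L \<le> (SUP n. INF q\<in>Q n. \<phi> q)"
    proof (rule dense_le)
      fix a assume "a < L"
      then obtain n where "\<forall>q\<in>Q n. a < \<phi> q" using small[OF order_tendstoD(1)[OF lim]] by blast
      then have "a \<le> (INF q\<in>Q n. \<phi> q)" by (intro INF_greatest) (simp add: less_imp_le)
      then show "a \<le> (SUP n. INF q\<in>Q n. \<phi> q)" by (rule SUP_upper2[OF UNIV_I])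
    qed
    show "(SUP n. INF q\<in>Q n. \<phi> q) \<le> L"
    proof (rule SUP_least, rule dense_ge)
      fix n a assume "L < a"
      then obtain q where "q \<in> Q n" "\<phi> q < a" using often[OF order_tendstoD(2)[OF lim]] by blast
      then show "(INF q\<in>Q n. \<phi> q) \<le> a" by (intro INF_lower2[of q]) auto
    qed
  qed
next
  assume L: "(INF n. SUP q\<in>Q n. \<phi> q) = L \<and> (SUP n. INF q\<in>Q n. \<phi> q) = L"
  have dense: "\<exists>q\<in>Q n. P q" if r: "0 < r" "r < 1 / Suc n" and ev: "eventually P (at_right r)" for r n P
  proof -
    obtain b where b: "r < b" "\<And>y. r < y \<Longrightarrow> y < b \<Longrightarrow> P y"
      using ev unfolding eventually_at_right_field by blast
    have "r < min b (1 / Suc n)" using b r by simp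
    then obtain q where "q \<in> \<rat>" "r < q" "q < min b (1 / Suc n)" using Rats_dense_in_real by blast
    then show ?thesis using b(2) r by (intro bexI[of _ q]) (auto simp: Q_def)
  qed
  have ev: "\<forall>\<^sub>F r in at_right (0::real). 0 < r \<and> r < 1 / real (Suc n)" for n
    by (intro eventually_at_rightI[of 0 "1 / real (Suc n)"]) auto
  show "(\<phi> \<longlongrightarrow> L) (at_right 0)"
  proof (rule order_tendstoI)
    fix a assume "a < L"
    then have "a < (SUP n. INF q\<in>Q n. \<phi> q)" using L by simp
    then obtain n where n: "a < (INF q\<in>Q n. \<phi> q)" unfolding less_SUP_iff by blast
    show "\<forall>\<^sub>F r in at_right 0. a < \<phi> r"
      using ev[of n]
    proof eventually_elim
      case (elim r)
      have "(INF q\<in>Q n. \<phi> q) \<le> \<phi> r"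
      proof (rule ccontr)
        assume "\<not> (INF q\<in>Q n. \<phi> q) \<le> \<phi> r"
        then have "\<phi> r < (INF q\<in>Q n. \<phi> q)" by simp
        then obtain q where "q \<in> Q n" "\<phi> q < (INF q\<in>Q n. \<phi> q)"
          using dense[of r n] order_tendstoD(2)[OF rc[of r]] elim by blast
        then show False using INF_lower[of q "Q n" \<phi>] by simp
      qed
      then show ?case using n by simp
    qed
  next
    fix a assume "L < a"
    then have "(INF n. SUP q\<in>Q n. \<phi> q) < a" using L by simp
    then obtain n where n: "(SUP q\<in>Q n. \<phi> q) < a" unfolding INF_less_iff by blast
    show "\<forall>\<^sub>F r in at_right 0. \<phi> r < a"
      using ev[of n]
    proof eventually_elim
      case (elim r)
      have "\<phi> r \<le> (SUP q\<in>Q n. \<phi> q)"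
      proof (rule ccontr)
        assume "\<not> \<phi> r \<le> (SUP q\<in>Q n. \<phi> q)"
        then have "(SUP q\<in>Q n. \<phi> q) < \<phi> r" by simp
        then obtain q where "q \<in> Q n" "(SUP q\<in>Q n. \<phi> q) < \<phi> q"
          using dense[of r n] order_tendstoD(1)[OF rc[of r]] elim by blast
        then show False using SUP_upper[of q "Q n" \<phi>] by simp
      qed
      then show ?case using n by simp
    qed
  qed
qed

text \<open>Where the limit does not exist, \<open>Lim\<close> is the description operator applied to an empty
  predicate, which is the same value at all such points.\<close>

lemma borel_measurable_Lim_at_right_0:
  fixes \<phi> :: "real \<Rightarrow> 'a \<Rightarrow> ennreal"
  assumes m: "\<And>r. 0 < r \<Longrightarrow> \<phi> r \<in> borel_measurable M"
    and rc: "\<And>r x. 0 < r \<Longrightarrow> ((\<lambda>r. \<phi> r x) \<longlongrightarrow> \<phi> r x) (at_right r)"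
  shows "(\<lambda>x. Lim (at_right 0) (\<lambda>r. \<phi> r x)) \<in> borel_measurable M"
proof -
  define Q where "Q n = \<rat> \<inter> {0<..<1 / real (Suc n)}" for n :: nat
  define l where "l x = (INF n. SUP q\<in>Q n. \<phi> q x)" for x
  define l' where "l' x = (SUP n. INF q\<in>Q n. \<phi> q x)" for x
  have Q: "countable (Q n)" for n unfolding Q_def using countable_rat by (rule countable_Int1)
  have Q0: "0 < q" if "q \<in> Q n" for q n using that by (simp add: Q_def)
  have [measurable]: "l \<in> borel_measurable M"
    unfolding l_def by (intro borel_measurable_INF borel_measurable_SUP Q m) (auto dest: Q0)
  have [measurable]: "l' \<in> borel_measurable M"
    unfolding l'_def by (intro borel_measurable_INF borel_measurable_SUP Q m) (auto dest: Q0)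
  have "((\<lambda>r. \<phi> r x) \<longlongrightarrow> L) (at_right 0) \<longleftrightarrow> l x = L \<and> l' x = L" for x L
    unfolding l_def l'_def Q_def by (rule tendsto_at_right_0_iff_rational_limits[OF rc])
  then have Lim: "Lim (at_right 0) (\<lambda>r. \<phi> r x) = (THE L. l x = L \<and> l' x = L)" for x
    unfolding t2_space_class.Lim_def by simp
  have "Lim (at_right 0) (\<lambda>r. \<phi> r x) = (if l x = l' x then l x else (THE L. False))" for x
  proof (cases "l x = l' x")
    case False
    then have "(\<lambda>L. l x = L \<and> l' x = L) = (\<lambda>L. False)" by auto
    then show ?thesis using False unfolding Lim by simp
  qed (simp add: Lim)
  moreover have "(\<lambda>x. if l x = l' x then l x else (THE L. False)) \<in> borel_measurable M" by measurable
  ultimately show ?thesis by simp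
qed

context doubling_measure begin

lemma measure_cball_right_continuous:
  "((\<lambda>r. measure \<mu> (cball x r)) \<longlongrightarrow> measure \<mu> (cball x r)) (at_right r)"
proof (rule tendsto_at_right_sequentially[of r "r + 1"])
  fix S :: "nat \<Rightarrow> real" assume S: "\<And>n. r < S n" "decseq S" "S \<longlonglongrightarrow> r"
  have "(\<lambda>n. measure \<mu> (cball x (S n))) \<longlonglongrightarrow> measure \<mu> (\<Inter>n. cball x (S n))"
  proof (rule Lim_measure_decseq)
    show "decseq (\<lambda>n. cball x (S n))"
      unfolding decseq_def by (intro allI impI subset_cball decseqD[OF S(2)])
  qed (auto simp: emeasure_cball)
  moreover have "(\<Inter>n. cball x (S n)) = cball x r"
  proof (intro equalityI subsetI)
    fix y assume "y \<in> (\<Inter>n. cball x (S n))"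
    then have "dist x y \<le> S n" for n by auto
    then have "dist x y \<le> r" by (intro LIMSEQ_le_const[OF S(3)]) auto
    then show "y \<in> cball x r" by simp
  next
    fix y assume "y \<in> cball x r"
    then show "y \<in> (\<Inter>n. cball x (S n))" using S(1) by (auto intro: order_trans less_imp_le)
  qed
  ultimately show "(\<lambda>n. measure \<mu> (cball x (S n))) \<longlonglongrightarrow> measure \<mu> (cball x r)" by simp
qed simp

end

text \<open>The average over a ball may be replaced by any constant \<open>c\<close> at the price of a factor 2.\<close>

lemma BMO_I:
  fixes M :: "'a::metric_space measure" and G :: "'a \<Rightarrow> real"
  assumes M: "metric_measure_space M" and G: "G \<in> borel_measurable M" and C: "0 \<le> C"
    and osc: "\<And>x r. 0 < r \<Longrightarrow> \<exists>c. (\<integral>\<^sup>+y. ennreal \<bar>G y - c\<bar> * indicator (ball x r) y \<partial>M) \<le> ennreal (C * measure M (ball x r))"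
  shows "G \<in> BMO M"
proof -
  note [measurable] = G
  have borel: "sets borel \<subseteq> sets M" using M by (simp add: metric_measure_space_def)
  have pos: "0 < emeasure M (ball x r)" and fin: "emeasure M (ball x r) < \<infinity>" if "0 < r" for x r
    using metric_measure_spaceE[OF M] that by metis+
  have main: "set_integrable M (ball x r) G \<and>
      average M (ball x r) (\<lambda>y. \<bar>G y - average M (ball x r) G\<bar>) \<le> 2 * C" if r: "0 < r" for x r
  proof -
    define B where "B = ball x r"
    have [measurable]: "B \<in> sets M" using borel by (auto simp: B_def)
    define m where "m = measure M B"
    have em: "emeasure M B = ennreal m"
      using fin[OF r, of x] by (simp add: B_def m_def emeasure_eq_ennreal_measure)
    have m: "0 < m" using pos[OF r, of x] em by (simp add: B_def)
    obtain c where c: "(\<integral>\<^sup>+y. ennreal \<bar>G y - c\<bar> * indicator B y \<partial>M) \<le> ennreal (C * m)"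
      using osc[OF r, of x] by (auto simp: B_def m_def)
    have nn: "(\<integral>\<^sup>+y. ennreal (norm (indicator B y * (G y - c))) \<partial>M) = (\<integral>\<^sup>+y. ennreal \<bar>G y - c\<bar> * indicator B y \<partial>M)"
      by (intro nn_integral_cong) (auto simp: indicator_def)
    have i1: "integrable M (\<lambda>y. indicator B y * (G y - c))"
    proof (rule integrableI_bounded)
      show "(\<integral>\<^sup>+y. ennreal (norm (indicator B y * (G y - c))) \<partial>M) < \<infinity>"
        unfolding nn using c by (rule le_less_trans) simp
    qed measurable
    have i2: "integrable M (\<lambda>y. indicator B y * k)" for k :: real
      using em by (intro integrable_mult_left integrable_real_indicator) auto
    have iG: "integrable M (\<lambda>y. indicator B y * G y)"
      using Bochner_Integration.integrable_add[OF i1 i2[of c]] by (simp add: algebra_simps)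
    have ia: "integrable M (\<lambda>y. indicator B y * \<bar>G y - k\<bar>)" for k
    proof -
      have "integrable M (\<lambda>y. \<bar>indicator B y * G y - indicator B y * k\<bar>)"
        by (intro integrable_abs Bochner_Integration.integrable_diff iG i2)
      moreover have "\<bar>indicator B y * G y - indicator B y * k\<bar> = indicator B y * \<bar>G y - k\<bar>" for y
        by (simp add: indicator_def)
      ultimately show ?thesis by simp
    qed
    have Ic: "(\<integral>y. indicator B y * \<bar>G y - c\<bar> \<partial>M) \<le> C * m"
    proof -
      have "ennreal (\<integral>y. indicator B y * \<bar>G y - c\<bar> \<partial>M) = (\<integral>\<^sup>+y. ennreal (indicator B y * \<bar>G y - c\<bar>) \<partial>M)"
        by (rule nn_integral_eq_integral[OF ia, symmetric]) simp
      also have "\<dots> = (\<integral>\<^sup>+y. ennreal \<bar>G y - c\<bar> * indicator B y \<partial>M)"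
        by (intro nn_integral_cong) (auto simp: indicator_def)
      finally have "ennreal (\<integral>y. indicator B y * \<bar>G y - c\<bar> \<partial>M) \<le> ennreal (C * m)" using c by simp
      then show ?thesis using m C by (subst (asm) ennreal_le_iff) auto
    qed
    define a where "a = average M B G"
    have "a * m = (\<integral>y. indicator B y * G y \<partial>M)" using m by (simp add: a_def average_def m_def set_lebesgue_integral_def)
    moreover have "c * m = (\<integral>y. indicator B y * c \<partial>M)" by (simp add: m_def)
    ultimately have "(a - c) * m = (\<integral>y. indicator B y * G y - indicator B y * c \<partial>M)"
      using iG i2 by (simp add: left_diff_distrib)
    then have "\<bar>(a - c) * m\<bar> \<le> (\<integral>y. indicator B y * \<bar>G y - c\<bar> \<partial>M)"
      using abs_integral_le_integral[OF Bochner_Integration.integrable_diff[OF iG i2[of c]] ia[of c]]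
      by (simp add: indicator_def)
    then have "\<bar>a - c\<bar> * m \<le> (\<integral>y. indicator B y * \<bar>G y - c\<bar> \<partial>M)" using m by (simp add: abs_mult)
    then have "\<bar>a - c\<bar> * m \<le> C * m" using Ic by linarith
    then have ac: "\<bar>a - c\<bar> \<le> C" using m by simp
    have "(\<integral>y. indicator B y * \<bar>G y - a\<bar> \<partial>M) \<le> (\<integral>y. indicator B y * \<bar>G y - c\<bar> + indicator B y * C \<partial>M)"
      using ac by (intro integral_mono Bochner_Integration.integrable_add ia i2) (auto simp: indicator_def)
    also have "\<dots> = (\<integral>y. indicator B y * \<bar>G y - c\<bar> \<partial>M) + C * m"
      using ia i2 by (simp add: m_def)
    also have "\<dots> \<le> 2 * C * m" using Ic by simp
    finally have "average M B (\<lambda>y. \<bar>G y - a\<bar>) \<le> 2 * C"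
      using m by (simp add: average_def set_lebesgue_integral_def m_def field_simps)
    then show ?thesis using iG by (simp add: set_integrable_def B_def a_def)
  qed
  have "locally_integrable M G"
    unfolding locally_integrable_def
  proof
    fix x show "\<exists>U. open U \<and> x \<in> U \<and> set_integrable M U G"
      using main[of 1 x] by (intro exI[of _ "ball x 1"]) auto
  qed
  then show ?thesis unfolding BMO_def using main by blast
qed

text \<open>For radii that reach the diameter of a bounded space the upper Ahlfors bound is recovered with
  the total mass: then \<open>r\<close> is at least the fixed distance \<open>d(a,b)\<close>.\<close>

lemma poincare_space_of_metric_measure_space:
  fixes M :: "'a::metric_space measure"
  assumes M: "metric_measure_space M" and reg: "borel_regular M" and AR: "ahlfors_regular M \<alpha>"
    and p: "1 \<le> p" "p < \<alpha>" and P: "weak_poincare M p" and nontriv: "\<exists>x y :: 'a. x \<noteq> y"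
  obtains A \<kappa> C\<^sub>p C\<^sub>0 where "poincare_space (distr M borel (\<lambda>x. x)) A \<alpha> \<kappa> p C\<^sub>p C\<^sub>0"
proof -
  define N where "N = distr M borel (\<lambda>x. x)"
  have borel: "sets borel \<subseteq> sets M" and space: "space M = UNIV" using M by (auto simp: metric_measure_space_def)
  have idm: "(\<lambda>x. x) \<in> measurable M borel" using borel space by (intro measurableI) auto
  have eN: "emeasure N E = emeasure M E" if "E \<in> sets borel" for E
    unfolding N_def using that idm space by (simp add: emeasure_distr)
  have mN: "measure N E = measure M E" if "E \<in> sets borel" for E using eN[OF that] by (simp add: measure_def)
  obtain A where A: "1 \<le> A" and pos: "\<And>x r. 0 < r \<Longrightarrow> 0 < emeasure M (ball x r)"
    and fin: "\<And>x r. 0 < r \<Longrightarrow> emeasure M (ball x r) < \<infinity>"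
    and dbl: "\<And>x r. 0 < r \<Longrightarrow> measure M (ball x (2 * r)) \<le> A * measure M (ball x r)"
    using metric_measure_spaceE[OF M] by metis
  have sN: "sets N = sets borel" by (simp add: N_def)
  have dN: "doubling_measure N A"
    by (rule doubling_measure.intro) (use sN pos fin dbl in \<open>simp_all add: eN mN\<close>)
  interpret N: doubling_measure N A by (rule dN)
  obtain \<kappa> where \<kappa>: "1 \<le> \<kappa>" and AR': "\<And>x r. 0 < r \<Longrightarrow> ereal r < ext_diameter (UNIV :: 'a set) \<Longrightarrow>
      ennreal (inverse \<kappa> * r powr \<alpha>) \<le> emeasure M (ball x r) \<and> emeasure M (ball x r) \<le> ennreal (\<kappa> * r powr \<alpha>)"
    using AR unfolding ahlfors_regular_def by blast
  obtain a b :: 'a where ab: "a \<noteq> b" using nontriv by blast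
  have diam: "ereal r < ext_diameter (UNIV :: 'a set)" if "r < dist x y" for r and x y :: 'a
    unfolding ext_diameter_def using that by (intro less_SUP_iff[THEN iffD2] bexI[of _ "(x, y)"]) auto
  have lowerA: "r powr \<alpha> \<le> 2 powr \<alpha> * \<kappa> * measure N (ball z r)" if r: "0 < r" "r \<le> dist x y" for r and x y z :: 'a
  proof -
    have "ennreal (inverse \<kappa> * (r / 2) powr \<alpha>) \<le> emeasure M (ball z (r / 2))"
      using AR'[of "r / 2" z] diam[of "r / 2" x y] r by simp
    also have "\<dots> = ennreal (measure N (ball z (r / 2)))" by (simp add: eN[symmetric] N.emeasure_ball)
    finally have "inverse \<kappa> * (r / 2) powr \<alpha> \<le> measure N (ball z (r / 2))" by (simp add: ennreal_le_iff)
    also have "\<dots> \<le> measure N (ball z r)"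
      using r by (intro N.measure_mono_bounded[OF _ ball_subset_cball]) auto
    finally show ?thesis using \<kappa> r by (simp add: powr_divide field_simps)
  qed
  have upperA: "measure N (ball x r) \<le> (\<kappa> + measure N UNIV / dist a b powr \<alpha>) * r powr \<alpha>" if r: "0 < r" for x r
  proof (cases "\<exists>y z :: 'a. r < dist y z")
    case True
    then have "emeasure M (ball x r) \<le> ennreal (\<kappa> * r powr \<alpha>)" using AR'[OF r] diam by blast
    then have "ennreal (measure N (ball x r)) \<le> ennreal (\<kappa> * r powr \<alpha>)" by (simp add: eN[symmetric] N.emeasure_ball)
    then have "measure N (ball x r) \<le> \<kappa> * r powr \<alpha>" using \<kappa> by (subst (asm) ennreal_le_iff) auto
    also have "\<dots> \<le> (\<kappa> + measure N UNIV / dist a b powr \<alpha>) * r powr \<alpha>" by (intro mult_right_mono) auto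
    finally show ?thesis .
  next
    case False
    then have le: "dist y z \<le> r" for y z :: 'a by (simp add: not_less)
    have "measure N (ball x r) \<le> measure N UNIV"
      by (rule N.measure_mono_bounded[of _ _ x r]) (use le in auto)
    also have "\<dots> = measure N UNIV / dist a b powr \<alpha> * dist a b powr \<alpha>" using ab by simp
    also have "\<dots> \<le> measure N UNIV / dist a b powr \<alpha> * r powr \<alpha>"
      using le p by (intro mult_left_mono powr_mono2) auto
    also have "\<dots> \<le> (\<kappa> + measure N UNIV / dist a b powr \<alpha>) * r powr \<alpha>" using \<kappa> by (intro mult_right_mono) auto
    finally show ?thesis .
  qed
  define \<kappa>' where "\<kappa>' = 2 powr \<alpha> * \<kappa> + (\<kappa> + measure N UNIV / dist a b powr \<alpha>)"
  have \<kappa>'ge: "2 powr \<alpha> * \<kappa> \<le> \<kappa>'" "\<kappa> + measure N UNIV / dist a b powr \<alpha> \<le> \<kappa>'" "1 \<le> \<kappa>'"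
  proof -
    have "0 \<le> 2 powr \<alpha> * \<kappa>" "0 \<le> measure N UNIV / dist a b powr \<alpha>" using \<kappa> by auto
    then show "2 powr \<alpha> * \<kappa> \<le> \<kappa>'" "\<kappa> + measure N UNIV / dist a b powr \<alpha> \<le> \<kappa>'" "1 \<le> \<kappa>'"
      using \<kappa> unfolding \<kappa>'_def by linarith+
  qed
  have av: "average N (ball x r) u = average M (ball x r) u" if [measurable]: "u \<in> borel_measurable borel" for x r u
    unfolding average_def set_lebesgue_integral_def N_def
    by (subst integral_distr[OF idm]) (simp_all add: mN[unfolded N_def])
  show ?thesis
  proof (rule weak_poincare_local_Lipschitz[OF M P p(1)])
    fix C\<^sub>0 C\<^sub>p :: real
    assume C: "1 \<le> C\<^sub>0" "1 \<le> C\<^sub>p" and poin: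
    "\<And>x r u \<Lambda> \<delta>. 0 < r \<Longrightarrow> 0 < \<delta> \<Longrightarrow> bounded (u ` ball x (C\<^sub>0 * r)) \<Longrightarrow>
       \<Lambda> \<in> borel_measurable borel \<Longrightarrow> (\<And>y. 0 \<le> \<Lambda> y) \<Longrightarrow>
       (\<And>y y'. dist y y' < \<delta> \<Longrightarrow> \<bar>u y - u y'\<bar> \<le> \<Lambda> y * dist y y') \<Longrightarrow>
       ennreal (average M (ball x r) (\<lambda>y. \<bar>u y - average M (ball x r) u\<bar>) powr p * measure M (ball x (C\<^sub>0 * r)))
        \<le> ennreal ((2 * C\<^sub>p * r) powr p) * (\<integral>\<^sup>+ y\<in>ball x (C\<^sub>0 * r). ennreal (\<Lambda> y powr p) \<partial>M)"
    have "poincare_space N A \<alpha> \<kappa>' p C\<^sub>p C\<^sub>0"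
    proof (intro poincare_space.intro regular_doubling_measure.intro dN regular_doubling_measure_axioms.intro
        poincare_space_axioms.intro)
      fix E :: "'a set"
      show "E \<in> sets borel \<Longrightarrow> emeasure N E = (INF U\<in>{U. open U \<and> E \<subseteq> U}. emeasure N U)"
      proof -
        assume E: "E \<in> sets borel"
        have "emeasure M E = (INF U\<in>{U. open U \<and> E \<subseteq> U}. emeasure M U)"
          using reg E unfolding borel_regular_def by blast
        also have "\<dots> = (INF U\<in>{U. open U \<and> E \<subseteq> U}. emeasure N U)"
          by (intro INF_cong refl) (auto simp: eN)
        finally show ?thesis by (simp add: eN E)
      qed
    next
      show "1 \<le> p" "p < \<alpha>" "1 \<le> \<kappa>'" "1 \<le> C\<^sub>p" "1 \<le> C\<^sub>0" "\<exists>x y :: 'a. x \<noteq> y" by fact+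
      show "connected (UNIV :: 'a set)" by (rule weak_poincare_connected[OF M P])
      show "measure N (ball x r) \<le> \<kappa>' * r powr \<alpha>" if "0 < r" for x r
        using upperA[OF that, of x] mult_right_mono[OF \<kappa>'ge(2), of "r powr \<alpha>"] by simp
      show "r powr \<alpha> \<le> \<kappa>' * measure N (ball z r)" if "0 < r" "r \<le> dist x y" for r and x y z :: 'a
        using lowerA[OF that, of z] mult_right_mono[OF \<kappa>'ge(1), of "measure N (ball z r)"] by simp
      fix r \<delta> :: real and u \<Lambda> :: "'a \<Rightarrow> real" and x :: 'a
      assume as: "0 < r" "0 < \<delta>" and u: "u \<in> borel_measurable borel" and bdd: "bounded (u ` ball x (C\<^sub>0 * r))"
        and \<Lambda>m: "\<Lambda> \<in> borel_measurable borel" and \<Lambda>0: "\<And>y. 0 \<le> \<Lambda> y"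
        and Lip: "\<And>y y'. dist y y' < \<delta> \<Longrightarrow> \<bar>u y - u y'\<bar> \<le> \<Lambda> y * dist y y'"
      note le = poin[OF as bdd \<Lambda>m \<Lambda>0 Lip]
      have "(\<lambda>y. \<bar>u y - average M (ball x r) u\<bar>) \<in> borel_measurable borel" using u by measurable
      moreover have "(\<lambda>y. ennreal (\<Lambda> y powr p) * indicator (ball x (C\<^sub>0 * r)) y) \<in> borel_measurable borel"
        using \<Lambda>m by measurable
      then have "(\<integral>\<^sup>+ y\<in>ball x (C\<^sub>0 * r). ennreal (\<Lambda> y powr p) \<partial>N) = (\<integral>\<^sup>+ y\<in>ball x (C\<^sub>0 * r). ennreal (\<Lambda> y powr p) \<partial>M)"
        unfolding N_def by (intro nn_integral_distr[OF idm]) simp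
      ultimately show "ennreal (average N (ball x r) (\<lambda>y. \<bar>u y - average N (ball x r) u\<bar>) powr p * measure N (ball x (C\<^sub>0 * r)))
          \<le> ennreal ((2 * C\<^sub>p * r) powr p) * (\<integral>\<^sup>+ y\<in>ball x (C\<^sub>0 * r). ennreal (\<Lambda> y powr p) \<partial>N)"
        using le by (simp add: av u mN)
    qed
    then show ?thesis using that by (simp add: N_def)
  qed
qed

theorem theorem1p2:
  fixes M :: "'a::metric_space measure"
    and f :: "'a \<Rightarrow> 'a"
    and \<eta> :: "real \<Rightarrow> real"
    and \<alpha> p :: real
  assumes "metric_measure_space M"
    and "locally_finite_measure M"
    and "borel_regular M"
    and "closure (measure_support M) = UNIV"
    and "locally_compact_space (euclidean :: 'a topology)"
    and "\<alpha> > 1"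
    and "ahlfors_regular M \<alpha>"
    and "1 \<le> p" and "p < \<alpha>"
    and "weak_poincare M p"
    and "quasisymmetric \<eta> f"
  shows "(AE x in M. \<exists>L<\<infinity>. (jacobian_quotient M f x \<longlongrightarrow> L) (at_right 0)) \<and>
         (AE x in M. 0 < generalised_jacobian M f x) \<and>
         (\<lambda>x. ln (enn2real (generalised_jacobian M f x))) \<in> BMO M"
proof -
  note M = assms(1)
  have borel: "sets borel \<subseteq> sets M" and space: "space M = UNIV" using M by (auto simp: metric_measure_space_def)
  have idm: "(\<lambda>x. x) \<in> measurable M borel" using borel space by (intro measurableI) auto
  define N where "N = distr M borel (\<lambda>x. x)"
  have eN: "emeasure N E = emeasure M E" if "E \<in> sets borel" for E
    unfolding N_def using that idm space by (simp add: emeasure_distr)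
  have AEN: "AE x in M. P x" if "AE x in N. P x" for P
    using AE_distrD[OF idm that[unfolded N_def]] .
  have pos: "0 < emeasure M (ball x r)" and fin: "emeasure M (ball x r) < \<infinity>" if "0 < r" for x r
    using metric_measure_spaceE[OF M] that by metis+
  obtain g where homeo: "homeomorphism UNIV UNIV f g" using assms(11) unfolding quasisymmetric_def by blast
  have qs: "qs_control f" by (rule quasisymmetric_imp_qs_control[OF assms(11)])
  have fUNIV: "f ` UNIV = UNIV" using homeo by (simp add: homeomorphism_def)
  let ?J = "generalised_jacobian M f"
  show ?thesis
  proof (cases "\<exists>x y :: 'a. x \<noteq> y")
    case False
    \<comment> \<open>In a one-point space the Ahlfors condition is void, but the Jacobian quotient is 1 at
        every radius.\<close>
    then have eq: "x = y" for x y :: 'a by blast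
    have single: "S = UNIV" if "S \<noteq> {}" for S :: "'a set" using that eq by (metis UNIV_eq_I ex_in_conv)
    have q1: "jacobian_quotient M f x r = 1" if "0 < r" for x r
    proof -
      have "cball x r = UNIV" by (rule single) (use that in auto)
      moreover have "ball x 1 = UNIV" by (rule single) auto
      ultimately show ?thesis
        using pos[of 1 x] fin[of 1 x] by (simp add: jacobian_quotient_def pullback_measure_def fUNIV)
    qed
    have lim: "(jacobian_quotient M f x \<longlongrightarrow> 1) (at_right 0)" for x
    proof (rule tendsto_eventually)
      show "\<forall>\<^sub>F r in at_right 0. jacobian_quotient M f x r = 1"
        using eventually_at_right_less[of "0::real"] by eventually_elim (rule q1)
    qed
    have J: "?J x = 1" for x
      unfolding generalised_jacobian_def by (rule tendsto_Lim[OF _ lim]) simp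
    have "(\<lambda>x. ln (enn2real (?J x))) \<in> BMO M"
      by (rule BMO_I[OF M, of _ 0]) (auto simp: J intro!: exI[of _ 0])
    moreover have "AE x in M. \<exists>L<\<infinity>. (jacobian_quotient M f x \<longlongrightarrow> L) (at_right 0)"
      using lim by (intro AE_I2 exI[of _ 1]) auto
    ultimately show ?thesis by (simp add: J)
  next
    case True
    obtain A \<kappa> C\<^sub>p C\<^sub>0 where "poincare_space N A \<alpha> \<kappa> p C\<^sub>p C\<^sub>0"
      using poincare_space_of_metric_measure_space[OF M assms(3,7,8,9,10) True] unfolding N_def by metis
    then interpret N: poincare_space N A \<alpha> \<kappa> p C\<^sub>p C\<^sub>0 .
    obtain h C where h[measurable]: "h \<in> borel_measurable borel" and h0: "\<And>x. 0 \<le> h x" and hpos: "AE x in N. 0 < h x"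
      and hlim: "AE x in N. ((\<lambda>r. measure N (f ` cball x r) / measure N (cball x r)) \<longlongrightarrow> h x) (at_right 0)"
      and C: "0 \<le> C" and osc: "\<And>x r. 0 < r \<Longrightarrow> \<exists>c>0. (\<integral>\<^sup>+y. ennreal \<bar>ln (h y) - ln c\<bar> * indicator (ball x r) y \<partial>N)
         \<le> ennreal (C * measure N (ball x r))"
      by (rule N.log_Jacobian_estimate[OF homeo qs]) blast
    interpret F: qs_map N A \<alpha> \<kappa> p C\<^sub>p C\<^sub>0 f g by unfold_locales (rule homeo qs)+
    obtain A' where "doubling_measure F.\<nu> A'" using F.\<nu>_doubling by blast
    then interpret D: doubling_measure F.\<nu> A' .
    have quot: "jacobian_quotient M f x r = ennreal (measure F.\<nu> (cball x r) / measure N (cball x r))" if "0 < r" for x r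
    proof -
      have "jacobian_quotient M f x r = emeasure N (f ` cball x r) / emeasure N (cball x r)"
        unfolding jacobian_quotient_def pullback_measure_def by (simp add: eN F.image_measurable)
      also have "\<dots> = emeasure F.\<nu> (cball x r) / emeasure N (cball x r)" by (simp add: F.emeasure_\<nu>)
      also have "\<dots> = ennreal (measure F.\<nu> (cball x r) / measure N (cball x r))"
        unfolding D.emeasure_cball N.emeasure_cball using N.measure_cball_pos[OF that] by (intro divide_ennreal) auto
      finally show ?thesis .
    qed
    have ev0: "\<forall>\<^sub>F r in at_right (0::real). 0 < r" by (rule eventually_at_right_less)
    have lim: "AE x in N. (jacobian_quotient M f x \<longlongrightarrow> ennreal (h x)) (at_right 0)"
      using hlim
    proof eventually_elim
      case (elim x)
      have "((\<lambda>r. ennreal (measure F.\<nu> (cball x r) / measure N (cball x r))) \<longlongrightarrow> ennreal (h x)) (at_right 0)"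
        using elim by (intro tendsto_ennrealI) (simp add: F.measure_\<nu>)
      moreover have "\<forall>\<^sub>F r in at_right 0. ennreal (measure F.\<nu> (cball x r) / measure N (cball x r)) = jacobian_quotient M f x r"
        using ev0 by eventually_elim (simp add: quot)
      ultimately show ?case by (rule Lim_transform_eventually)
    qed
    then have Jh: "AE x in N. ?J x = ennreal (h x)"
    proof eventually_elim
      case (elim x)
      then show ?case unfolding generalised_jacobian_def by (intro tendsto_Lim) auto
    qed
    have "?J = (\<lambda>x. Lim (at_right 0) (\<lambda>r. ennreal (measure F.\<nu> (cball x r) / measure N (cball x r))))"
    proof
      fix x
      have "(jacobian_quotient M f x \<longlongrightarrow> L) (at_right 0) \<longleftrightarrow>
          ((\<lambda>r. ennreal (measure F.\<nu> (cball x r) / measure N (cball x r))) \<longlongrightarrow> L) (at_right 0)" for L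
        by (rule tendsto_cong) (use ev0 in eventually_elim, simp add: quot)
      then show "?J x = Lim (at_right 0) (\<lambda>r. ennreal (measure F.\<nu> (cball x r) / measure N (cball x r)))"
        unfolding generalised_jacobian_def t2_space_class.Lim_def by simp
    qed
    moreover have "\<dots> \<in> borel_measurable borel"
    proof (rule borel_measurable_Lim_at_right_0)
      fix r :: real assume "0 < r"
      show "(\<lambda>x. ennreal (measure F.\<nu> (cball x r) / measure N (cball x r))) \<in> borel_measurable borel" by measurable
      fix x
      show "((\<lambda>r. ennreal (measure F.\<nu> (cball x r) / measure N (cball x r))) \<longlongrightarrow>
          ennreal (measure F.\<nu> (cball x r) / measure N (cball x r))) (at_right r)"
        using N.measure_cball_pos[OF \<open>0 < r\<close>, of x]
        by (intro tendsto_ennrealI tendsto_divide D.measure_cball_right_continuous N.measure_cball_right_continuous) simp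
    qed
    ultimately have Jm[measurable]: "?J \<in> borel_measurable borel" by simp
    define G where "G x = ln (enn2real (?J x))" for x
    have Gm[measurable]: "G \<in> borel_measurable borel" unfolding G_def by measurable
    have GM: "G \<in> borel_measurable M" using measurable_comp[OF idm Gm] by (simp add: comp_def)
    have "G \<in> BMO M"
    proof (rule BMO_I[OF M GM C])
      fix x :: 'a and r :: real assume r: "0 < r"
      obtain c where c: "(\<integral>\<^sup>+y. ennreal \<bar>ln (h y) - ln c\<bar> * indicator (ball x r) y \<partial>N) \<le> ennreal (C * measure N (ball x r))"
        using osc[OF r, of x] by blast
      have "(\<integral>\<^sup>+y. ennreal \<bar>G y - ln c\<bar> * indicator (ball x r) y \<partial>M) = (\<integral>\<^sup>+y. ennreal \<bar>G y - ln c\<bar> * indicator (ball x r) y \<partial>N)"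
        unfolding N_def by (rule nn_integral_distr[OF idm, symmetric]) measurable
      also have "\<dots> = (\<integral>\<^sup>+y. ennreal \<bar>ln (h y) - ln c\<bar> * indicator (ball x r) y \<partial>N)"
        using Jh by (intro nn_integral_cong_AE) (auto simp: G_def h0 elim!: eventually_mono)
      also have "\<dots> \<le> ennreal (C * measure M (ball x r))"
        using c eN[of "ball x r"] by (simp add: measure_def)
      finally show "\<exists>c. (\<integral>\<^sup>+y. ennreal \<bar>G y - c\<bar> * indicator (ball x r) y \<partial>M) \<le> ennreal (C * measure M (ball x r))" by blast
    qed
    moreover have "AE x in M. \<exists>L<\<infinity>. (jacobian_quotient M f x \<longlongrightarrow> L) (at_right 0)"
    proof (rule AEN)
      show "AE x in N. \<exists>L<\<infinity>. (jacobian_quotient M f x \<longlongrightarrow> L) (at_right 0)"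
        using lim by eventually_elim (auto intro!: exI[of _ "ennreal _"])
    qed
    moreover have "AE x in M. 0 < ?J x"
    proof (rule AEN)
      show "AE x in N. 0 < ?J x" using Jh hpos by eventually_elim simp
    qed
    ultimately show ?thesis by (simp add: G_def[abs_def])
  qed
qed

end
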